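(* Let $Q=\overline{\mathbb{A}_2}^{[1,2]}$ be the quiver with vertices $1,2$, arrows $a_1:1\to2$, $b_1:2\to1$, and loops $\varepsilon_1$ at $1$ and $\varepsilon_2$ at $2$, and let $$W_2^{[1,2]}=2\varepsilon_1^3+3\varepsilon_1a_1b_1+3\varepsilon_2b_1a_1+\varepsilon_2^3 .$$ Let $\Lambda=\widehat{\mathrm{J}}(Q,W_2^{[1,2]})$ be the completed Jacobian algebra. The 2-cyclic Caldero–Chapoton map $CC(-):\operatorname{mod}\Lambda\to\mathbb{Z}[x_1^{\pm1},x_2^{\pm1}]$ provides a bijection between the indecomposable $\tau$-rigid modules in $\operatorname{mod}\Lambda$ (up to isomorphism) and the non-initial cluster variables of the generalized cluster algebra $\mathcal{A}(\overline{\mathbb{A}_2}^{[1,2]})$, which are $$\frac{3x_2}{x_1},\ \frac{3x_1}{x_2},\ \frac{9}{x_1},\ \frac{9}{x_2}.$$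
   Context: $K$ is an algebraically closed field. Paths are written left to right. $\widehat{KQ}$ is the completion of the path algebra with respect to the ideal generated by the arrows; for an arrow $a$ and a cycle $p$, $\partial_a(p)$ is the sum of $vu$ over all decompositions $p=uav$; the completed Jacobian algebra $\widehat{\mathrm{J}}(Q,W)$ is $\widehat{KQ}$ modulo the closure of the two-sided ideal generated by all $\partial_a(W)$, $a\in Q_1$. Finite-dimensional modules are identified with finite-dimensional representations $M=(M_i,\ M_a:M_{s(a)}\to M_{t(a)})$ of $Q$ satisfying the relations; $P_i$ is the indecomposable projective at vertex $i$. A module $M$ is $\tau$-rigid if $\operatorname{Hom}(M,\tau M)=0$, with $\tau$ the Auslander–Reiten translation. If $\bigoplus_i P_i^{b_i}\to\bigoplus_i P_i^{a_i}\to M\to 0$ is the minimal projective presentation of $M$, its $g$-vector is $g_M=(a_i-b_i)_i\in\mathbb{Z}^n$, $n$ being the number of vertices. For $e\in\mathbb{N}^n$, $\mathrm{Gr}_e(M)$ is the quiver Grassmannian (the variety of subrepresentations of $M$ with dimension vector $e$) and $\chi$ is the Euler characteristic. With $x^{a}=x_1^{a_1}\cdots x_n^{a_n}$, the 2-cyclic Caldero–Chapoton map is $$CC(M)=\Big(\sum_{e\in\mathbb{N}^n}\chi(\mathrm{Gr}_e(M))\Big)x^{-g_M}.$$ $\mathcal{A}(\overline{\mathbb{A}_2}^{[1,2]})$ is the Paquette–Schiffler generalized cluster algebra of a sphere with one puncture, one puncture of order $3$ and one orbifold point; it is the subalgebra of $\mathbb{Z}[x_1^{\pm1},x_2^{\pm1}]$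 generated by its cluster variables $x_1,x_2,\frac{3x_2}{x_1},\frac{3x_1}{x_2},\frac{9}{x_1},\frac{9}{x_2}$, of which $x_1,x_2$ are the initial ones.
   Formalization: The field K is assumed to have characteristic different from 2 and 3; in characteristic 3 all relations vanish and no nonzero finite-dimensional module is τ-rigid, and in characteristic 2 the projective P_1 is infinite-dimensional and 9/x_1 is not attained, so the claim fails there. *)

theory Defs
  imports
    "HOL-Computational_Algebra.Polynomial"
    "HOL-Library.Poly_Mapping"
    "HOL-Library.Function_Algebras"
    "HOL-Algebra.QuotRing"
    "HOL-Algebra.Module"
begin

section \<open>Completed path algebras and completed Jacobian algebras\<close>

text \<open>A finite quiver is given by its source and target maps \<open>src, tgt :: 'a \<Rightarrow> 'v\<close>. A path
  is a start vertex together with a list of arrows, written left to right; \<open>(i, [])\<close> is the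
  trivial path at \<open>i\<close>.\<close>

type_synonym ('v, 'a) path = "'v \<times> 'a list"

definition is_path :: "('a \<Rightarrow> 'v) \<Rightarrow> ('a \<Rightarrow> 'v) \<Rightarrow> ('v, 'a) path \<Rightarrow> bool" where
  "is_path src tgt p \<longleftrightarrow>
     (snd p \<noteq> [] \<longrightarrow> src (hd (snd p)) = fst p) \<and>
     (\<forall>k. Suc k < length (snd p) \<longrightarrow> tgt (snd p ! k) = src (snd p ! Suc k))"

definition path_end :: "('a \<Rightarrow> 'v) \<Rightarrow> ('v, 'a) path \<Rightarrow> 'v" where
  "path_end tgt p = (if snd p = [] then fst p else tgt (last (snd p)))"

text \<open>Since the quiver is finite, the completion of the path algebra at the arrow ideal is the
  ring of all formal (possibly infinite) linear combinations of paths; its elements are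
  represented by their coefficient functions.\<close>

definition completed_path_algebra ::
  "('a::finite \<Rightarrow> 'v::finite) \<Rightarrow> ('a \<Rightarrow> 'v) \<Rightarrow> (('v, 'a) path \<Rightarrow> 'k::field) ring" where
  "completed_path_algebra src tgt =
     \<lparr> carrier = {f. \<forall>p. f p \<noteq> 0 \<longrightarrow> is_path src tgt p},
       mult = (\<lambda>f g p. \<Sum>k\<le>length (snd p).
                 f (fst p, take k (snd p)) *
                 g (path_end tgt (fst p, take k (snd p)), drop k (snd p))),
       one = (\<lambda>p. if snd p = [] then 1 else 0),
       zero = (\<lambda>p. 0),
       add = (\<lambda>f g p. f p + g p) \<rparr>"

definition path_elt :: "('v, 'a) path \<Rightarrow> ('v, 'a) path \<Rightarrow> 'k::field" where
  "path_elt p = (\<lambda>q. if q = p then 1 else 0)"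

text \<open>The cyclic derivative of a (possibly infinite) combination \<open>W\<close> of cycles: the coefficient
  of \<open>\<partial>\<^sub>a W\<close> at a path \<open>q\<close> is the sum of the coefficients of \<open>W\<close> at the cycles \<open>u a v\<close>, over
  all factorisations \<open>q = v u\<close>. Such a \<open>q\<close> starts at the target of \<open>a\<close>, and \<open>u a v\<close> starts
  where \<open>v\<close> ends.\<close>

definition cyclic_derivative ::
  "('a \<Rightarrow> 'v) \<Rightarrow> 'a \<Rightarrow> (('v, 'a) path \<Rightarrow> 'k::field) \<Rightarrow> ('v, 'a) path \<Rightarrow> 'k" where
  "cyclic_derivative tgt a W q =
     (if fst q = tgt a
      then \<Sum>(v, u) \<in> {(v, u). v @ u = snd q}. W (path_end tgt (fst q, v), u @ [a] @ v)
      else 0)"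

text \<open>Closure in the topology defined by the powers of the arrow ideal; the \<open>n\<close>-th power
  consists of the combinations of paths of length at least \<open>n\<close>.\<close>

definition adic_closure ::
  "(('v, 'a) path \<Rightarrow> 'k::field) set \<Rightarrow> (('v, 'a) path \<Rightarrow> 'k) set" where
  "adic_closure I = {f. \<forall>n. \<exists>g\<in>I. \<forall>p. length (snd p) < n \<longrightarrow> f p = g p}"

definition jacobian_ideal ::
  "('a::finite \<Rightarrow> 'v::finite) \<Rightarrow> ('a \<Rightarrow> 'v) \<Rightarrow> (('v, 'a) path \<Rightarrow> 'k::field)
     \<Rightarrow> (('v, 'a) path \<Rightarrow> 'k) set" where
  "jacobian_ideal src tgt W =
     adic_closure (genideal (completed_path_algebra src tgt)
                     (range (\<lambda>a. cyclic_derivative tgt a W)))"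

text \<open>A \<open>K\<close>-algebra with distinguished elements: \<open>scal c\<close> is \<open>c \<cdot> 1\<close> and \<open>idem i\<close> is the
  idempotent \<open>e\<^sub>i\<close> of the vertex \<open>i\<close>.\<close>

record ('r, 'k, 'v) vertex_algebra = "'r ring" +
  scal :: "'k \<Rightarrow> 'r"
  idem :: "'v \<Rightarrow> 'r"

definition completed_jacobian_algebra ::
  "('a::finite \<Rightarrow> 'v::finite) \<Rightarrow> ('a \<Rightarrow> 'v) \<Rightarrow> (('v, 'a) path \<Rightarrow> 'k::field)
     \<Rightarrow> ((('v, 'a) path \<Rightarrow> 'k) set, 'k, 'v) vertex_algebra" where
  "completed_jacobian_algebra src tgt W =
     (let R = completed_path_algebra src tgt; J = jacobian_ideal src tgt W in
      ring.extend (R Quot J)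
        (vertex_algebra.fields
           (\<lambda>c. J +>\<^bsub>R\<^esub> (\<lambda>p. if snd p = [] then c else 0))
           (\<lambda>i. J +>\<^bsub>R\<^esub> path_elt (i, []))))"


section \<open>Finite-dimensional modules\<close>

text \<open>With paths written left to right, representations \<open>(M\<^sub>i, M\<^sub>a : M\<^bsub>s(a)\<^esub> \<rightarrow> M\<^bsub>t(a)\<^esub>)\<close>
  satisfying the relations are right modules: \<open>M\<^sub>i = M e\<^sub>i\<close> and \<open>M\<^sub>a\<close> is right multiplication
  by \<open>a\<close>. The module record is reused with \<open>r \<odot> x\<close> standing for \<open>x r\<close>; its fields
  \<^term>\<open>mult\<close> and \<^term>\<open>one\<close> play no role.\<close>

definition right_module ::
  "('r, 'k, 'v) vertex_algebra \<Rightarrow> ('r, 'm) module \<Rightarrow> bool" where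
  "right_module A M \<longleftrightarrow> abelian_group M \<and>
     (\<forall>r\<in>carrier A. \<forall>x\<in>carrier M. r \<odot>\<^bsub>M\<^esub> x \<in> carrier M) \<and>
     (\<forall>r\<in>carrier A. \<forall>x\<in>carrier M. \<forall>y\<in>carrier M.
        r \<odot>\<^bsub>M\<^esub> (x \<oplus>\<^bsub>M\<^esub> y) = r \<odot>\<^bsub>M\<^esub> x \<oplus>\<^bsub>M\<^esub> r \<odot>\<^bsub>M\<^esub> y) \<and>
     (\<forall>r\<in>carrier A. \<forall>s\<in>carrier A. \<forall>x\<in>carrier M.
        (r \<oplus>\<^bsub>A\<^esub> s) \<odot>\<^bsub>M\<^esub> x = r \<odot>\<^bsub>M\<^esub> x \<oplus>\<^bsub>M\<^esub> s \<odot>\<^bsub>M\<^esub> x) \<and>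
     (\<forall>r\<in>carrier A. \<forall>s\<in>carrier A. \<forall>x\<in>carrier M.
        (r \<otimes>\<^bsub>A\<^esub> s) \<odot>\<^bsub>M\<^esub> x = s \<odot>\<^bsub>M\<^esub> (r \<odot>\<^bsub>M\<^esub> x)) \<and>
     (\<forall>x\<in>carrier M. \<one>\<^bsub>A\<^esub> \<odot>\<^bsub>M\<^esub> x = x)"

definition finite_dimensional ::
  "('r, 'k, 'v) vertex_algebra \<Rightarrow> ('r, 'm) module \<Rightarrow> bool" where
  "finite_dimensional A M \<longleftrightarrow>
     (\<exists>B. finite B \<and> B \<subseteq> carrier M \<and>
        (\<forall>x\<in>carrier M. \<exists>c. x = (\<Oplus>\<^bsub>M\<^esub>b\<in>B. scal A (c b) \<odot>\<^bsub>M\<^esub> b)))"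

definition mod_fd :: "('r, 'k, 'v) vertex_algebra \<Rightarrow> ('r, 'm) module set" where
  "mod_fd A = {M. right_module A M \<and> finite_dimensional A M}"

definition rhom ::
  "('r, 'k, 'v) vertex_algebra \<Rightarrow> ('r, 'm) module \<Rightarrow> ('r, 'n) module \<Rightarrow> ('m \<Rightarrow> 'n) set" where
  "rhom A M N = {f \<in> carrier M \<rightarrow>\<^sub>E carrier N.
     (\<forall>x\<in>carrier M. \<forall>y\<in>carrier M. f (x \<oplus>\<^bsub>M\<^esub> y) = f x \<oplus>\<^bsub>N\<^esub> f y) \<and>
     (\<forall>r\<in>carrier A. \<forall>x\<in>carrier M. f (r \<odot>\<^bsub>M\<^esub> x) = r \<odot>\<^bsub>N\<^esub> f x)}"

definition rmod_iso ::
  "('r, 'k, 'v) vertex_algebra \<Rightarrow> ('r, 'm) module \<Rightarrow> ('r, 'n) module \<Rightarrow> bool" where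
  "rmod_iso A M N \<longleftrightarrow> (\<exists>f\<in>rhom A M N. bij_betw f (carrier M) (carrier N))"

definition rsubmodule ::
  "('r, 'k, 'v) vertex_algebra \<Rightarrow> 'm set \<Rightarrow> ('r, 'm) module \<Rightarrow> bool" where
  "rsubmodule A N M \<longleftrightarrow> additive_subgroup N M \<and>
     (\<forall>r\<in>carrier A. \<forall>x\<in>N. r \<odot>\<^bsub>M\<^esub> x \<in> N)"

definition indecomposable ::
  "('r, 'k, 'v) vertex_algebra \<Rightarrow> ('r, 'm) module \<Rightarrow> bool" where
  "indecomposable A M \<longleftrightarrow> carrier M \<noteq> {\<zero>\<^bsub>M\<^esub>} \<and>
     (\<forall>N N'. rsubmodule A N M \<and> rsubmodule A N' M \<and>
             N <+>\<^bsub>M\<^esub> N' = carrier M \<and> N \<inter> N' = {\<zero>\<^bsub>M\<^esub>} \<longrightarrow>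
             N = {\<zero>\<^bsub>M\<^esub>} \<or> N' = {\<zero>\<^bsub>M\<^esub>})"


section \<open>Minimal projective presentations, g-vectors and the Auslander-Reiten translation\<close>

text \<open>\<open>proj_sum A a\<close> is \<open>\<Oplus>\<^sub>i P\<^sub>i\<^bsup>a\<^sub>i\<^esup>\<close> with \<open>P\<^sub>i = e\<^sub>i A\<close>; an element \<open>u\<close> has the component
  \<open>u i k\<close> in the \<open>k\<close>-th copy of \<open>P\<^sub>i\<close>, for \<open>k < a i\<close>.\<close>

definition proj_sum ::
  "('r, 'k, 'v) vertex_algebra \<Rightarrow> ('v \<Rightarrow> nat) \<Rightarrow> ('r, 'v \<Rightarrow> nat \<Rightarrow> 'r) module" where
  "proj_sum A a =
     \<lparr> carrier = {u. \<forall>i k. if k < a i then u i k \<in> {idem A i \<otimes>\<^bsub>A\<^esub> r | r. r \<in> carrier A}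
                            else u i k = \<zero>\<^bsub>A\<^esub>},
       mult = undefined, one = undefined,
       zero = (\<lambda>i k. \<zero>\<^bsub>A\<^esub>),
       add = (\<lambda>u v i k. u i k \<oplus>\<^bsub>A\<^esub> v i k),
       smult = (\<lambda>r u i k. u i k \<otimes>\<^bsub>A\<^esub> r) \<rparr>"

definition superfluous ::
  "('r, 'k, 'v) vertex_algebra \<Rightarrow> 'm set \<Rightarrow> ('r, 'm) module \<Rightarrow> bool" where
  "superfluous A N M \<longleftrightarrow>
     (\<forall>X. rsubmodule A X M \<and> N <+>\<^bsub>M\<^esub> X = carrier M \<longrightarrow> X = carrier M)"

definition hom_kernel :: "('r, 'm) module \<Rightarrow> ('r, 'n) module \<Rightarrow> ('m \<Rightarrow> 'n) \<Rightarrow> 'm set" where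
  "hom_kernel M N f = {x \<in> carrier M. f x = \<zero>\<^bsub>N\<^esub>}"

text \<open>\<open>proj_sum A b \<rightarrow> proj_sum A a \<rightarrow> M \<rightarrow> 0\<close>, by \<open>f\<close> and \<open>q\<close>, is exact, \<open>q\<close> is a projective
  cover of \<open>M\<close> and \<open>f\<close> induces a projective cover of the kernel of \<open>q\<close>.\<close>

definition minimal_presentation ::
  "('r, 'k, 'v) vertex_algebra \<Rightarrow> ('v \<Rightarrow> nat) \<Rightarrow> ('v \<Rightarrow> nat)
     \<Rightarrow> (('v \<Rightarrow> nat \<Rightarrow> 'r) \<Rightarrow> ('v \<Rightarrow> nat \<Rightarrow> 'r)) \<Rightarrow> (('v \<Rightarrow> nat \<Rightarrow> 'r) \<Rightarrow> 'm)
     \<Rightarrow> ('r, 'm) module \<Rightarrow> bool" where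
  "minimal_presentation A a b f q M \<longleftrightarrow>
     f \<in> rhom A (proj_sum A b) (proj_sum A a) \<and> q \<in> rhom A (proj_sum A a) M \<and>
     q ` carrier (proj_sum A a) = carrier M \<and>
     f ` carrier (proj_sum A b) = hom_kernel (proj_sum A a) M q \<and>
     superfluous A (hom_kernel (proj_sum A a) M q) (proj_sum A a) \<and>
     superfluous A (hom_kernel (proj_sum A b) (proj_sum A a) f) (proj_sum A b)"

definition g_vector ::
  "('r, 'k, 'v) vertex_algebra \<Rightarrow> ('r, 'm) module \<Rightarrow> 'v \<Rightarrow> int" where
  "g_vector A M = (THE g. \<exists>a b f q. minimal_presentation A a b f q M \<and>
                            g = (\<lambda>i. int (a i) - int (b i)))"

definition regular_module :: "('r, 'k, 'v) vertex_algebra \<Rightarrow> ('r, 'r) module" where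
  "regular_module A =
     \<lparr> carrier = carrier A, mult = undefined, one = undefined, zero = \<zero>\<^bsub>A\<^esub>,
       add = add A, smult = (\<lambda>r x. x \<otimes>\<^bsub>A\<^esub> r) \<rparr>"

text \<open>\<open>proj_dual A b\<close> is the left module \<open>P\<^sup>* = Hom(P, A)\<close> for \<open>P = proj_sum A b\<close>, and
  \<open>nakayama A b\<close> is \<open>\<nu>P = D Hom(P, A)\<close> with \<open>D = Hom\<^sub>K(-, K)\<close>. The left action on \<open>P\<^sup>*\<close> is
  \<open>(r g)(p) = r g(p)\<close>, and it induces the right action \<open>(l r)(g) = l(r g)\<close> on \<open>\<nu>P\<close>.\<close>

definition proj_dual ::
  "('r, 'k, 'v) vertex_algebra \<Rightarrow> ('v \<Rightarrow> nat) \<Rightarrow> (('v \<Rightarrow> nat \<Rightarrow> 'r) \<Rightarrow> 'r) set" where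
  "proj_dual A b = rhom A (proj_sum A b) (regular_module A)"

definition dual_add ::
  "('r, 'k, 'v) vertex_algebra \<Rightarrow> ('v \<Rightarrow> nat) \<Rightarrow> (('v \<Rightarrow> nat \<Rightarrow> 'r) \<Rightarrow> 'r)
     \<Rightarrow> (('v \<Rightarrow> nat \<Rightarrow> 'r) \<Rightarrow> 'r) \<Rightarrow> (('v \<Rightarrow> nat \<Rightarrow> 'r) \<Rightarrow> 'r)" where
  "dual_add A b g h = restrict (\<lambda>p. g p \<oplus>\<^bsub>A\<^esub> h p) (carrier (proj_sum A b))"

definition dual_smult ::
  "('r, 'k, 'v) vertex_algebra \<Rightarrow> ('v \<Rightarrow> nat) \<Rightarrow> 'r
     \<Rightarrow> (('v \<Rightarrow> nat \<Rightarrow> 'r) \<Rightarrow> 'r) \<Rightarrow> (('v \<Rightarrow> nat \<Rightarrow> 'r) \<Rightarrow> 'r)" where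
  "dual_smult A b r g = restrict (\<lambda>p. r \<otimes>\<^bsub>A\<^esub> g p) (carrier (proj_sum A b))"

definition nakayama ::
  "('r, 'k::field, 'v) vertex_algebra \<Rightarrow> ('v \<Rightarrow> nat)
     \<Rightarrow> ('r, (('v \<Rightarrow> nat \<Rightarrow> 'r) \<Rightarrow> 'r) \<Rightarrow> 'k) module" where
  "nakayama A b =
     \<lparr> carrier = {l \<in> proj_dual A b \<rightarrow>\<^sub>E UNIV.
          (\<forall>g\<in>proj_dual A b. \<forall>h\<in>proj_dual A b. l (dual_add A b g h) = l g + l h) \<and>
          (\<forall>c. \<forall>g\<in>proj_dual A b. l (dual_smult A b (scal A c) g) = c * l g)},
       mult = undefined, one = undefined,
       zero = restrict (\<lambda>g. 0) (proj_dual A b),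
       add = (\<lambda>l m. restrict (\<lambda>g. l g + m g) (proj_dual A b)),
       smult = (\<lambda>r l. restrict (\<lambda>g. l (dual_smult A b r g)) (proj_dual A b)) \<rparr>"

text \<open>\<open>\<nu>f : \<nu>P \<rightarrow> \<nu>P'\<close> for \<open>f : P = proj_sum A b \<rightarrow> P' = proj_sum A a\<close>.\<close>

definition nakayama_map ::
  "('r, 'k::field, 'v) vertex_algebra \<Rightarrow> ('v \<Rightarrow> nat) \<Rightarrow> ('v \<Rightarrow> nat)
     \<Rightarrow> (('v \<Rightarrow> nat \<Rightarrow> 'r) \<Rightarrow> ('v \<Rightarrow> nat \<Rightarrow> 'r))
     \<Rightarrow> ((('v \<Rightarrow> nat \<Rightarrow> 'r) \<Rightarrow> 'r) \<Rightarrow> 'k) \<Rightarrow> ((('v \<Rightarrow> nat \<Rightarrow> 'r) \<Rightarrow> 'r) \<Rightarrow> 'k)" where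
  "nakayama_map A b a f l =
     restrict (\<lambda>g. l (compose (carrier (proj_sum A b)) g f)) (proj_dual A a)"

text \<open>\<open>\<tau>M = D Tr M\<close>, where \<open>Tr M\<close> is the cokernel of \<open>P\<^sub>0\<^sup>* \<rightarrow> P\<^sub>1\<^sup>*\<close>. The functionals on this
  cokernel are the functionals on \<open>P\<^sub>1\<^sup>*\<close> that vanish on the image of \<open>P\<^sub>0\<^sup>*\<close>, so
  \<open>\<tau>M = Ker (\<nu>P\<^sub>1 \<rightarrow> \<nu>P\<^sub>0)\<close>. Different minimal presentations give isomorphic modules.\<close>

definition AR_translate ::
  "('r, 'k::field, 'v) vertex_algebra \<Rightarrow> ('r, 'm) module
     \<Rightarrow> ('r, (('v \<Rightarrow> nat \<Rightarrow> 'r) \<Rightarrow> 'r) \<Rightarrow> 'k) module" where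
  "AR_translate A M =
     (let (a, b, f) = (SOME (a, b, f). \<exists>q. minimal_presentation A a b f q M) in
      (nakayama A b)
        \<lparr> carrier := hom_kernel (nakayama A b) (nakayama A a) (nakayama_map A b a f) \<rparr>)"

definition tau_rigid ::
  "('r, 'k::field, 'v) vertex_algebra \<Rightarrow> ('r, 'm) module \<Rightarrow> bool" where
  "tau_rigid A M \<longleftrightarrow>
     (\<forall>h\<in>rhom A M (AR_translate A M). \<forall>x\<in>carrier M. h x = \<zero>\<^bsub>AR_translate A M\<^esub>)"


section \<open>Quiver Grassmannians\<close>

text \<open>A variety is a set of points with its Zariski open sets and, for each open set, the
  regular functions on it (only their values on the open set matter).\<close>

record ('x, 'k) variety =
  points :: "'x set"
  zopen :: "'x set set"
  regular :: "'x set \<Rightarrow> ('x \<Rightarrow> 'k) set"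

definition lin_basis ::
  "('r, 'k, 'v) vertex_algebra \<Rightarrow> ('r, 'm) module \<Rightarrow> 'm set \<Rightarrow> nat \<Rightarrow> (nat \<Rightarrow> 'm) \<Rightarrow> bool" where
  "lin_basis A M V d s \<longleftrightarrow> (\<forall>k<d. s k \<in> V) \<and>
     (\<forall>x\<in>V. \<exists>!c. c \<in> {..<d} \<rightarrow>\<^sub>E UNIV \<and>
        x = (\<Oplus>\<^bsub>M\<^esub>k\<in>{..<d}. scal A (c k) \<odot>\<^bsub>M\<^esub> s k))"

definition vertex_space ::
  "('r, 'k, 'v) vertex_algebra \<Rightarrow> ('r, 'm) module \<Rightarrow> 'm set \<Rightarrow> 'v \<Rightarrow> 'm set" where
  "vertex_space A M N i = (\<lambda>x. idem A i \<odot>\<^bsub>M\<^esub> x) ` N"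

text \<open>A frame of a subrepresentation \<open>N\<close> with dimension vector \<open>e\<close> consists of bases
  \<open>s i 0, \<dots>, s i (e i - 1)\<close> of the spaces \<open>N\<^sub>i\<close>.\<close>

definition frame ::
  "('r, 'k, 'v) vertex_algebra \<Rightarrow> ('r, 'm) module \<Rightarrow> ('v \<Rightarrow> nat)
     \<Rightarrow> ('v \<Rightarrow> nat \<Rightarrow> 'm) \<Rightarrow> 'm set \<Rightarrow> bool" where
  "frame A M e s N \<longleftrightarrow> rsubmodule A N M \<and> (\<forall>i. lin_basis A M (vertex_space A M N i) (e i) (s i))"

definition linear_functional ::
  "('r, 'k::field, 'v) vertex_algebra \<Rightarrow> ('r, 'm) module \<Rightarrow> ('m \<Rightarrow> 'k) \<Rightarrow> bool" where
  "linear_functional A M l \<longleftrightarrow>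
     (\<forall>x\<in>carrier M. \<forall>y\<in>carrier M. l (x \<oplus>\<^bsub>M\<^esub> y) = l x + l y) \<and>
     (\<forall>c. \<forall>x\<in>carrier M. l (scal A c \<odot>\<^bsub>M\<^esub> x) = c * l x)"

text \<open>Polynomial functions on the affine space of tuples \<open>(s i k)\<close> with \<open>k < e i\<close>.\<close>

inductive_set frame_poly ::
  "('r, 'k::field, 'v) vertex_algebra \<Rightarrow> ('r, 'm) module \<Rightarrow> ('v \<Rightarrow> nat)
     \<Rightarrow> (('v \<Rightarrow> nat \<Rightarrow> 'm) \<Rightarrow> 'k) set"
  for A M e where
  const: "(\<lambda>s. c) \<in> frame_poly A M e"
| coord: "linear_functional A M l \<Longrightarrow> k < e i \<Longrightarrow> (\<lambda>s. l (s i k)) \<in> frame_poly A M e"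
| add: "h \<in> frame_poly A M e \<Longrightarrow> h' \<in> frame_poly A M e \<Longrightarrow> (\<lambda>s. h s + h' s) \<in> frame_poly A M e"
| mult: "h \<in> frame_poly A M e \<Longrightarrow> h' \<in> frame_poly A M e \<Longrightarrow> (\<lambda>s. h s * h' s) \<in> frame_poly A M e"

text \<open>The variety \<open>Gr\<^sub>e(M)\<close>. A product of Grassmannians is the quotient of the variety of frames
  by a product of general linear groups, and this quotient map is a Zariski locally trivial
  principal bundle, also over the closed subvariety of subrepresentations. Hence a set of
  subrepresentations is open iff its preimage in the variety of frames is, and a function is
  regular iff its pullback is locally a quotient of polynomial functions.\<close>

definition quiver_grassmannian ::
  "('r, 'k::field, 'v) vertex_algebra \<Rightarrow> ('r, 'm) module \<Rightarrow> ('v \<Rightarrow> nat)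
     \<Rightarrow> ('m set, 'k) variety" where
  "quiver_grassmannian A M e =
     (let P = {N. \<exists>s. frame A M e s N} in
      \<lparr> points = P,
        zopen = {W. W \<subseteq> P \<and> (\<forall>N s. N \<in> W \<and> frame A M e s N \<longrightarrow>
           (\<exists>h\<in>frame_poly A M e. h s \<noteq> 0 \<and>
              (\<forall>N' s'. frame A M e s' N' \<and> h s' \<noteq> 0 \<longrightarrow> N' \<in> W)))},
        regular = (\<lambda>W. {\<phi>. \<forall>N s. N \<in> W \<and> frame A M e s N \<longrightarrow>
           (\<exists>h\<in>frame_poly A M e. \<exists>h'\<in>frame_poly A M e. h' s \<noteq> 0 \<and>
              (\<forall>N' s'. N' \<in> W \<and> frame A M e s' N' \<and> h' s' \<noteq> 0 \<longrightarrow> \<phi> N' = h s' / h' s'))}) \<rparr>)"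


section \<open>The Euler characteristic of a variety\<close>

text \<open>Over an arbitrary algebraically closed field the Euler characteristic is that of etale
  cohomology, with coefficients in a finite field \<open>'f\<close> whose characteristic differs from that
  of \<open>K\<close>. (The Euler characteristic does not depend on \<open>'f\<close>; it agrees with the l-adic one,
  and over the complex numbers with the topological one.)

  By a theorem of Artin, etale cohomology of a quasi-projective variety is the direct limit of
  the Cech cohomologies of its etale coverings. Every etale covering is refined by a finite
  family of standard etale maps \<open>V \<rightarrow> X\<close>: for an open set \<open>U\<close> and \<open>f, g\<close> in \<open>O(U)[T]\<close>, \<open>V\<close> is
  the set of all \<open>(x, t)\<close> with \<open>x\<close> in \<open>U\<close>, \<open>f(x, t) = 0\<close>, \<open>f'(x, t) \<noteq> 0\<close>, \<open>g(x, t) \<noteq> 0\<close>.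
  Here \<open>f'\<close> is the derivative with respect to \<open>T\<close>. The disjoint union of the members of a
  covering has as fibre over \<open>x\<close> the set of pairs \<open>(j, t)\<close> such that \<open>(x, t)\<close> lies in the
  \<open>j\<close>-th member.\<close>

type_synonym ('x, 'k) covering = "('x set \<times> ('x \<Rightarrow> 'k poly) \<times> ('x \<Rightarrow> 'k poly)) list"

definition poly_over :: "('x, 'k::field) variety \<Rightarrow> 'x set \<Rightarrow> ('x \<Rightarrow> 'k poly) \<Rightarrow> bool" where
  "poly_over X U f \<longleftrightarrow>
     (\<forall>n. (\<lambda>x. coeff (f x) n) \<in> regular X U) \<and> (\<exists>d. \<forall>x\<in>U. degree (f x) \<le> d)"

definition etale_fibre :: "('x, 'k::field) covering \<Rightarrow> 'x \<Rightarrow> (nat \<times> 'k) set" where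
  "etale_fibre \<V> x = {(j, t). j < length \<V> \<and>
     (case \<V> ! j of (U, f, g) \<Rightarrow>
        x \<in> U \<and> poly (f x) t = 0 \<and> poly (pderiv (f x)) t \<noteq> 0 \<and> poly (g x) t \<noteq> 0)}"

definition etale_covering :: "('x, 'k::field) variety \<Rightarrow> ('x, 'k) covering \<Rightarrow> bool" where
  "etale_covering X \<V> \<longleftrightarrow>
     (\<forall>(U, f, g)\<in>set \<V>. U \<in> zopen X \<and> poly_over X U f \<and> poly_over X U g) \<and>
     (\<forall>x\<in>points X. etale_fibre \<V> x \<noteq> {})"

text \<open>Elements of \<open>O(U)[T\<^sub>0, T\<^sub>1, \<dots>]\<close> as functions of \<open>x\<close> and \<open>[t\<^sub>0, t\<^sub>1, \<dots>]\<close>. Their non-vanishing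
  sets are a basis of the Zariski topology of \<open>X \<times> K\<^sup>n\<close>.\<close>

inductive_set rel_poly ::
  "('x, 'k::field) variety \<Rightarrow> 'x set \<Rightarrow> ('x \<Rightarrow> 'k list \<Rightarrow> 'k) set"
  for X U where
  base: "\<phi> \<in> regular X U \<Longrightarrow> (\<lambda>x ts. \<phi> x) \<in> rel_poly X U"
| var: "(\<lambda>x ts. ts ! i) \<in> rel_poly X U"
| add: "h \<in> rel_poly X U \<Longrightarrow> h' \<in> rel_poly X U \<Longrightarrow> (\<lambda>x ts. h x ts + h' x ts) \<in> rel_poly X U"
| mult: "h \<in> rel_poly X U \<Longrightarrow> h' \<in> rel_poly X U \<Longrightarrow> (\<lambda>x ts. h x ts * h' x ts) \<in> rel_poly X U"

text \<open>Points of the \<open>(p + 1)\<close>-fold fibre product over \<open>X\<close> of a covering with itself.\<close>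

definition simplices ::
  "('x, 'k::field) variety \<Rightarrow> ('x, 'k) covering \<Rightarrow> nat \<Rightarrow> ('x \<times> (nat \<times> 'k) list) set" where
  "simplices X \<V> p =
     {(x, w). x \<in> points X \<and> length w = Suc p \<and> set w \<subseteq> etale_fibre \<V> x}"

text \<open>Cech cochains with values in the constant sheaf are the locally constant functions on
  these fibre products.\<close>

definition cochain ::
  "('x, 'k::field) variety \<Rightarrow> ('x, 'k) covering \<Rightarrow> nat
     \<Rightarrow> ('x \<Rightarrow> (nat \<times> 'k) list \<Rightarrow> 'f::field) \<Rightarrow> bool" where
  "cochain X \<V> p c \<longleftrightarrow> (\<forall>(x, w)\<in>simplices X \<V> p.
     \<exists>U\<in>zopen X. x \<in> U \<and> (\<exists>h\<in>rel_poly X U. h x (map snd w) \<noteq> 0 \<and>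
       (\<forall>(y, v)\<in>simplices X \<V> p.
          y \<in> U \<and> map fst v = map fst w \<and> h y (map snd v) \<noteq> 0 \<longrightarrow> c y v = c x w)))"

definition cech_diff ::
  "('x \<Rightarrow> (nat \<times> 'k) list \<Rightarrow> 'f::field) \<Rightarrow> 'x \<Rightarrow> (nat \<times> 'k) list \<Rightarrow> 'f" where
  "cech_diff c x w = (\<Sum>i<length w. (-1) ^ i * c x (take i w @ drop (Suc i) w))"

definition cocycle ::
  "('x, 'k::field) variety \<Rightarrow> ('x, 'k) covering \<Rightarrow> nat
     \<Rightarrow> ('x \<Rightarrow> (nat \<times> 'k) list \<Rightarrow> 'f::field) \<Rightarrow> bool" where
  "cocycle X \<V> p c \<longleftrightarrow>
     cochain X \<V> p c \<and> (\<forall>(x, w)\<in>simplices X \<V> (Suc p). cech_diff c x w = 0)"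

definition coboundary ::
  "('x, 'k::field) variety \<Rightarrow> ('x, 'k) covering \<Rightarrow> nat
     \<Rightarrow> ('x \<Rightarrow> (nat \<times> 'k) list \<Rightarrow> 'f::field) \<Rightarrow> bool" where
  "coboundary X \<V> p c \<longleftrightarrow>
     (case p of
        0 \<Rightarrow> \<forall>(x, w)\<in>simplices X \<V> 0. c x w = 0
      | Suc q \<Rightarrow> \<exists>b. cochain X \<V> q b \<and> (\<forall>(x, w)\<in>simplices X \<V> p. c x w = cech_diff b x w))"

text \<open>Morphisms over \<open>X\<close> from a covering \<open>\<V>'\<close> to a covering \<open>\<V>\<close>: the index is locally constant
  and the coordinate is locally a quotient of polynomials.\<close>

definition refinement ::
  "('x, 'k::field) variety \<Rightarrow> ('x, 'k) covering \<Rightarrow> ('x, 'k) covering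
     \<Rightarrow> ('x \<Rightarrow> nat \<times> 'k \<Rightarrow> nat \<times> 'k) \<Rightarrow> bool" where
  "refinement X \<V>' \<V> \<phi> \<longleftrightarrow>
     (\<forall>x\<in>points X. \<forall>v\<in>etale_fibre \<V>' x. \<phi> x v \<in> etale_fibre \<V> x \<and>
        (\<exists>U\<in>zopen X. x \<in> U \<and> (\<exists>h\<in>rel_poly X U. \<exists>h'\<in>rel_poly X U. h' x [snd v] \<noteq> 0 \<and>
           (\<forall>y\<in>U. \<forall>u\<in>etale_fibre \<V>' y. fst u = fst v \<and> h' y [snd u] \<noteq> 0 \<longrightarrow>
              \<phi> y u = (fst (\<phi> x v), h y [snd u] / h' y [snd u])))))"

definition vanishes_in_limit ::
  "('x, 'k::field) variety \<Rightarrow> ('x, 'k) covering \<Rightarrow> nat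
     \<Rightarrow> ('x \<Rightarrow> (nat \<times> 'k) list \<Rightarrow> 'f::field) \<Rightarrow> bool" where
  "vanishes_in_limit X \<V> p c \<longleftrightarrow>
     (\<exists>\<V>' \<phi>. etale_covering X \<V>' \<and> refinement X \<V>' \<V> \<phi> \<and>
        coboundary X \<V>' p (\<lambda>x w. c x (map (\<phi> x) w)))"

text \<open>The dimension of the \<open>p\<close>-th etale cohomology group: the largest number of cocycles on a
  common covering whose classes in the direct limit are linearly independent.\<close>

definition etale_betti ::
  "'f::{field,finite} itself \<Rightarrow> ('x, 'k::field) variety \<Rightarrow> nat \<Rightarrow> nat" where
  "etale_betti F X p =
     (GREATEST n. \<exists>\<V> (cs :: nat \<Rightarrow> 'x \<Rightarrow> (nat \<times> 'k) list \<Rightarrow> 'f).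
        etale_covering X \<V> \<and> (\<forall>i<n. cocycle X \<V> p (cs i)) \<and>
        (\<forall>a. vanishes_in_limit X \<V> p (\<lambda>x w. \<Sum>i<n. a i * cs i x w) \<longrightarrow> (\<forall>i<n. a i = 0)))"

definition euler_characteristic ::
  "'f::{field,finite} itself \<Rightarrow> ('x, 'k::field) variety \<Rightarrow> int" where
  "euler_characteristic F X =
     (\<Sum>p | etale_betti F X p \<noteq> 0. (-1) ^ p * int (etale_betti F X p))"


section \<open>The 2-cyclic Caldero-Chapoton map\<close>

text \<open>The ring of integral Laurent polynomials in variables \<open>x\<^sub>v\<close> is the group ring of the group
  of exponent vectors; \<^term>\<open>Poly_Mapping.single a c\<close> is \<open>c x\<^sup>a\<close>.\<close>

type_synonym 'v laurent = "('v \<Rightarrow> int) \<Rightarrow>\<^sub>0 int"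

text \<open>For a finite-dimensional module only finitely many \<open>Gr\<^sub>e(M)\<close> are non-empty.\<close>

definition CC ::
  "'f::{field,finite} itself \<Rightarrow> ('r, 'k::field, 'v) vertex_algebra \<Rightarrow> ('r, 'm) module
     \<Rightarrow> 'v laurent" where
  "CC F A M = Poly_Mapping.single (- g_vector A M)
     (\<Sum>e | points (quiver_grassmannian A M e) \<noteq> {}.
        euler_characteristic F (quiver_grassmannian A M e))"

text \<open>The carriers are subsets of a fixed type \<open>'m\<close>. Every finite-dimensional module over a
  \<open>K\<close>-algebra is isomorphic to one with \<open>'m = (nat \<Rightarrow> K)\<close>.\<close>

definition indec_tau_rigid ::
  "('r, 'k::field, 'v) vertex_algebra \<Rightarrow> ('r, 'm) module set" where
  "indec_tau_rigid A = {M \<in> mod_fd A. indecomposable A M \<and> tau_rigid A M}"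

definition iso_on ::
  "('r, 'k, 'v) vertex_algebra \<Rightarrow> ('r, 'm) module set \<Rightarrow> ('r, 'm) module rel" where
  "iso_on A S = {(M, N) \<in> S \<times> S. rmod_iso A M N}"


section \<open>The quiver with potential and the generalized cluster algebra\<close>

datatype vert = V1 | V2

datatype arr = A1 | B1 | E1 | E2

instance vert :: finite
proof
  have "(UNIV :: vert set) = {V1, V2}" using vert.exhaust by blast
  then show "finite (UNIV :: vert set)" by (metis finite.emptyI finite.insertI)
qed

instance arr :: finite
proof
  have "(UNIV :: arr set) = {A1, B1, E1, E2}" using arr.exhaust by blast
  then show "finite (UNIV :: arr set)" by (metis finite.emptyI finite.insertI)
qed

fun src :: "arr \<Rightarrow> vert" where
  "src A1 = V1" | "src B1 = V2" | "src E1 = V1" | "src E2 = V2"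

fun tgt :: "arr \<Rightarrow> vert" where
  "tgt A1 = V2" | "tgt B1 = V1" | "tgt E1 = V1" | "tgt E2 = V2"

definition W12 :: "(vert, arr) path \<Rightarrow> 'k::field" where
  "W12 = (\<lambda>p. 2 * path_elt (V1, [E1, E1, E1]) p + 3 * path_elt (V1, [E1, A1, B1]) p +
              3 * path_elt (V2, [E2, B1, A1]) p + path_elt (V2, [E2, E2, E2]) p)"

definition Lambda12 ::
  "(((vert, arr) path \<Rightarrow> 'k::field) set, 'k, vert) vertex_algebra" where
  "Lambda12 = completed_jacobian_algebra src tgt W12"

text \<open>\<open>lmono c p q\<close> is \<open>c x\<^sub>1\<^sup>p x\<^sub>2\<^sup>q\<close>.\<close>

definition lmono :: "int \<Rightarrow> int \<Rightarrow> int \<Rightarrow> vert laurent" where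
  "lmono c p q = Poly_Mapping.single (case_vert p q) c"

inductive_set generated_subalgebra :: "'b::comm_ring_1 set \<Rightarrow> 'b set" for S where
  gen: "x \<in> S \<Longrightarrow> x \<in> generated_subalgebra S"
| one: "1 \<in> generated_subalgebra S"
| diff: "x \<in> generated_subalgebra S \<Longrightarrow> y \<in> generated_subalgebra S \<Longrightarrow>
           x - y \<in> generated_subalgebra S"
| mult: "x \<in> generated_subalgebra S \<Longrightarrow> y \<in> generated_subalgebra S \<Longrightarrow>
           x * y \<in> generated_subalgebra S"

record 'b cluster_algebra =
  underlying_ring :: "'b set"
  cluster_variables :: "'b set"
  initial_variables :: "'b set"

text \<open>The generalized cluster algebra of the sphere with one puncture, one puncture of order 3
  and one orbifold point, given by its complete list of cluster variables
  \<open>x\<^sub>1, x\<^sub>2, 3x\<^sub>2/x\<^sub>1, 3x\<^sub>1/x\<^sub>2, 9/x\<^sub>1, 9/x\<^sub>2\<close>.\<close>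

definition gca12 :: "vert laurent cluster_algebra" where
  "gca12 = (let X = {lmono 1 1 0, lmono 1 0 1, lmono 3 (-1) 1, lmono 3 1 (-1),
                     lmono 9 (-1) 0, lmono 9 0 (-1)} in
     \<lparr> underlying_ring = generated_subalgebra X,
       cluster_variables = X,
       initial_variables = {lmono 1 1 0, lmono 1 0 1} \<rparr>)"

end

theory Submission
  imports Defs
begin

text \<open>Put \<open>z = \<epsilon>\<^sub>1 - \<epsilon>\<^sub>2\<close>. In \<open>\<Lambda>\<close> the element \<open>z\<close> is central, both products of the two arrows
  between the vertices are nonzero multiples of \<open>z\<^sup>2\<close>, and \<open>z\<^sup>2\<close> kills these arrows. So \<open>\<Lambda>\<close> has
  dimension 12, with \<open>e\<^sub>i \<Lambda> e\<^sub>i = K[z]/z\<^sup>4\<close> and \<open>e\<^sub>i \<Lambda> e\<^sub>j\<close> free of rank one over \<open>K[z]/z\<^sup>2\<close>.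

  A module with minimal presentation \<open>Q\<^sub>1 \<rightarrow> Q\<^sub>0 \<rightarrow> M\<close> is tau-rigid iff every map \<open>Q\<^sub>1 \<rightarrow> M\<close> factors
  through \<open>Q\<^sub>0\<close>. Hence \<open>Q\<^sub>0\<close> and \<open>Q\<^sub>1\<close> have no common summand, and if \<open>Q\<^sub>1 \<noteq> 0\<close>, then the presentation
  is a matrix over the local ring \<open>K[z]/z\<^sup>2\<close>, not all of whose entries lie in its radical. An entry
  that is a unit splits off a direct summand \<open>P\<^sub>i / a\<^sub>i \<Lambda>\<close>, where \<open>a\<^sub>i\<close> is the arrow from \<open>i\<close> to the
  other vertex. This leaves \<open>P\<^sub>1, P\<^sub>2, P\<^sub>1 / a\<^sub>1 \<Lambda>, P\<^sub>2 / a\<^sub>2 \<Lambda>\<close>. The components of these modules at both vertices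
  are uniserial over \<open>K[z]\<close>, so every non-empty quiver Grassmannian is a point, and the
  Caldero-Chapoton map counts submodules: 9 for \<open>P\<^sub>i\<close> and 3 for \<open>P\<^sub>i / a\<^sub>i \<Lambda>\<close>.\<close>

section \<open>The Jacobian algebra in coordinates\<close>

text \<open>Homomorphisms M -> tau M are tested with linear functionals. Hom(M, nu P_j) is dual to M
  e_j, and tau M lies in nu Q_1. A functional on M and a summand P_j of Q_1 give a homomorphism M ->
  nu Q_1, which lands in tau M as soon as the functional kills all multiples x r, with x in M and r
  an entry of the corresponding column of the presentation. Two functionals suffice: the constant
  coefficient of a generator separates the supports of Q_0 and Q_1, and the coefficient of a_i
  produces the unit entry. Conversely, for the four modules already Hom(M, nu Q_1) vanishes.

  The characteristic enters through the coefficients of the potential. Dividing the cyclic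
  derivatives by 3 leaves the constants -2 and -1 in a_1 a_2 = -2 z^2 e_1 and a_2 a_1 = -z^2 e_2.
  Their difference is a unit, which kills z^2 a_v. Both are units because 2 is, so z^4 = 0 follows
  and the right ideal a_i \<Lambda> contains z^2 e_i.

  Distinct submodules of one of the four modules have distinct dimension vectors. Every etale
  covering of a point is refined by the trivial one, so the cohomology of a point can be computed by
  hand.\<close>

fun oth :: "vert \<Rightarrow> vert" where
  "oth V1 = V2" | "oth V2 = V1"

lemma oth_oth [simp]: "oth (oth v) = v"
  by (cases v) auto

lemma oth_neq [simp]: "oth v \<noteq> v" "v \<noteq> oth v"
  by (cases v; simp)+

lemma oth_inject [simp]: "oth v = oth w \<longleftrightarrow> v = w"
  by (metis oth_oth)

lemma oth_eq [simp]: "oth v = V1 \<longleftrightarrow> v = V2" "oth v = V2 \<longleftrightarrow> v = V1"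
  by (cases v; simp)+

lemma neq_iff_oth: "v \<noteq> w \<longleftrightarrow> v = oth w"
  by (cases v; cases w) auto

lemma all_vert: "(\<forall>v. P v) \<longleftrightarrow> P i \<and> P (oth i)"
proof
  assume "P i \<and> P (oth i)"
  then show "\<forall>v. P v" by (intro allI, rename_tac v, case_tac "v = i") (simp_all add: neq_iff_oth)
qed simp

lemma UNIV_vert: "UNIV = {v, oth v}"
  using neq_iff_oth by auto

text \<open>The arrow out of \<open>v\<close> is called \<open>a\<^sub>v\<close>, so \<open>a\<^sub>1\<close> and \<open>a\<^sub>2\<close> are the \<open>a\<^sub>1\<close> and \<open>b\<^sub>1\<close> of the
  quiver. With \<open>z = \<epsilon>\<^sub>1 - \<epsilon>\<^sub>2\<close> the relations say that \<open>z\<close> is central, \<open>a\<^sub>1 a\<^sub>2 = -2 z\<^sup>2 e\<^sub>1\<close> and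
  \<open>a\<^sub>2 a\<^sub>1 = - z\<^sup>2 e\<^sub>2\<close>; comparing the two evaluations of \<open>a\<^sub>v a\<^sub>w a\<^sub>v\<close> gives \<open>z\<^sup>2 a\<^sub>v = 0\<close>. The fields
  \<open>lp0, \<dots>, lp3\<close> and \<open>ar0, ar1\<close> of \<open>jac\<close> are the coefficients of \<open>z\<^sup>k e\<^sub>v\<close> and \<open>z\<^sup>k a\<^sub>v\<close>.\<close>

fun kap :: "vert \<Rightarrow> 'k::field" where
  "kap V1 = - 2" | "kap V2 = - 1"

datatype 'k jac = Jac (lp0: "vert \<Rightarrow> 'k") (lp1: "vert \<Rightarrow> 'k") (lp2: "vert \<Rightarrow> 'k")
  (lp3: "vert \<Rightarrow> 'k") (ar0: "vert \<Rightarrow> 'k") (ar1: "vert \<Rightarrow> 'k")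

lemma jac_eq_iff: "x = y \<longleftrightarrow> (\<forall>v. lp0 x v = lp0 y v \<and> lp1 x v = lp1 y v \<and> lp2 x v = lp2 y v \<and>
    lp3 x v = lp3 y v \<and> ar0 x v = ar0 y v \<and> ar1 x v = ar1 y v)"
  by (cases x; cases y) (auto simp: fun_eq_iff)

instantiation jac :: (field) ring_1
begin

definition "0 = Jac (\<lambda>v. 0) (\<lambda>v. 0) (\<lambda>v. 0) (\<lambda>v. 0) (\<lambda>v. 0) (\<lambda>v. 0)"
definition "1 = Jac (\<lambda>v. 1) (\<lambda>v. 0) (\<lambda>v. 0) (\<lambda>v. 0) (\<lambda>v. 0) (\<lambda>v. 0)"
definition "x + y = Jac (\<lambda>v. lp0 x v + lp0 y v) (\<lambda>v. lp1 x v + lp1 y v)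
  (\<lambda>v. lp2 x v + lp2 y v) (\<lambda>v. lp3 x v + lp3 y v) (\<lambda>v. ar0 x v + ar0 y v)
  (\<lambda>v. ar1 x v + ar1 y v)"
definition "x - y = Jac (\<lambda>v. lp0 x v - lp0 y v) (\<lambda>v. lp1 x v - lp1 y v)
  (\<lambda>v. lp2 x v - lp2 y v) (\<lambda>v. lp3 x v - lp3 y v) (\<lambda>v. ar0 x v - ar0 y v)
  (\<lambda>v. ar1 x v - ar1 y v)"
definition "- x = Jac (\<lambda>v. - lp0 x v) (\<lambda>v. - lp1 x v)
  (\<lambda>v. - lp2 x v) (\<lambda>v. - lp3 x v) (\<lambda>v. - ar0 x v) (\<lambda>v. - ar1 x v)"
text \<open>Coefficients are indexed by the start vertex, so behind an arrow the right factor is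
  read at \<open>oth v\<close>. A product of two arrows enters two z-degrees higher with the factor
  \<open>kap v\<close>. Products that would contribute to z^4 e_v or z^2 a_v are dropped.\<close>

definition "x * y = Jac
  (\<lambda>v. lp0 x v * lp0 y v)
  (\<lambda>v. lp0 x v * lp1 y v + lp1 x v * lp0 y v)
  (\<lambda>v. lp0 x v * lp2 y v + lp1 x v * lp1 y v + lp2 x v * lp0 y v
       + kap v * (ar0 x v * ar0 y (oth v)))
  (\<lambda>v. lp0 x v * lp3 y v + lp1 x v * lp2 y v + lp2 x v * lp1 y v + lp3 x v * lp0 y v
       + kap v * (ar0 x v * ar1 y (oth v) + ar1 x v * ar0 y (oth v)))
  (\<lambda>v. lp0 x v * ar0 y v + ar0 x v * lp0 y (oth v))
  (\<lambda>v. lp0 x v * ar1 y v + lp1 x v * ar0 y v + ar0 x v * lp1 y (oth v) + ar1 x v * lp0 y (oth v))"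

instance
  by standard (simp_all add: jac_eq_iff zero_jac_def one_jac_def plus_jac_def minus_jac_def
      uminus_jac_def times_jac_def algebra_simps)

end

lemma jac_sel_zero [simp]: "lp0 0 v = 0" "lp1 0 v = 0" "lp2 0 v = 0" "lp3 0 v = 0"
    "ar0 0 v = 0" "ar1 0 v = 0"
  by (simp_all add: zero_jac_def)

lemma jac_sel_one [simp]: "lp0 1 v = 1" "lp1 1 v = 0" "lp2 1 v = 0" "lp3 1 v = 0"
    "ar0 1 v = 0" "ar1 1 v = 0"
  by (simp_all add: one_jac_def)

lemma jac_sel_add [simp]: "lp0 (x + y) v = lp0 x v + lp0 y v" "lp1 (x + y) v = lp1 x v + lp1 y v"
    "lp2 (x + y) v = lp2 x v + lp2 y v" "lp3 (x + y) v = lp3 x v + lp3 y v"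
    "ar0 (x + y) v = ar0 x v + ar0 y v" "ar1 (x + y) v = ar1 x v + ar1 y v"
  by (simp_all add: plus_jac_def)

lemma jac_sel_diff [simp]: "lp0 (x - y) v = lp0 x v - lp0 y v" "lp1 (x - y) v = lp1 x v - lp1 y v"
    "lp2 (x - y) v = lp2 x v - lp2 y v" "lp3 (x - y) v = lp3 x v - lp3 y v"
    "ar0 (x - y) v = ar0 x v - ar0 y v" "ar1 (x - y) v = ar1 x v - ar1 y v"
  by (simp_all add: minus_jac_def)

lemma jac_sel_uminus [simp]: "lp0 (- x) v = - lp0 x v" "lp1 (- x) v = - lp1 x v"
    "lp2 (- x) v = - lp2 x v" "lp3 (- x) v = - lp3 x v"
    "ar0 (- x) v = - ar0 x v" "ar1 (- x) v = - ar1 x v"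
  by (simp_all add: uminus_jac_def)

lemma jac_sel_mult [simp]:
  "lp0 (x * y) v = lp0 x v * lp0 y v"
  "lp1 (x * y) v = lp0 x v * lp1 y v + lp1 x v * lp0 y v"
  "lp2 (x * y) v = lp0 x v * lp2 y v + lp1 x v * lp1 y v + lp2 x v * lp0 y v
       + kap v * (ar0 x v * ar0 y (oth v))"
  "lp3 (x * y) v = lp0 x v * lp3 y v + lp1 x v * lp2 y v + lp2 x v * lp1 y v + lp3 x v * lp0 y v
       + kap v * (ar0 x v * ar1 y (oth v) + ar1 x v * ar0 y (oth v))"
  "ar0 (x * y) v = lp0 x v * ar0 y v + ar0 x v * lp0 y (oth v)"
  "ar1 (x * y) v = lp0 x v * ar1 y v + lp1 x v * ar0 y v + ar0 x v * lp1 y (oth v)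
       + ar1 x v * lp0 y (oth v)"
  by (simp_all add: times_jac_def)

lemma jac_sel_sum:
  "lp0 (sum f T) v = (\<Sum>t\<in>T. lp0 (f t) v)"
  "lp1 (sum f T) v = (\<Sum>t\<in>T. lp1 (f t) v)"
  "lp2 (sum f T) v = (\<Sum>t\<in>T. lp2 (f t) v)"
  "lp3 (sum f T) v = (\<Sum>t\<in>T. lp3 (f t) v)"
  "ar0 (sum f T) v = (\<Sum>t\<in>T. ar0 (f t) v)"
  "ar1 (sum f T) v = (\<Sum>t\<in>T. ar1 (f t) v)"
  by (induction T rule: infinite_finite_induct) auto

definition sc :: "'k \<Rightarrow> 'k::field jac" where
  "sc c = Jac (\<lambda>v. c) (\<lambda>v. 0) (\<lambda>v. 0) (\<lambda>v. 0) (\<lambda>v. 0) (\<lambda>v. 0)"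

definition ee :: "vert \<Rightarrow> 'k::field jac" where
  "ee i = Jac (\<lambda>v. if v = i then 1 else 0) (\<lambda>v. 0) (\<lambda>v. 0) (\<lambda>v. 0) (\<lambda>v. 0) (\<lambda>v. 0)"

definition zz :: "'k::field jac" where
  "zz = Jac (\<lambda>v. 0) (\<lambda>v. 1) (\<lambda>v. 0) (\<lambda>v. 0) (\<lambda>v. 0) (\<lambda>v. 0)"

definition av :: "vert \<Rightarrow> 'k::field jac" where
  "av i = Jac (\<lambda>v. 0) (\<lambda>v. 0) (\<lambda>v. 0) (\<lambda>v. 0) (\<lambda>v. if v = i then 1 else 0) (\<lambda>v. 0)"

lemma jac_sel_sc [simp]: "lp0 (sc c) v = c" "lp1 (sc c) v = 0" "lp2 (sc c) v = 0"
    "lp3 (sc c) v = 0" "ar0 (sc c) v = 0" "ar1 (sc c) v = 0"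
  by (simp_all add: sc_def)

lemma jac_sel_ee [simp]: "lp0 (ee i) v = (if v = i then 1 else 0)" "lp1 (ee i) v = 0"
    "lp2 (ee i) v = 0" "lp3 (ee i) v = 0" "ar0 (ee i) v = 0" "ar1 (ee i) v = 0"
  by (simp_all add: ee_def)

lemma jac_sel_zz [simp]: "lp0 zz v = 0" "lp1 zz v = 1"
    "lp2 zz v = 0" "lp3 zz v = 0" "ar0 zz v = 0" "ar1 zz v = 0"
  by (simp_all add: zz_def)

lemma jac_sel_av [simp]: "lp0 (av i) v = 0" "lp1 (av i) v = 0" "lp2 (av i) v = 0"
    "lp3 (av i) v = 0" "ar0 (av i) v = (if v = i then 1 else 0)" "ar1 (av i) v = 0"
  by (simp_all add: av_def)

lemma sc_simps: "sc 0 = 0" "sc 1 = 1" "sc (c + d) = sc c + sc d" "sc (c * d) = sc c * sc d"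
    "sc (- c) = - sc c" "sc (c - d) = sc c - sc d"
  by (simp_all add: jac_eq_iff)

lemma sc_commute: "sc c * x = x * sc c"
  by (simp add: jac_eq_iff mult.commute)

lemma ee_idem [simp]: "ee i * ee i = ee i"
  by (simp add: jac_eq_iff)

lemma ee_idem_left [simp]: "ee i * (ee i * x) = ee i * x"
  by (simp add: mult.assoc [symmetric])

lemma ee_orth: "ee i * ee j = (if i = j then ee i else 0)"
  by (simp add: jac_eq_iff)

lemma ee_sum: "ee i + ee (oth i) = 1"
  using neq_iff_oth by (auto simp: jac_eq_iff)

section \<open>Completed path algebras\<close>

abbreviation cpa :: "('a::finite \<Rightarrow> 'v::finite) \<Rightarrow> ('a \<Rightarrow> 'v) \<Rightarrow> (('v, 'a) path \<Rightarrow> 'k::field) ring"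
  where "cpa \<equiv> completed_path_algebra"

lemma path_end_append: "path_end t (path_end t (i, u), v) = path_end t (i, u @ v)"
  by (auto simp: path_end_def)

lemma path_end_Nil [simp]: "path_end t (i, []) = i"
  by (simp add: path_end_def)

lemma path_end_Cons: "path_end t (i, x # w) = path_end t (t x, w)"
  by (simp add: path_end_def)

lemma is_path_Nil [simp]: "is_path s t (i, [])"
  by (simp add: is_path_def)

lemma is_path_Cons: "is_path s t (i, x # w) \<longleftrightarrow> s x = i \<and> is_path s t (t x, w)"
proof (cases w)
  case (Cons y ys)
  have "(\<forall>k. Suc k < length (x # w) \<longrightarrow> t ((x # w) ! k) = s ((x # w) ! Suc k)) \<longleftrightarrow>
     t x = s y \<and> (\<forall>k. Suc k < length w \<longrightarrow> t (w ! k) = s (w ! Suc k))"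
    (is "?l \<longleftrightarrow> ?r")
  proof
    assume l: ?l
    have "t x = s y" using l[rule_format, of 0] by (simp add: Cons)
    moreover have "t (w ! k) = s (w ! Suc k)" if "Suc k < length w" for k
      using l[rule_format, of "Suc k"] that by simp
    ultimately show ?r by blast
  next
    assume r: ?r
    show ?l
    proof (intro allI impI)
      fix k assume "Suc k < length (x # w)"
      then show "t ((x # w) ! k) = s ((x # w) ! Suc k)"
        using r by (cases k) (auto simp: Cons)
    qed
  qed
  then show ?thesis by (auto simp: is_path_def Cons)
qed (simp add: is_path_def)

lemma is_path_append:
  "is_path s t (i, u @ v) \<longleftrightarrow> is_path s t (i, u) \<and> is_path s t (path_end t (i, u), v)"
  by (induction u arbitrary: i) (auto simp: is_path_Cons path_end_Cons)

lemma cpa_simps: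
  "carrier (cpa s t) = {f. \<forall>p. f p \<noteq> 0 \<longrightarrow> is_path s t p}"
  "one (cpa s t) = (\<lambda>p. if snd p = [] then 1 else 0)"
  "zero (cpa s t) = 0"
  "add (cpa s t) f g = f + g"
  "mult (cpa s t) f g (i, w) =
     (\<Sum>k\<le>length w. f (i, take k w) * g (path_end t (i, take k w), drop k w))"
  by (auto simp: completed_path_algebra_def plus_fun_def zero_fun_def)

text \<open>Both sides sum over two cut positions of the same word. The substitution m = k + l turns
  cutting first at m into cutting first at k.\<close>

lemma cpa_mult_assoc:
  "mult (cpa s t) (mult (cpa s t) f g) h = mult (cpa s t) f (mult (cpa s t) g h)"
proof (intro ext, clarify)
  fix i :: 'a and w :: "'b list"
  let ?n = "length w"
  let ?F = "\<lambda>k m. f (i, take k w) * g (path_end t (i, take k w), take (m - k) (drop k w)) *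
      h (path_end t (i, take m w), drop m w)"
  have tt: "drop k (take m w) = take (m - k) (drop k w)" for k m by (simp add: drop_take)
  have "mult (cpa s t) (mult (cpa s t) f g) h (i, w) = (\<Sum>m\<le>?n. \<Sum>k\<le>m. ?F k m)"
    unfolding cpa_simps sum_distrib_right
    by (intro sum.cong refl) (auto simp: min_def tt)
  also have "\<dots> = (\<Sum>(m, k)\<in>(SIGMA m:{..?n}. {..m}). ?F k m)"
    by (simp add: sum.Sigma)
  also have "\<dots> = (\<Sum>(k, l)\<in>(SIGMA k:{..?n}. {..?n - k}). ?F k (k + l))"
    by (rule sum.reindex_bij_witness[where i="\<lambda>(k, l). (k + l, k)" and j="\<lambda>(m, k). (k, m - k)"]) auto
  also have "\<dots> = (\<Sum>k\<le>?n. \<Sum>l\<le>?n - k. ?F k (k + l))"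
    by (simp add: sum.Sigma)
  also have "\<dots> = mult (cpa s t) f (mult (cpa s t) g h) (i, w)"
    unfolding cpa_simps sum_distrib_left
    by (intro sum.cong refl) (auto simp: path_end_append take_add mult.assoc add.commute)
  finally show "mult (cpa s t) (mult (cpa s t) f g) h (i, w) =
    mult (cpa s t) f (mult (cpa s t) g h) (i, w)" .
qed

lemma cpa_one_left: "mult (cpa s t) (one (cpa s t)) f = f"
proof (intro ext, clarify)
  fix i w
  have "mult (cpa s t) (one (cpa s t)) f (i, w) =
    (\<Sum>k\<le>length w. if k = 0 then f (i, w) else 0)"
    unfolding cpa_simps by (intro sum.cong refl) auto
  then show "mult (cpa s t) (one (cpa s t)) f (i, w) = f (i, w)" by simp
qed

lemma cpa_one_right: "mult (cpa s t) f (one (cpa s t)) = f"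
proof (intro ext, clarify)
  fix i w
  have "mult (cpa s t) f (one (cpa s t)) (i, w) =
    (\<Sum>k\<le>length w. if k = length w then f (i, w) else 0)"
    unfolding cpa_simps by (intro sum.cong refl) auto
  then show "mult (cpa s t) f (one (cpa s t)) (i, w) = f (i, w)" by simp
qed

lemma cpa_mult_add_left:
  "mult (cpa s t) (f + g) h = mult (cpa s t) f h + mult (cpa s t) g h"
  by (auto simp: fun_eq_iff cpa_simps plus_fun_def sum.distrib algebra_simps)

lemma cpa_mult_add_right:
  "mult (cpa s t) h (f + g) = mult (cpa s t) h f + mult (cpa s t) h g"
  by (auto simp: fun_eq_iff cpa_simps plus_fun_def sum.distrib algebra_simps)

lemma cpa_mult_closed:
  assumes "f \<in> carrier (cpa s t)" "g \<in> carrier (cpa s t)"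
  shows "mult (cpa s t) f g \<in> carrier (cpa s t)"
proof -
  have "is_path s t (i, w)" if "mult (cpa s t) f g (i, w) \<noteq> 0" for i w
  proof -
    have "\<exists>k. f (i, take k w) * g (path_end t (i, take k w), drop k w) \<noteq> 0"
    proof (rule ccontr)
      assume "\<nexists>k. f (i, take k w) * g (path_end t (i, take k w), drop k w) \<noteq> 0"
      then show False using that unfolding cpa_simps by (simp only: not_ex not_not sum.neutral_const simp_thms)
    qed
    then obtain k where "f (i, take k w) * g (path_end t (i, take k w), drop k w) \<noteq> 0" by blast
    then have "is_path s t (i, take k w)" "is_path s t (path_end t (i, take k w), drop k w)"
      using assms by (auto simp: cpa_simps)
    then show ?thesis using is_path_append[of s t i "take k w" "drop k w"] by simp
  qed
  then show ?thesis by (auto simp: cpa_simps(1))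
qed

lemma cpa_add_closed:
  assumes "f \<in> carrier (cpa s t)" "g \<in> carrier (cpa s t)"
  shows "f + g \<in> carrier (cpa s t)"
proof -
  have "f p \<noteq> 0 \<or> g p \<noteq> 0" if "(f + g) p \<noteq> 0" for p
    using that by (auto simp: plus_fun_def)
  then show ?thesis using assms unfolding cpa_simps by blast
qed

lemma ring_cpa: "ring (cpa s t :: (('v::finite, 'a::finite) path \<Rightarrow> 'k::field) ring)"
proof (rule ringI)
  show "abelian_group (cpa s t :: (('v, 'a) path \<Rightarrow> 'k) ring)"
  proof (rule abelian_groupI)
    fix x :: "('v, 'a) path \<Rightarrow> 'k" assume "x \<in> carrier (cpa s t)"
    then have "(- x) \<in> carrier (cpa s t)" "add (cpa s t) (- x) x = zero (cpa s t)"
      by (simp_all add: cpa_simps)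
    then show "\<exists>y\<in>carrier (cpa s t). y \<oplus>\<^bsub>cpa s t\<^esub> x = \<zero>\<^bsub>cpa s t\<^esub>" by blast
  next
    show "\<zero>\<^bsub>cpa s t\<^esub> \<in> carrier (cpa s t :: (('v, 'a) path \<Rightarrow> 'k) ring)"
      by (simp add: cpa_simps)
  qed (simp_all add: cpa_add_closed cpa_simps(3,4) add.assoc)
  show "Group.monoid (cpa s t :: (('v, 'a) path \<Rightarrow> 'k) ring)"
  proof (rule monoidI)
    have "is_path s t p" if "snd p = []" for p :: "('v, 'a) path"
      using that by (cases p) simp
    then show "\<one>\<^bsub>cpa s t\<^esub> \<in> carrier (cpa s t :: (('v, 'a) path \<Rightarrow> 'k) ring)"
      by (simp add: cpa_simps)
  qed (simp_all only: cpa_mult_closed cpa_mult_assoc cpa_one_left cpa_one_right)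
qed (simp_all only: cpa_mult_add_left cpa_mult_add_right cpa_simps(4))

lemma path_elt_in_cpa: "is_path s t p \<Longrightarrow> path_elt p \<in> carrier (cpa s t)"
  by (auto simp: cpa_simps path_elt_def)

lemma path_elt_mult:
  "mult (cpa s t) (path_elt (i, u)) (path_elt (j, v)) =
    (if path_end t (i, u) = j then path_elt (i, u @ v) else (0 :: ('v::finite, 'a::finite) path \<Rightarrow> 'k::field))"
proof (intro ext, clarify)
  fix l :: 'v and w :: "'a list"
  have "mult (cpa s t) (path_elt (i, u)) (path_elt (j, v)) (l, w) =
    (\<Sum>k\<le>length w. if k = length u \<and> l = i \<and> w = u @ v \<and> path_end t (i, u) = j then 1 else (0::'k))"
  proof -
    have "path_elt (i, u) (l, take k w) * path_elt (j, v) (path_end t (l, take k w), drop k w) =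
      (if k = length u \<and> l = i \<and> w = u @ v \<and> path_end t (i, u) = j then 1 else (0::'k))"
      if "k \<le> length w" for k
    proof -
      have "w = u @ v \<and> k = length u \<longleftrightarrow> take k w = u \<and> drop k w = v"
        using that by (metis append_eq_conv_conj append_take_drop_id length_take min.absorb2)
      then show ?thesis by (auto simp: path_elt_def)
    qed
    then show ?thesis
      unfolding cpa_simps by (intro sum.cong refl) simp
  qed
  also have "\<dots> = (if l = i \<and> w = u @ v \<and> path_end t (i, u) = j then 1 else 0)"
    by (cases "l = i \<and> w = u @ v \<and> path_end t (i, u) = j") auto
  also have "\<dots> = (if path_end t (i, u) = j then path_elt (i, u @ v) else (0 :: ('v, 'a) path \<Rightarrow> 'k)) (l, w)"
    by (auto simp: path_elt_def)
  finally show "mult (cpa s t) (path_elt (i, u)) (path_elt (j, v)) (l, w) =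
    (if path_end t (i, u) = j then path_elt (i, u @ v) else (0 :: ('v, 'a) path \<Rightarrow> 'k)) (l, w)" .
qed

definition fscale :: "'k::field \<Rightarrow> ('p \<Rightarrow> 'k) \<Rightarrow> ('p \<Rightarrow> 'k)" where
  "fscale c f = (\<lambda>p. c * f p)"

lemma cpa_mult_fscale:
  "mult (cpa s t) (fscale c f) g = fscale c (mult (cpa s t) f g)"
  "mult (cpa s t) f (fscale c g) = fscale c (mult (cpa s t) f g)"
  by (auto simp: fun_eq_iff cpa_simps fscale_def sum_distrib_left mult_ac)

lemma cpa_mult_diff_right:
  "mult (cpa s t) h (f - g) = mult (cpa s t) h f - mult (cpa s t) h g"
  by (auto simp: fun_eq_iff cpa_simps sum_subtractf algebra_simps)

lemma cpa_mult_diff_left: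
  "mult (cpa s t) (f - g) h = mult (cpa s t) f h - mult (cpa s t) g h"
  by (auto simp: fun_eq_iff cpa_simps sum_subtractf algebra_simps)

lemma fscale_closed: "f \<in> carrier (cpa s t) \<Longrightarrow> fscale c f \<in> carrier (cpa s t)"
  by (auto simp: cpa_simps fscale_def)

text \<open>Scaling by c is multiplication by c times the unit, so ring ideals are
  subspaces.\<close>

lemma cpa_ideal_fscale:
  assumes "ideal I (cpa s t)" "f \<in> I"
  shows "fscale c f \<in> I"
proof -
  interpret ideal I "cpa s t" by fact
  have f: "f \<in> carrier (cpa s t)" using assms by (metis a_Hcarr)
  have "mult (cpa s t) (fscale c (one (cpa s t))) f \<in> I"
    using assms I_l_closed[OF assms(2) fscale_closed[OF one_closed]] by blast
  then show ?thesis by (simp only: cpa_mult_fscale cpa_one_left)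
qed

lemma cpa_ideal_diff:
  assumes "ideal I (cpa s t)" "f \<in> I" "g \<in> I"
  shows "f - g \<in> I"
proof -
  interpret ideal I "cpa s t" by fact
  have "fscale (- 1) g \<in> I" using assms cpa_ideal_fscale by blast
  then have "f + fscale (- 1) g \<in> I"
    using additive_subgroup.a_closed[OF additive_subgroup_axioms] assms unfolding cpa_simps by blast
  moreover have "f + fscale (- 1) g = f - g" by (auto simp: fscale_def)
  ultimately show ?thesis by simp
qed

lemma cpa_ideal_add:
  assumes "ideal I (cpa s t)" "f \<in> I" "g \<in> I"
  shows "f + g \<in> I"
proof -
  interpret ideal I "cpa s t" by fact
  show ?thesis using additive_subgroup.a_closed[OF additive_subgroup_axioms] assms unfolding cpa_simps by blast
qed

section \<open>The Jacobian ideal\<close>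

text \<open>The sign at \<open>E2\<close> comes from z = \<epsilon>_1 - \<epsilon>_2. With it the
  relations \<epsilon>_1 a_1 = - a_1 \<epsilon>_2 and \<epsilon>_2 a_2 = - a_2 \<epsilon>_1 say that
  z commutes with the arrows.\<close>

fun arrow_val :: "arr \<Rightarrow> 'k::field jac" where
  "arrow_val A1 = av V1"
| "arrow_val B1 = av V2"
| "arrow_val E1 = zz * ee V1"
| "arrow_val E2 = - (zz * ee V2)"

definition path_val :: "(vert, arr) path \<Rightarrow> 'k::field jac" where
  "path_val p = ee (fst p) * prod_list (map arrow_val (snd p))"

lemma ee_arrow_val: "ee i * arrow_val x = (if src x = i then arrow_val x else 0)"
  by (cases x; cases i) (auto simp: jac_eq_iff)

lemma arrow_val_ee: "arrow_val x * ee j = (if tgt x = j then arrow_val x else 0)"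
  by (cases x; cases j) (auto simp: jac_eq_iff)

lemma path_val_Nil [simp]: "path_val (i, []) = ee i"
  by (simp add: path_val_def)

lemma path_val_Cons:
  "path_val (i, x # w) = (if src x = i then arrow_val x * path_val (tgt x, w) else (0 :: 'k::field jac))"
proof -
  have "(path_val (i, x # w) :: 'k jac) = (ee i * arrow_val x) * prod_list (map arrow_val w)"
    by (simp add: path_val_def mult.assoc)
  moreover have "(arrow_val x * path_val (tgt x, w) :: 'k jac) =
      (arrow_val x * ee (tgt x)) * prod_list (map arrow_val w)"
    by (simp add: path_val_def mult.assoc)
  ultimately show ?thesis by (auto simp: ee_arrow_val arrow_val_ee split: if_splits)
qed

lemma path_val_mult:
  "path_val (i, u) * path_val (j, v) = (if path_end tgt (i, u) = j then path_val (i, u @ v) else 0)"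
proof (induction u arbitrary: i)
  case Nil
  then show ?case by (simp add: path_val_def mult.assoc [symmetric] ee_orth)
next
  case (Cons x u)
  then show ?case by (auto simp: path_val_Cons path_end_Cons mult.assoc)
qed

text \<open>Grading with arrows in degree 1: \<open>jac_pow d\<close> is the \<open>d\<close>-th power of the radical.\<close>

definition jac_pow :: "nat \<Rightarrow> 'k::field jac set" where
  "jac_pow d = {x. \<forall>v. (1 \<le> d \<longrightarrow> lp0 x v = 0) \<and> (2 \<le> d \<longrightarrow> lp1 x v = 0 \<and> ar0 x v = 0) \<and>
     (3 \<le> d \<longrightarrow> lp2 x v = 0 \<and> ar1 x v = 0) \<and> (4 \<le> d \<longrightarrow> lp3 x v = 0)}"

lemma jac_pow_0 [simp]: "x \<in> jac_pow 0"
  by (simp add: jac_pow_def)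

lemma jac_pow_4: "4 \<le> d \<Longrightarrow> x \<in> jac_pow d \<longleftrightarrow> x = 0"
  by (auto simp: jac_pow_def jac_eq_iff)

lemma jac_pow_mult:
  assumes "x \<in> jac_pow 1" "y \<in> jac_pow d"
  shows "x * y \<in> jac_pow (Suc d)"
proof -
  consider "d = 0" | "d = 1" | "d = 2" | "d = 3" | "4 \<le> d" by linarith
  then show ?thesis using assms by cases (auto simp: jac_pow_def)
qed

lemma jac_pow_add: "x \<in> jac_pow d \<Longrightarrow> y \<in> jac_pow d \<Longrightarrow> x + y \<in> jac_pow d"
  by (auto simp: jac_pow_def)

lemma jac_pow_sum: "(\<And>t. t \<in> T \<Longrightarrow> f t \<in> jac_pow d) \<Longrightarrow> sum f T \<in> jac_pow d"
  by (induction T rule: infinite_finite_induct) (auto simp: jac_pow_add, simp_all add: jac_pow_def)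

lemma arrow_val_pow: "arrow_val x \<in> jac_pow 1"
  by (cases x) (auto simp: jac_pow_def)

lemma path_val_pow: "path_val (i, w) \<in> jac_pow (length w)"
proof (induction w arbitrary: i)
  case (Cons x w)
  then show ?case
    using jac_pow_mult[OF arrow_val_pow Cons] by (auto simp: path_val_Cons) (simp add: jac_pow_def)
qed simp

lemma path_val_long: "4 \<le> length w \<Longrightarrow> path_val (i, w) = 0"
  using path_val_pow[of i w] by (simp add: jac_pow_4)

definition words :: "nat \<Rightarrow> arr list set" where
  "words n = {w. length w \<le> n}"

lemma finite_words [simp]: "finite (words n)"
  using finite_lists_length_le[of "UNIV :: arr set" n] by (simp add: words_def)

text \<open>A finite sum is enough for infinite combinations because words of length at least 4
  evaluate to 0. Words that are not paths evaluate to 0 as well, so the sum may run over all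
  words.\<close>

definition path_eval :: "((vert, arr) path \<Rightarrow> 'k::field) \<Rightarrow> 'k jac" where
  "path_eval f = (\<Sum>p\<in>UNIV \<times> words 3. sc (f p) * path_val p)"

lemma path_eval_add: "path_eval (f + g) = path_eval f + path_eval g"
  by (simp add: path_eval_def sc_simps distrib_right sum.distrib)

lemma path_eval_fscale: "path_eval (fscale c f) = sc c * path_eval f"
  by (simp add: path_eval_def fscale_def sc_simps sum_distrib_left mult.assoc)

lemma path_eval_path_elt: "path_eval (path_elt (i, w)) = (path_val (i, w) :: 'k::field jac)"
proof (cases "length w \<le> 3")
  case True
  have "path_eval (path_elt (i, w)) = (\<Sum>p\<in>UNIV \<times> words 3. if p = (i, w) then path_val p else (0 :: 'k jac))"
    unfolding path_eval_def by (intro sum.cong refl) (auto simp: path_elt_def sc_simps)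
  moreover have "(i, w) \<in> UNIV \<times> words 3" using True by (simp add: words_def)
  ultimately show ?thesis by simp
next
  case False
  have "path_eval (path_elt (i, w)) = (0 :: 'k jac)"
    unfolding path_eval_def
    by (intro sum.neutral) (use False in \<open>auto simp: path_elt_def sc_simps words_def\<close>)
  then show ?thesis using False path_val_long[of w i] by simp
qed

lemma path_eval_one: "path_eval (\<lambda>p. if snd p = [] then c else 0) = sc c"
proof -
  have "path_eval (\<lambda>p. if snd p = [] then c else 0) =
    (\<Sum>p\<in>UNIV \<times> words 3. if snd p = [] then sc c * path_val p else 0)"
    unfolding path_eval_def by (intro sum.cong refl) (auto simp: sc_simps)
  also have "\<dots> = (\<Sum>p\<in>UNIV \<times> {[]}. sc c * path_val p)"
    by (intro sum.mono_neutral_cong_right finite_cartesian_product finite_words) (auto simp: words_def)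
  also have "\<dots> = (\<Sum>i\<in>UNIV. sc c * ee i)"
    by (simp add: sum.cartesian_product')
  also have "\<dots> = sc c"
    by (simp add: UNIV_vert[of V1] sum_distrib_left [symmetric] ee_sum[of V1, simplified] distrib_left [symmetric])
  finally show ?thesis .
qed

lemma sc_mult_sc_mult: "sc c * x * (sc d * y) = sc c * sc d * (x * y)"
  by (metis mult.assoc sc_commute)

lemma path_eval_mult:
  "path_eval (mult (cpa src tgt) f g) = path_eval f * path_eval g"
proof -
  let ?h = "\<lambda>i w w'. sc (f (i, w)) * sc (g (path_end tgt (i, w), w')) * path_val (i, w @ w')"
  have long: "?h i w w' = 0" if "\<not> length w + length w' \<le> 3" for i w w'
    by (subst path_val_long) (use that in auto)
  have "path_eval (mult (cpa src tgt) f g) =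
    (\<Sum>i\<in>UNIV. \<Sum>v\<in>words 3. \<Sum>k\<le>length v. ?h i (take k v) (drop k v))"
    unfolding path_eval_def sum.cartesian_product' cpa_simps
    by (intro sum.cong refl) (simp add: jac_sel_sum jac_eq_iff sum_distrib_right sum.distrib
        sum_distrib_left algebra_simps sc_simps)
  also have "\<dots> = (\<Sum>i\<in>UNIV. \<Sum>(v, k)\<in>(SIGMA v:words 3. {..length v}). ?h i (take k v) (drop k v))"
    by (simp add: sum.Sigma)
  also have "\<dots> = (\<Sum>i\<in>UNIV. \<Sum>(w, w')\<in>{(w, w'). length w + length w' \<le> 3}. ?h i w w')"
    by (intro sum.cong refl sum.reindex_bij_witness[where
          i="\<lambda>(w, w'). (w @ w', length w)" and j="\<lambda>(v, k). (take k v, drop k v)"])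
      (auto simp: words_def)
  \<comment> \<open>The added pairs have total length at least 4, and such concatenations evaluate
    to 0.\<close>
  also have "\<dots> = (\<Sum>i\<in>UNIV. \<Sum>(w, w')\<in>words 3 \<times> words 3. ?h i w w')"
  proof (rule sum.cong[OF refl], rule sum.mono_neutral_left)
    show "\<forall>p\<in>words 3 \<times> words 3 - {(w, w'). length w + length w' \<le> 3}.
        (case p of (w, w') \<Rightarrow> ?h i w w') = 0" for i
    proof
      fix p assume "p \<in> words 3 \<times> words 3 - {(w, w'). length w + length w' \<le> 3}"
      then show "(case p of (w, w') \<Rightarrow> ?h i w w') = 0"
        using long[of "fst p" "snd p" i] by (cases p) simp
    qed
  qed (auto simp: words_def intro!: finite_cartesian_product finite_words[unfolded words_def])
  \<comment> \<open>The new sum over start vertices j of the second word has one surviving term, the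
    end of the first word, by \<open>path_val_mult\<close>.\<close>
  also have "\<dots> = (\<Sum>i\<in>UNIV. \<Sum>w\<in>words 3. \<Sum>w'\<in>words 3. \<Sum>j\<in>UNIV.
      sc (f (i, w)) * path_val (i, w) * (sc (g (j, w')) * path_val (j, w')))"
    unfolding sum.cartesian_product [symmetric]
  proof (intro sum.cong refl)
    fix i w w'
    let ?e = "path_end tgt (i, w)"
    have "(\<Sum>j\<in>UNIV. sc (f (i, w)) * path_val (i, w) * (sc (g (j, w')) * path_val (j, w'))) =
      (\<Sum>j\<in>UNIV. sc (f (i, w)) * sc (g (j, w')) * (path_val (i, w) * path_val (j, w')))"
      by (simp only: sc_mult_sc_mult)
    also have "\<dots> = (\<Sum>j\<in>UNIV. if ?e = j then ?h i w w' else 0)"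
      by (intro sum.cong refl) (auto simp: path_val_mult)
    also have "\<dots> = ?h i w w'"
      by simp
    finally show "?h i w w' = (\<Sum>j\<in>UNIV. sc (f (i, w)) * path_val (i, w) * (sc (g (j, w')) * path_val (j, w')))"
      by simp
  qed
  also have "\<dots> = (\<Sum>i\<in>UNIV. \<Sum>w\<in>words 3. \<Sum>j\<in>UNIV. \<Sum>w'\<in>words 3.
      sc (f (i, w)) * path_val (i, w) * (sc (g (j, w')) * path_val (j, w')))"
    by (intro sum.cong refl sum.swap)
  also have "\<dots> = path_eval f * path_eval g"
    unfolding path_eval_def sum.cartesian_product'
    by (simp only: sum_distrib_right) (simp only: sum_distrib_left)
  finally show ?thesis .
qed

section \<open>The cyclic derivatives of the potential\<close>

fun loop :: "vert \<Rightarrow> arr" where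
  "loop V1 = E1" | "loop V2 = E2"

fun out :: "vert \<Rightarrow> arr" where
  "out V1 = A1" | "out V2 = B1"

text \<open>The sign for which the loop at i evaluates to \<open>sg i\<close> times z e_i.\<close>

fun sg :: "vert \<Rightarrow> 'k::field" where
  "sg V1 = 1" | "sg V2 = - 1"

lemma src_tgt_loop_out [simp]: "src (loop i) = i" "tgt (loop i) = i" "src (out i) = i"
    "tgt (out i) = oth i"
  by (cases i; simp)+

lemma sg_simps [simp]: "sg i * sg i = 1" "sg i * (sg i * x) = x" "sg (oth i) = - sg i"
  by (cases i; simp)+

lemma arrow_val_loop: "arrow_val (loop i) = sc (sg i) * (zz * ee i)"
  by (cases i) (auto simp: jac_eq_iff)

lemma arrow_val_out: "arrow_val (out i) = av i"
  by (cases i) auto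

lemma arr_cases: "x = loop (src x) \<or> x = out (src x)"
  by (cases x) auto

lemma W12_long: "length (snd p) \<noteq> 3 \<Longrightarrow> W12 p = 0"
  by (auto simp: W12_def path_elt_def)

lemma sum_splits:
  "(\<Sum>(v, u)\<in>{(v, u). v @ u = s}. h v u) = (\<Sum>k\<le>length s. h (take k s) (drop k s))"
  by (rule sum.reindex_bij_witness[where i="\<lambda>k. (take k s, drop k s)" and j="\<lambda>(v, u). length v"])
    auto

text \<open>The potential is homogeneous of degree 3, so only words of length 2 matter, and each has
  three cut positions. The three factorisations of \<epsilon>_1^3 give 3 * 2 = 6; those of
  \<epsilon>_2^3 give 3.\<close>

lemma cyclic_derivative_W12:
  "cyclic_derivative tgt E1 W12 =
     fscale 6 (path_elt (V1, [E1, E1])) + fscale 3 (path_elt (V1, [A1, B1]))" (is ?E1)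
  "cyclic_derivative tgt E2 W12 =
     fscale 3 (path_elt (V2, [B1, A1])) + fscale 3 (path_elt (V2, [E2, E2]))" (is ?E2)
  "cyclic_derivative tgt A1 W12 =
     fscale 3 (path_elt (V2, [B1, E1])) + fscale 3 (path_elt (V2, [E2, B1]))" (is ?A1)
  "cyclic_derivative tgt B1 W12 =
     fscale 3 (path_elt (V1, [E1, A1])) + fscale 3 (path_elt (V1, [A1, E2]))" (is ?B1)
proof -
  have zero: "cyclic_derivative tgt a W12 (i, s) = 0" if "length s \<noteq> 2" for a i s
    unfolding cyclic_derivative_def sum_splits
    using that by (auto intro!: sum.neutral W12_long)
  have two: "cyclic_derivative tgt a W12 (i, [x, y]) = (if i = tgt a then
      W12 (path_end tgt (i, []), [x, y, a]) +
      W12 (path_end tgt (i, [x]), [y, a, x]) + W12 (path_end tgt (i, [x, y]), [a, x, y]) else 0)" for a i x y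
    unfolding cyclic_derivative_def sum_splits by (simp add: atMost_Suc path_end_def numeral_2_eq_2)
  have all: "f = g" if "\<And>i s. length s \<noteq> 2 \<Longrightarrow> f (i, s) = g (i, s)"
    "\<And>i x y. f (i, [x, y]) = g (i, [x, y])" for f g :: "(vert, arr) path \<Rightarrow> 'k::field"
  proof (intro ext, clarify)
    fix i s
    show "f (i, s) = g (i, s)"
    proof (cases "length s = 2")
      case True
      then obtain x y where "s = [x, y]" by (auto simp: numeral_2_eq_2 length_Suc_conv)
      then show ?thesis using that(2) by simp
    qed (use that(1) in blast)
  qed
  show ?E1
  proof (rule all)
    show "cyclic_derivative tgt E1 W12 (i, [x, y]) =
     (fscale 6 (path_elt (V1, [E1, E1])) + fscale 3 (path_elt (V1, [A1, B1]))) (i, [x, y])" for i x y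
      unfolding two by (cases x; cases y; cases i) (simp_all add: W12_def path_elt_def fscale_def path_end_def)
  qed (auto simp: zero fscale_def path_elt_def)
  show ?E2
  proof (rule all)
    show "cyclic_derivative tgt E2 W12 (i, [x, y]) =
     (fscale 3 (path_elt (V2, [B1, A1])) + fscale 3 (path_elt (V2, [E2, E2]))) (i, [x, y])" for i x y
      unfolding two by (cases x; cases y; cases i) (simp_all add: W12_def path_elt_def fscale_def path_end_def)
  qed (auto simp: zero fscale_def path_elt_def)
  show ?A1
  proof (rule all)
    show "cyclic_derivative tgt A1 W12 (i, [x, y]) =
     (fscale 3 (path_elt (V2, [B1, E1])) + fscale 3 (path_elt (V2, [E2, B1]))) (i, [x, y])" for i x y
      unfolding two by (cases x; cases y; cases i) (simp_all add: W12_def path_elt_def fscale_def path_end_def)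
  qed (auto simp: zero fscale_def path_elt_def)
  show ?B1
  proof (rule all)
    show "cyclic_derivative tgt B1 W12 (i, [x, y]) =
     (fscale 3 (path_elt (V1, [E1, A1])) + fscale 3 (path_elt (V1, [A1, E2]))) (i, [x, y])" for i x y
      unfolding two by (cases x; cases y; cases i) (simp_all add: W12_def path_elt_def fscale_def path_end_def)
  qed (auto simp: zero fscale_def path_elt_def)
qed

text \<open>\<open>nform b\<close> lifts \<open>b\<close> to a combination of 12 paths, with \<open>z = \<epsilon>\<^sub>1 - \<epsilon>\<^sub>2\<close>.\<close>

definition nform_at :: "vert \<Rightarrow> 'k::field jac \<Rightarrow> (vert, arr) path \<Rightarrow> 'k" where
  "nform_at i b =
     fscale (lp0 b i) (path_elt (i, [])) + fscale (sg i * lp1 b i) (path_elt (i, [loop i])) +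
     fscale (lp2 b i) (path_elt (i, [loop i, loop i])) +
     fscale (sg i * lp3 b i) (path_elt (i, [loop i, loop i, loop i])) +
     fscale (ar0 b i) (path_elt (i, [out i])) + fscale (sg i * ar1 b i) (path_elt (i, [loop i, out i]))"

definition nform :: "'k::field jac \<Rightarrow> (vert, arr) path \<Rightarrow> 'k" where
  "nform b = nform_at V1 b + nform_at V2 b"

lemma nform_at_linear: "nform_at i (x + y) = nform_at i x + nform_at i y"
  "nform_at i (sc c * x) = fscale c (nform_at i x)" "nform_at i 0 = 0"
  by (auto simp: nform_at_def fun_eq_iff fscale_def algebra_simps)

lemma nform_linear: "nform (x + y) = nform x + nform y" "nform (sc c * x) = fscale c (nform x)"
  "nform 0 = 0" 
  by (auto simp: nform_def nform_at_linear) (auto simp: fscale_def fun_eq_iff algebra_simps)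

lemma nform_sum: "nform (sum f T) = (\<Sum>t\<in>T. nform (f t))"
  by (induction T rule: infinite_finite_induct) (auto simp: nform_linear)

lemma nform_ee:
  assumes "ee i * b = b"
  shows "nform b = nform_at i b"
proof -
  have "nform_at (oth i) (ee i * b) = 0"
    by (auto simp: nform_at_def fun_eq_iff fscale_def)
  then show ?thesis using assms by (cases i) (auto simp: nform_def)
qed

lemma is_path_words: "is_path src tgt (i, [])" "is_path src tgt (i, [loop i])"
  "is_path src tgt (i, [loop i, loop i])" "is_path src tgt (i, [loop i, loop i, loop i])"
  "is_path src tgt (i, [out i])" "is_path src tgt (i, [loop i, out i])"
  by (simp_all add: is_path_Cons)

lemma nform_closed: "nform b \<in> carrier (cpa src tgt)"
  unfolding nform_def nform_at_def
  by (intro cpa_add_closed fscale_closed path_elt_in_cpa is_path_words)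

lemma path_eval_nform: "path_eval (nform b) = b"
proof -
  have "path_eval (nform_at i b) = ee i * b" for i
    unfolding nform_at_def path_eval_add path_eval_fscale path_eval_path_elt path_val_Cons path_val_Nil
    by (auto simp: arrow_val_loop arrow_val_out jac_eq_iff)
  then show ?thesis
    by (simp add: nform_def path_eval_add distrib_right [symmetric] ee_sum[of V1, simplified])
qed

definition jac_ring :: "'k::field jac ring" where
  "jac_ring = \<lparr>carrier = UNIV, mult = (*), one = 1, zero = 0, add = (+)\<rparr>"

lemma ring_jac_ring: "ring (jac_ring :: 'k::field jac ring)"
proof (rule ringI)
  show "abelian_group (jac_ring :: 'k::field jac ring)"
  proof (rule abelian_groupI)
    fix x :: "'k jac"
    show "\<exists>y\<in>carrier jac_ring. y \<oplus>\<^bsub>jac_ring\<^esub> x = \<zero>\<^bsub>jac_ring\<^esub>"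
      by (rule bexI[of _ "- x"]) (simp_all add: jac_ring_def)
  qed (auto simp: jac_ring_def algebra_simps)
  show "Group.monoid (jac_ring :: 'k::field jac ring)"
    by (rule monoidI) (auto simp: jac_ring_def algebra_simps)
qed (auto simp: jac_ring_def algebra_simps)

lemma path_eval_hom:
  "ring_hom_ring (cpa src tgt) jac_ring (path_eval :: ((vert, arr) path \<Rightarrow> 'k::field) \<Rightarrow> 'k jac)"
proof (rule ring_hom_ringI[OF ring_cpa ring_jac_ring])
  show "path_eval \<one>\<^bsub>cpa src tgt\<^esub> = (\<one>\<^bsub>jac_ring\<^esub> :: 'k jac)"
    by (simp add: cpa_simps(2) path_eval_one jac_ring_def sc_simps)
qed (simp_all add: jac_ring_def path_eval_mult cpa_simps(4) path_eval_add)

definition jker :: "((vert, arr) path \<Rightarrow> 'k::field) set" where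
  "jker = {f \<in> carrier (cpa src tgt). path_eval f = 0}"

lemma jker_a_kernel: "jker = a_kernel (cpa src tgt) jac_ring path_eval"
  by (simp add: jker_def a_kernel_def' jac_ring_def)

lemma ideal_jker: "ideal jker (cpa src tgt)"
  unfolding jker_a_kernel by (rule ring_hom_ring.kernel_is_ideal[OF path_eval_hom])

abbreviation potential_ideal :: "((vert, arr) path \<Rightarrow> 'k::field) set" where
  "potential_ideal \<equiv> genideal (cpa src tgt) (range (\<lambda>a. cyclic_derivative tgt a W12))"

lemma derivatives_in_jker: "range (\<lambda>a. cyclic_derivative tgt a W12) \<subseteq> jker"
proof clarify
  fix a :: arr
  have "(cyclic_derivative tgt a W12 :: _ \<Rightarrow> 'a) \<in> carrier (cpa src tgt)"
    by (cases a) (auto simp: cyclic_derivative_W12 is_path_Cons intro!: cpa_add_closed fscale_closed path_elt_in_cpa)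
  moreover have "path_eval (cyclic_derivative tgt a W12 :: _ \<Rightarrow> 'a) = 0"
    by (cases a) (auto simp: cyclic_derivative_W12 path_eval_add path_eval_fscale path_eval_path_elt
        path_val_Cons jac_eq_iff)
  ultimately show "(cyclic_derivative tgt a W12 :: _ \<Rightarrow> 'a) \<in> jker" by (simp add: jker_def)
qed

lemma potential_ideal_subset_jker: "potential_ideal \<subseteq> jker"
  by (rule ring.genideal_minimal[OF ring_cpa ideal_jker derivatives_in_jker])

lemma ideal_potential_ideal: "ideal potential_ideal (cpa src tgt)"
proof (rule ring.genideal_ideal[OF ring_cpa])
  show "range (\<lambda>a. cyclic_derivative tgt a W12) \<subseteq> carrier (cpa src tgt)"
    using derivatives_in_jker by (auto simp: jker_def)
qed

lemma derivative_in_potential_ideal: "cyclic_derivative tgt a W12 \<in> potential_ideal"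
proof -
  have "range (\<lambda>a. cyclic_derivative tgt a W12) \<subseteq> potential_ideal"
    by (rule ring.genideal_self[OF ring_cpa]) (use derivatives_in_jker in \<open>auto simp: jker_def\<close>)
  then show ?thesis by auto
qed

section \<open>Rewriting paths modulo the cyclic derivatives\<close>

text \<open>The scalar c may be 0; then w' is arbitrary and the path itself lies in the ideal, as in
  \<open>wcong_0\<close>.\<close>

definition wcong :: "'k::field \<Rightarrow> vert \<Rightarrow> arr list \<Rightarrow> arr list \<Rightarrow> bool" where
  "wcong c i w w' \<longleftrightarrow> path_elt (i, w) - fscale c (path_elt (i, w')) \<in> potential_ideal"

lemma wcong_scale:
  assumes "fscale d (path_elt (i, w) - fscale c (path_elt (i, w'))) \<in> potential_ideal" "d \<noteq> 0"
  shows "wcong c i w w'"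
proof -
  have "fscale (inverse d) (fscale d (path_elt (i, w) - fscale c (path_elt (i, w')))) \<in> potential_ideal"
    by (rule cpa_ideal_fscale[OF ideal_potential_ideal assms(1)])
  moreover have "fscale (inverse d) (fscale d f) = f" for f :: "(vert, arr) path \<Rightarrow> 'a"
    using assms(2) by (auto simp: fscale_def)
  ultimately show ?thesis by (simp add: wcong_def)
qed

text \<open>The derivative at the loop, divided by 3: the constants are -6/3 = -2 at the first
  vertex and -3/3 = -1 at the second.\<close>

lemma wcong_out_out:
  assumes "(3::'k::field) \<noteq> 0"
  shows "wcong (kap i :: 'k) i [out i, out (oth i)] [loop i, loop i]"
proof (rule wcong_scale[OF _ assms])
  have "cyclic_derivative tgt (loop i) W12 =
      fscale (3::'k) (path_elt (i, [out i, out (oth i)]) - fscale (kap i) (path_elt (i, [loop i, loop i])))"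
    by (cases i) (auto simp: cyclic_derivative_W12 fscale_def fun_eq_iff algebra_simps)
  then show "fscale (3::'k) (path_elt (i, [out i, out (oth i)]) - fscale (kap i) (path_elt (i, [loop i, loop i])))
      \<in> potential_ideal"
    using derivative_in_potential_ideal by metis
qed

text \<open>The derivative at the arrow opposite to \<open>out i\<close>, divided by 3. The scalar
  -1 says that z commutes with \<open>out i\<close>.\<close>

lemma wcong_out_loop:
  assumes "(3::'k::field) \<noteq> 0"
  shows "wcong (- 1 :: 'k) i [out i, loop (oth i)] [loop i, out i]"
proof (rule wcong_scale[OF _ assms])
  have "cyclic_derivative tgt (out (oth i)) W12 =
      fscale (3::'k) (path_elt (i, [out i, loop (oth i)]) - fscale (- 1) (path_elt (i, [loop i, out i])))"
    by (cases i) (auto simp: cyclic_derivative_W12 fscale_def fun_eq_iff algebra_simps)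
  then show "fscale (3::'k) (path_elt (i, [out i, loop (oth i)]) - fscale (- 1) (path_elt (i, [loop i, out i])))
      \<in> potential_ideal"
    using derivative_in_potential_ideal by metis
qed

lemma wcong_context:
  assumes "wcong c i w w'" and "path_end tgt (j, u) = i" and "path_end tgt (i, w') = path_end tgt (i, w)"
    and "is_path src tgt (j, u)" and "is_path src tgt (path_end tgt (i, w), v)"
  shows "wcong c j (u @ w @ v) (u @ w' @ v)"
proof -
  interpret I: ideal "potential_ideal :: (_ \<Rightarrow> 'a) set" "cpa src tgt" by (rule ideal_potential_ideal)
  let ?e = "path_end tgt (i, w)"
  have "mult (cpa src tgt) (mult (cpa src tgt) (path_elt (j, u)) (path_elt (i, w) - fscale c (path_elt (i, w'))))
      (path_elt (?e, v)) \<in> potential_ideal"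
    using assms(1) unfolding wcong_def
    by (intro I.I_r_closed I.I_l_closed path_elt_in_cpa assms)
  moreover have "path_end tgt (j, u @ w) = ?e" "path_end tgt (j, u @ w') = ?e"
    using assms by (simp_all add: path_end_append [symmetric])
  ultimately show ?thesis
    unfolding wcong_def using assms(2)
    by (simp add: cpa_mult_diff_right cpa_mult_diff_left cpa_mult_fscale path_elt_mult)
qed

lemma wcong_trans:
  assumes "wcong c i w w'" "wcong d i w' w''"
  shows "wcong (c * d) i w w''"
proof -
  have "path_elt (i, w) - fscale c (path_elt (i, w')) + fscale c (path_elt (i, w') - fscale d (path_elt (i, w'')))
      \<in> potential_ideal"
    using assms unfolding wcong_def
    by (intro cpa_ideal_add[OF ideal_potential_ideal] cpa_ideal_fscale[OF ideal_potential_ideal])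
  moreover have "path_elt (i, w) - fscale c (path_elt (i, w')) + fscale c (path_elt (i, w') - fscale d (path_elt (i, w'')))
    = path_elt (i, w) - fscale (c * d) (path_elt (i, w''))"
    by (auto simp: fscale_def fun_eq_iff algebra_simps)
  ultimately show ?thesis by (simp add: wcong_def)
qed

text \<open>Subtracting the two congruences leaves a nonzero multiple of the second path.\<close>

lemma wcong_zero:
  assumes "wcong c i w w'" "wcong d i w w'" "c \<noteq> (d :: 'k::field)"
  shows "wcong (0 :: 'k) i w' []"
proof -
  have "(path_elt (i, w) - fscale d (path_elt (i, w'))) - (path_elt (i, w) - fscale c (path_elt (i, w')))
      \<in> potential_ideal"
    by (rule cpa_ideal_diff[OF ideal_potential_ideal assms(2)[unfolded wcong_def] assms(1)[unfolded wcong_def]])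
  moreover have "(path_elt (i, w) - fscale d (path_elt (i, w'))) - (path_elt (i, w) - fscale c (path_elt (i, w')))
     = fscale (c - d) (path_elt (i, w') - fscale 0 (path_elt (i, [])))"
    by (auto simp: fscale_def fun_eq_iff algebra_simps)
  ultimately show ?thesis
    using assms(3) by (intro wcong_scale[of "c - d"]) simp_all
qed

lemma wcong_0: "wcong (0 :: 'k) i w w' \<longleftrightarrow> path_elt (i, w) \<in> (potential_ideal :: (_ \<Rightarrow> 'k::field) set)"
    (is "?l \<longleftrightarrow> ?r")
proof -
  have "path_elt (i, w) - fscale 0 (path_elt (i, w')) = (path_elt (i, w) :: _ \<Rightarrow> 'k)"
    by (auto simp: fscale_def)
  then show ?thesis by (simp add: wcong_def)
qed

context
  assumes three: "(3::'k::field) \<noteq> 0" and two: "(2::'k) \<noteq> 0"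
begin

lemma kap_nonzero: "(kap i :: 'k) \<noteq> 0"
  using two by (cases i) auto

text \<open>The path a_i a_j a_i, with j = \<open>oth i\<close>, is reduced from the left with
  constant \<open>kap i\<close>. From the right it is reduced with constant
  \<open>kap (oth i)\<close>, followed by two commutations whose signs cancel. The constants -2 and
  -1 are different, so \<open>wcong_zero\<close> applies.\<close>

lemma loop_loop_out: "path_elt (i, [loop i, loop i, out i]) \<in> (potential_ideal :: (_ \<Rightarrow> 'k) set)"
proof -
  let ?j = "oth i"
  have 1: "wcong (kap i :: 'k) i [out i, out ?j, out i] [loop i, loop i, out i]"
    using wcong_context[OF wcong_out_out[OF three, of i], of i "[]" "[out i]"]
    by (simp add: path_end_def is_path_Cons)
  have 2: "wcong (kap ?j :: 'k) i [out i, out ?j, out i] [out i, loop ?j, loop ?j]"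
    using wcong_context[OF wcong_out_out[OF three, of ?j], of i "[out i]" "[]"]
    by (simp add: path_end_def is_path_Cons)
  have 3: "wcong (- 1 :: 'k) i [out i, loop ?j, loop ?j] [loop i, out i, loop ?j]"
    using wcong_context[OF wcong_out_loop[OF three, of i], of i "[]" "[loop ?j]"]
    by (simp add: path_end_def is_path_Cons)
  have 4: "wcong (- 1 :: 'k) i [loop i, out i, loop ?j] [loop i, loop i, out i]"
    using wcong_context[OF wcong_out_loop[OF three, of i], of i "[loop i]" "[]"]
    by (simp add: path_end_def is_path_Cons)
  have "(kap i :: 'k) \<noteq> kap ?j * (- 1 * - 1)"
    by (cases i) (auto simp: eq_neg_iff_add_eq_0)
  then have "wcong (0 :: 'k) i [loop i, loop i, out i] []"
    using wcong_zero[OF 1 wcong_trans[OF 2 wcong_trans[OF 3 4]]] by blast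
  then show ?thesis by (simp add: wcong_0)
qed

text \<open>Multiplying the previous path by the returning arrow gives \<open>kap i\<close> times
  the fourth power of the loop, and \<open>kap i\<close> is invertible.\<close>

lemma loop4: "path_elt (i, [loop i, loop i, loop i, loop i]) \<in> (potential_ideal :: (_ \<Rightarrow> 'k) set)"
proof -
  let ?j = "oth i"
  have 1: "wcong (kap i :: 'k) i [loop i, loop i, out i, out ?j] [loop i, loop i, loop i, loop i]"
    using wcong_context[OF wcong_out_out[OF three, of i], of i "[loop i, loop i]" "[]"]
    by (simp add: path_end_def is_path_Cons)
  have "wcong (0 :: 'k) i [loop i, loop i, out i] []"
    using loop_loop_out wcong_0 by blast
  interpret I: ideal "potential_ideal :: (_ \<Rightarrow> 'k) set" "cpa src tgt" by (rule ideal_potential_ideal)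
  have "mult (cpa src tgt) (path_elt (i, [loop i, loop i, out i])) (path_elt (?j, [out ?j]))
      \<in> (potential_ideal :: (_ \<Rightarrow> 'k) set)"
    by (intro I.I_r_closed path_elt_in_cpa loop_loop_out) (simp add: is_path_Cons)
  then have "path_elt (i, [loop i, loop i, out i, out ?j]) \<in> (potential_ideal :: (_ \<Rightarrow> 'k) set)"
    by (simp add: path_elt_mult path_end_def)
  then have "wcong (0 :: 'k) i [loop i, loop i, out i, out ?j] [loop i, loop i, loop i, loop i]"
    by (simp add: wcong_0)
  from wcong_zero[OF this 1] kap_nonzero[of i] show ?thesis by (metis wcong_0)
qed

text \<open>The loop shifts each normal form to the next one. Only two terms overflow, the fourth
  power of the loop and the square of the loop followed by the arrow, and both lie in the
  ideal.\<close>

lemma nform_loop: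
  assumes "ee i * b = b"
  shows "mult (cpa src tgt) (path_elt (i, [loop i])) (nform b) - nform (arrow_val (loop i) * b)
     \<in> (potential_ideal :: (_ \<Rightarrow> 'k) set)"
proof -
  have ee: "ee i * (arrow_val (loop i) * b) = arrow_val (loop i) * b"
    by (simp add: mult.assoc [symmetric] ee_arrow_val)
  have "fscale (sg i * lp3 b i) (path_elt (i, [loop i, loop i, loop i, loop i])) +
      fscale (sg i * ar1 b i) (path_elt (i, [loop i, loop i, out i])) \<in> potential_ideal"
    by (intro cpa_ideal_add[OF ideal_potential_ideal] cpa_ideal_fscale[OF ideal_potential_ideal] loop4 loop_loop_out)
  moreover have "mult (cpa src tgt) (path_elt (i, [loop i])) (nform b) - nform (arrow_val (loop i) * b) =
      fscale (sg i * lp3 b i) (path_elt (i, [loop i, loop i, loop i, loop i])) +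
      fscale (sg i * ar1 b i) (path_elt (i, [loop i, loop i, out i]))"
    unfolding nform_ee[OF assms] nform_ee[OF ee] nform_at_def cpa_mult_add_right cpa_mult_fscale path_elt_mult
    by (auto simp: path_end_def arrow_val_loop fun_eq_iff fscale_def)
  ultimately show ?thesis by simp
qed

text \<open>Of the six basis paths at \<open>oth i\<close>, only the trivial one stays in normal
  form behind the arrow. The error \<open>?r\<close> has one relation for each of the other
  five.\<close>

lemma nform_out:
  assumes "ee (oth i) * b = b"
  shows "mult (cpa src tgt) (path_elt (i, [out i])) (nform b) - nform (arrow_val (out i) * b)
     \<in> (potential_ideal :: (_ \<Rightarrow> 'k) set)"
proof -
  let ?j = "oth i"
  have ee: "ee i * (arrow_val (out i) * b) = arrow_val (out i) * b"
    by (simp add: mult.assoc [symmetric] ee_arrow_val)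
  have 1: "wcong (- 1 :: 'k) i [out i, loop ?j] [loop i, out i]"
    using wcong_out_loop[OF three] .
  have 2: "wcong (kap i :: 'k) i [out i, out ?j] [loop i, loop i]"
    using wcong_out_out[OF three] .
  have 3: "wcong (- 1 :: 'k) i [out i, loop ?j, loop ?j] [loop i, out i, loop ?j]"
    using wcong_context[OF wcong_out_loop[OF three, of i], of i "[]" "[loop ?j]"]
    by (simp add: path_end_def is_path_Cons)
  have 4: "wcong (- 1 :: 'k) i [loop i, out i, loop ?j] [loop i, loop i, out i]"
    using wcong_context[OF wcong_out_loop[OF three, of i], of i "[loop i]" "[]"]
    by (simp add: path_end_def is_path_Cons)
  have 5: "wcong (0 :: 'k) i [loop i, loop i, out i] []"
    using loop_loop_out wcong_0 by blast
  have 6: "path_elt (i, [out i, loop ?j, loop ?j]) \<in> (potential_ideal :: (_ \<Rightarrow> 'k) set)"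
    using wcong_trans[OF 3 wcong_trans[OF 4 5]] by (simp add: wcong_0)
  interpret I: ideal "potential_ideal :: (_ \<Rightarrow> 'k) set" "cpa src tgt" by (rule ideal_potential_ideal)
  have "mult (cpa src tgt) (path_elt (i, [out i, loop ?j, loop ?j])) (path_elt (?j, [loop ?j]))
      \<in> (potential_ideal :: (_ \<Rightarrow> 'k) set)"
    by (intro I.I_r_closed path_elt_in_cpa 6) (simp add: is_path_Cons)
  then have 7: "path_elt (i, [out i, loop ?j, loop ?j, loop ?j]) \<in> (potential_ideal :: (_ \<Rightarrow> 'k) set)"
    by (simp add: path_elt_mult path_end_def)
  have 8: "wcong (- 1 :: 'k) i [out i, loop ?j, out ?j] [loop i, out i, out ?j]"
    using wcong_context[OF wcong_out_loop[OF three, of i], of i "[]" "[out ?j]"]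
    by (simp add: path_end_def is_path_Cons)
  have 9: "wcong (kap i :: 'k) i [loop i, out i, out ?j] [loop i, loop i, loop i]"
    using wcong_context[OF wcong_out_out[OF three, of i], of i "[loop i]" "[]"]
    by (simp add: path_end_def is_path_Cons)
  have 10: "wcong (- 1 * kap i :: 'k) i [out i, loop ?j, out ?j] [loop i, loop i, loop i]"
    by (rule wcong_trans[OF 8 9])
  let ?d = "\<lambda>c w w'. path_elt (i, w) - fscale (c :: 'k) (path_elt (i, w'))"
  let ?r = "fscale (sg ?j * lp1 b ?j) (?d (- 1) [out i, loop ?j] [loop i, out i]) +
      fscale (lp2 b ?j) (path_elt (i, [out i, loop ?j, loop ?j])) +
      fscale (sg ?j * lp3 b ?j) (path_elt (i, [out i, loop ?j, loop ?j, loop ?j])) +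
      fscale (ar0 b ?j) (?d (kap i) [out i, out ?j] [loop i, loop i]) +
      fscale (sg ?j * ar1 b ?j) (?d (- 1 * kap i) [out i, loop ?j, out ?j] [loop i, loop i, loop i])"
  have "?r \<in> potential_ideal"
    using 1 2 6 7 10 unfolding wcong_def
    by (intro cpa_ideal_add[OF ideal_potential_ideal] cpa_ideal_fscale[OF ideal_potential_ideal])
  moreover have "mult (cpa src tgt) (path_elt (i, [out i])) (nform b) - nform (arrow_val (out i) * b) = ?r"
    unfolding nform_ee[OF assms] nform_ee[OF ee] nform_at_def cpa_mult_add_right cpa_mult_fscale path_elt_mult
    by (auto simp: path_end_def arrow_val_out fun_eq_iff fscale_def algebra_simps)
  ultimately show ?thesis by simp
qed

text \<open>The tail is put in normal form first; the arrow in front is then absorbed by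
  \<open>nform_loop\<close> or \<open>nform_out\<close>. So the 12 chosen paths span modulo the
  ideal.\<close>

lemma path_elt_nform:
  "is_path src tgt (i, w) \<Longrightarrow> path_elt (i, w) - nform (path_val (i, w)) \<in> (potential_ideal :: (_ \<Rightarrow> 'k) set)"
proof (induction w arbitrary: i)
  case Nil
  have "path_elt (i, []) - nform (path_val (i, [])) = (0 :: _ \<Rightarrow> 'k)"
    unfolding path_val_Nil nform_ee[of i "ee i", simplified] nform_at_def
    by (auto simp: fun_eq_iff fscale_def)
  moreover have "(0 :: _ \<Rightarrow> 'k) \<in> potential_ideal"
    using additive_subgroup.zero_closed[OF ideal.axioms(1)[OF ideal_potential_ideal]]
    by (simp only: cpa_simps(3))
  ultimately show ?case by (simp only:)
next
  case (Cons x w)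
  interpret I: ideal "potential_ideal :: (_ \<Rightarrow> 'k) set" "cpa src tgt" by (rule ideal_potential_ideal)
  let ?b = "path_val (tgt x, w) :: 'k jac"
  have p: "src x = i" "is_path src tgt (tgt x, w)" using Cons.prems by (auto simp: is_path_Cons)
  have b: "ee (tgt x) * ?b = ?b" by (simp add: path_val_def)
  have 1: "mult (cpa src tgt) (path_elt (i, [x])) (path_elt (tgt x, w) - nform ?b)
      \<in> (potential_ideal :: (_ \<Rightarrow> 'k) set)"
    using p by (intro I.I_l_closed path_elt_in_cpa Cons.IH) (simp_all add: is_path_Cons)
  have 2: "mult (cpa src tgt) (path_elt (i, [x])) (nform ?b) - nform (arrow_val x * ?b)
      \<in> (potential_ideal :: (_ \<Rightarrow> 'k) set)"
    using arr_cases[of x] nform_loop[of i ?b] nform_out[of i ?b] b p by (metis src_tgt_loop_out(2,4))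
  have "path_elt (i, x # w) - nform (path_val (i, x # w)) =
     mult (cpa src tgt) (path_elt (i, [x])) (path_elt (tgt x, w) - nform ?b) +
     (mult (cpa src tgt) (path_elt (i, [x])) (nform ?b) - nform (arrow_val x * ?b))"
    using p by (simp add: cpa_mult_diff_right path_elt_mult path_end_def path_val_Cons)
  then show ?case using cpa_ideal_add[OF ideal_potential_ideal 1 2] by (simp only:)
qed

text \<open>An element of the closure agrees with an element of the ideal below degree 4, and these
  degrees determine \<open>path_eval\<close>. Conversely, if \<open>path_eval f\<close> is 0, then
  the normal forms of the terms of a truncation of f add up to 0, so the truncation is a combination
  of differences of a path and its normal form and lies in the ideal. The truncations converge to
  f.\<close>

lemma jacobian_ideal_eq: "jacobian_ideal src tgt W12 = (jker :: (_ \<Rightarrow> 'k) set)"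
proof
  show "jacobian_ideal src tgt W12 \<subseteq> (jker :: (_ \<Rightarrow> 'k) set)"
  proof
    fix f :: "(vert, arr) path \<Rightarrow> 'k" assume "f \<in> jacobian_ideal src tgt W12"
    then have f: "\<exists>g\<in>potential_ideal. \<forall>p. length (snd p) < n \<longrightarrow> f p = g p" for n
      by (auto simp: jacobian_ideal_def adic_closure_def)
    have "is_path src tgt p" if "f p \<noteq> 0" for p
    proof -
      obtain g where g: "g \<in> potential_ideal" "f p = g p" using f[of "Suc (length (snd p))"] by (metis lessI)
      then have "g \<in> carrier (cpa src tgt)" using potential_ideal_subset_jker by (auto simp: jker_def)
      then show ?thesis using that g by (cases p) (simp add: cpa_simps)
    qed
    moreover obtain g where g: "g \<in> potential_ideal" "\<And>p. length (snd p) < 4 \<Longrightarrow> f p = g p"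
      using f[of 4] by auto
    have "path_eval f = path_eval g"
      unfolding path_eval_def by (intro sum.cong refl) (use g(2) in \<open>auto simp: words_def\<close>)
    moreover have "path_eval g = 0" using g potential_ideal_subset_jker by (auto simp: jker_def)
    ultimately show "f \<in> jker" by (simp add: jker_def cpa_simps(1))
  qed
  show "(jker :: (_ \<Rightarrow> 'k) set) \<subseteq> jacobian_ideal src tgt W12"
  proof
    fix f :: "(vert, arr) path \<Rightarrow> 'k" assume f: "f \<in> jker"
    have "\<exists>g\<in>potential_ideal. \<forall>p. length (snd p) < n \<longrightarrow> f p = g p" for n
    proof
      \<comment> \<open>Length n + 3 covers all words below length n and also the words up to length
        3 that \<open>path_eval\<close> sees.\<close>
      let ?N = "UNIV \<times> words (n + 3)"
      let ?g = "\<Sum>p\<in>?N. fscale (f p) (path_elt p - nform (path_val p))"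
      have zero: "(0 :: _ \<Rightarrow> 'k) \<in> potential_ideal"
        using additive_subgroup.zero_closed[OF ideal.axioms(1)[OF ideal_potential_ideal]]
        by (simp only: cpa_simps(3))
      have term_in: "fscale (f p) (path_elt p - nform (path_val p)) \<in> potential_ideal" for p
      proof (cases "f p = 0")
        case True
        then have "fscale (f p) (path_elt p - nform (path_val p)) = 0" by (auto simp: fscale_def)
        then show ?thesis using zero by simp
      next
        case False
        then have "is_path src tgt p" using f by (cases p) (auto simp: jker_def cpa_simps)
        then show ?thesis
          using path_elt_nform[of "fst p" "snd p"] by (simp add: cpa_ideal_fscale[OF ideal_potential_ideal])
      qed
      have "(\<Sum>p\<in>T. fscale (f p) (path_elt p - nform (path_val p))) \<in> potential_ideal" for T
      proof (induction T rule: infinite_finite_induct)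
        case (insert p T)
        then show ?case
          using cpa_ideal_add[OF ideal_potential_ideal term_in[of p] insert.IH]
          by (simp only: sum.insert not_False_eq_True)
      qed (simp_all only: sum.infinite sum.empty zero not_False_eq_True)
      then show "?g \<in> potential_ideal" .
      have "path_eval f = (\<Sum>p\<in>?N. sc (f p) * path_val p)"
        unfolding path_eval_def
      proof (intro sum.mono_neutral_left finite_cartesian_product finite_words ballI)
        fix p :: "(vert, arr) path" assume "p \<in> ?N - UNIV \<times> words 3"
        then have "4 \<le> length (snd p)" by (auto simp: words_def)
        then show "sc (f p) * path_val p = 0"
          by (cases p) (simp add: path_val_long)
      qed (auto simp: words_def)
      then have s: "(\<Sum>p\<in>?N. fscale (f p) (nform (path_val p))) = 0"
        using f by (simp add: jker_def nform_linear(2) [symmetric] nform_sum [symmetric] nform_linear(3))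
      have "?g = (\<Sum>p\<in>?N. fscale (f p) (path_elt p)) - (\<Sum>p\<in>?N. fscale (f p) (nform (path_val p)))"
        unfolding sum_subtractf [symmetric]
        by (intro sum.cong refl ext) (simp add: fscale_def algebra_simps)
      then have g: "?g = (\<Sum>p\<in>?N. fscale (f p) (path_elt p))" using s by simp
      have ev: "(\<Sum>p\<in>T. h p) q = (\<Sum>p\<in>T. h p q)" if "finite T" for T q and h :: "(vert, arr) path \<Rightarrow> (vert, arr) path \<Rightarrow> 'k"
        using that by (induction T rule: finite_induct) auto
      show "\<forall>p. length (snd p) < n \<longrightarrow> f p = ?g p"
      proof (intro allI impI)
        fix q :: "(vert, arr) path" assume q: "length (snd q) < n"
        have "?g q = (\<Sum>p\<in>?N. if p = q then f p else 0)"
          unfolding g ev[OF finite_cartesian_product[OF finite finite_words]]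
          by (intro sum.cong refl) (auto simp: fscale_def path_elt_def)
        also have "\<dots> = f q"
        proof -
          have "q \<in> ?N" using q by (cases q) (auto simp: words_def)
          then show ?thesis by simp
        qed
        finally show "f q = ?g q" by simp
      qed
    qed
    then show "f \<in> jacobian_ideal src tgt W12"
      by (auto simp: jacobian_ideal_def adic_closure_def)
  qed
qed

end

section \<open>The quotient algebra identified with \<open>jac\<close>\<close>

definition jac_coset :: "'k::field jac \<Rightarrow> ((vert, arr) path \<Rightarrow> 'k) set" where
  "jac_coset b = {f \<in> carrier (cpa src tgt). path_eval f = b}"

lemma jker_coset: "f \<in> carrier (cpa src tgt) \<Longrightarrow> jker +>\<^bsub>cpa src tgt\<^esub> f = jac_coset (path_eval f)"
  unfolding jac_coset_def jker_a_kernel by (rule ring_hom_ring.rcos_eq_homeq[OF path_eval_hom])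

lemma jac_coset_nform: "jac_coset b = jker +>\<^bsub>cpa src tgt\<^esub> nform b"
  using jker_coset[OF nform_closed[of b]] by (simp add: path_eval_nform)

lemma Lambda12_simps:
  assumes "(3::'k::field) \<noteq> 0" "(2::'k) \<noteq> 0"
  shows "carrier (Lambda12 :: (_, 'k, _) vertex_algebra) = range jac_coset"
    and "zero (Lambda12 :: (_, 'k, _) vertex_algebra) = jac_coset 0"
    and "one (Lambda12 :: (_, 'k, _) vertex_algebra) = jac_coset 1"
    and "add (Lambda12 :: (_, 'k, _) vertex_algebra) (jac_coset x) (jac_coset y) = jac_coset (x + y)"
    and "mult (Lambda12 :: (_, 'k, _) vertex_algebra) (jac_coset x) (jac_coset y) = jac_coset (x * y)"
    and "scal (Lambda12 :: (_, 'k, _) vertex_algebra) c = jac_coset (sc c)"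
    and "idem (Lambda12 :: (_, 'k, _) vertex_algebra) i = jac_coset (ee i)"
proof -
  let ?R = "cpa src tgt :: ((vert, arr) path \<Rightarrow> 'k) ring"
  interpret J: ideal "jker :: (_ \<Rightarrow> 'k) set" ?R by (rule ideal_jker)
  note L = Lambda12_def completed_jacobian_algebra_def Let_def jacobian_ideal_eq[OF assms] FactRing_def
    ring.defs vertex_algebra.defs
  show "carrier (Lambda12 :: (_, 'k, _) vertex_algebra) = range jac_coset"
  proof -
    have "carrier (Lambda12 :: (_, 'k, _) vertex_algebra) = (\<lambda>f. jker +>\<^bsub>?R\<^esub> f) ` carrier ?R"
      by (auto simp: L A_RCOSETS_def')
    also have "\<dots> = (\<lambda>f. jac_coset (path_eval f)) ` carrier ?R"
      by (rule image_cong) (simp_all add: jker_coset)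
    also have "\<dots> = jac_coset ` path_eval ` carrier ?R"
      by (simp only: image_image)
    also have "path_eval ` carrier ?R = UNIV"
    proof (rule UNIV_eq_I [symmetric])
      fix b :: "'k jac"
      have "path_eval (nform b) \<in> path_eval ` carrier ?R"
        by (rule imageI[OF nform_closed])
      then show "b \<in> path_eval ` carrier ?R" by (simp only: path_eval_nform)
    qed
    finally show ?thesis .
  qed
  have one: "(\<lambda>p. if snd p = [] then c else 0) \<in> carrier ?R" for c
    by (auto simp: cpa_simps split: if_splits)
  let ?L = "Lambda12 :: (_, 'k, _) vertex_algebra"
  have "zero ?L = jker" by (simp add: L)
  then show "zero ?L = jac_coset 0" by (simp only: jac_coset_def jker_def)
  have "one ?L = jker +>\<^bsub>?R\<^esub> one ?R" by (simp add: L)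
  then show "one ?L = jac_coset 1"
    using one[of 1] by (simp only: jker_coset path_eval_one cpa_simps(2) sc_simps)
  have "scal ?L c = jker +>\<^bsub>?R\<^esub> (\<lambda>p. if snd p = [] then c else 0)" by (simp add: L)
  then show "scal ?L c = jac_coset (sc c)"
    using one[of c] by (simp only: jker_coset path_eval_one)
  have "idem ?L i = jker +>\<^bsub>?R\<^esub> path_elt (i, [])" by (simp add: L)
  then show "idem ?L i = jac_coset (ee i)"
    by (simp only: jker_coset path_elt_in_cpa is_path_Nil path_eval_path_elt path_val_Nil)
  have "add ?L X Y = X <+>\<^bsub>?R\<^esub> Y" for X Y by (simp add: L)
  then show "add ?L (jac_coset x) (jac_coset y) = jac_coset (x + y)"
    using J.a_rcos_sum[OF nform_closed[of x] nform_closed[of y]]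
    by (simp only: jac_coset_nform cpa_simps(4) nform_linear)
  have "mult ?L X Y = rcoset_mult ?R jker X Y" for X Y by (simp add: L)
  then have "mult ?L (jac_coset x) (jac_coset y) = jker +>\<^bsub>?R\<^esub> (nform x \<otimes>\<^bsub>?R\<^esub> nform y)"
    using J.rcoset_mult_add[OF nform_closed[of x] nform_closed[of y]]
    by (simp only: jac_coset_nform)
  then show "mult ?L (jac_coset x) (jac_coset y) = jac_coset (x * y)"
    by (simp only: jker_coset cpa_mult_closed nform_closed path_eval_mult path_eval_nform)
qed

lemma inj_jac_coset: "inj jac_coset"
proof (rule injI)
  fix x y :: "'k::field jac" assume "jac_coset x = jac_coset y"
  moreover have "nform x \<in> jac_coset x" by (simp add: jac_coset_def nform_closed path_eval_nform)
  ultimately show "x = y" by (simp add: jac_coset_def path_eval_nform)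
qed

section \<open>Modules and projective covers\<close>

lemma ee_mult_iff: "ee i * b = b \<longleftrightarrow>
    lp0 b (oth i) = 0 \<and> lp1 b (oth i) = 0 \<and> lp2 b (oth i) = 0 \<and> lp3 b (oth i) = 0 \<and>
    ar0 b (oth i) = 0 \<and> ar1 b (oth i) = 0"
  unfolding jac_eq_iff all_vert[of _ i] by auto

text \<open>The loop part of e_i v is a power series in z modulo z^4 with nonzero constant term, and
  y inverts it coefficient by coefficient. As y is supported on loops at i, it annihilates the arrow
  part of e_i v.\<close>

lemma jac_unit:
  assumes "lp0 v i \<noteq> 0"
  obtains y where "ee i * v * y = ee i"
proof -
  define c where "c = inverse (lp0 v i)"
  have c: "lp0 v i * c = 1" using assms by (simp add: c_def)
  define y1 where "y1 = - c * (lp1 v i * c)"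
  define y2 where "y2 = - c * (lp1 v i * y1 + lp2 v i * c)"
  define y3 where "y3 = - c * (lp1 v i * y2 + lp2 v i * y1 + lp3 v i * c)"
  have inv: "lp0 v i * (- c * x) = - x" for x
    using c by (metis mult.assoc mult_1_left mult_minus_right mult_minus_left)
  have 1: "lp0 v i * y1 = - (lp1 v i * c)" "lp0 v i * y2 = - (lp1 v i * y1 + lp2 v i * c)"
    "lp0 v i * y3 = - (lp1 v i * y2 + lp2 v i * y1 + lp3 v i * c)"
    unfolding y1_def y2_def y3_def by (rule inv)+
  let ?s = "\<lambda>x v. if v = i then x else 0"
  have "ee i * v * Jac (?s c) (?s y1) (?s y2) (?s y3) (\<lambda>_. 0) (\<lambda>_. 0) = ee i"
    using c 1 by (auto simp: jac_eq_iff)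
  then show thesis by (rule that)
qed

text \<open>\<open>jfree a\<close> is \<open>proj_sum A a\<close> with all coordinates in \<open>jac\<close>.\<close>

type_synonym 'k jvec = "vert \<Rightarrow> nat \<Rightarrow> 'k jac"

definition jfree :: "(vert \<Rightarrow> nat) \<Rightarrow> 'k::field jvec set" where
  "jfree a = {u. \<forall>i k. if k < a i then ee i * u i k = u i k else u i k = 0}"

definition rmul :: "'k::field jvec \<Rightarrow> 'k jac \<Rightarrow> 'k jvec" where
  "rmul u b = (\<lambda>i k. u i k * b)"

definition vsingle :: "vert \<Rightarrow> nat \<Rightarrow> 'k::field jac \<Rightarrow> 'k jvec" where
  "vsingle i k b = (\<lambda>j l. if j = i \<and> l = k then b else 0)"

text \<open>For u in a free module this is membership in the radical. The entry \<open>u i k\<close>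
  lies in e_i \<open>jac\<close>, so it has no constant coefficient at the other vertex.\<close>

definition vrad :: "'k::field jvec \<Rightarrow> bool" where
  "vrad u \<longleftrightarrow> (\<forall>i k. lp0 (u i k) i = 0)"

lemma jfree_ee: "u \<in> jfree a \<Longrightarrow> ee i * u i k = u i k"
  by (auto simp: jfree_def split: if_splits) (metis mult_zero_right)

lemma jfree_out: "u \<in> jfree a \<Longrightarrow> \<not> k < a i \<Longrightarrow> u i k = 0"
  by (auto simp: jfree_def)

lemma jfreeI: "(\<And>i k. k < a i \<Longrightarrow> ee i * u i k = u i k) \<Longrightarrow> (\<And>i k. a i \<le> k \<Longrightarrow> u i k = 0) \<Longrightarrow> u \<in> jfree a"
  by (auto simp: jfree_def)

lemma jfree_zero [simp]: "0 \<in> jfree a"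
  by (auto simp: jfree_def)

lemma jfree_add: "u \<in> jfree a \<Longrightarrow> v \<in> jfree a \<Longrightarrow> u + v \<in> jfree a"
  by (auto simp: jfree_def distrib_left)

lemma jfree_diff: "u \<in> jfree a \<Longrightarrow> v \<in> jfree a \<Longrightarrow> u - v \<in> jfree a"
  by (auto simp: jfree_def right_diff_distrib)

lemma jfree_uminus: "u \<in> jfree a \<Longrightarrow> - u \<in> jfree a"
  by (auto simp: jfree_def)

lemma jfree_rmul: "u \<in> jfree a \<Longrightarrow> rmul u b \<in> jfree a"
  by (auto simp: jfree_def rmul_def mult.assoc [symmetric])

lemma jfree_sum: "(\<And>t. t \<in> T \<Longrightarrow> f t \<in> jfree a) \<Longrightarrow> sum f T \<in> jfree a"
  by (induction T rule: infinite_finite_induct) (simp_all add: jfree_add del: plus_fun_apply)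

lemma jfree_vsingle: "k < a i \<Longrightarrow> ee i * b = b \<Longrightarrow> vsingle i k b \<in> jfree a"
  by (auto simp: jfree_def vsingle_def)

lemma rmul_simps: "rmul (u + v) b = rmul u b + rmul v b" "rmul u (b + c) = rmul u b + rmul u c"
  "rmul u (b * c) = rmul (rmul u b) c" "rmul u 1 = u" "rmul u 0 = 0" "rmul 0 b = 0"
  "rmul (u - v) b = rmul u b - rmul v b" "rmul u (b - c) = rmul u b - rmul u c"
  by (auto simp: rmul_def fun_eq_iff algebra_simps)

lemma rmul_vsingle: "rmul (vsingle i k b) c = vsingle i k (b * c)"
  by (auto simp: rmul_def vsingle_def fun_eq_iff)

lemma jvec_sum_apply: "(\<Sum>t\<in>T. f t) i k = (\<Sum>t\<in>T. f t i (k::nat) :: 'k::field jac)"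
  by (induction T rule: infinite_finite_induct) auto

lemma jfree_expand:
  assumes "u \<in> jfree a"
  shows "u = (\<Sum>(i, k)\<in>(SIGMA i:UNIV. {..<a i}). rmul (vsingle i k (ee i)) (u i k))"
proof (intro ext)
  fix j l
  have "(\<Sum>(i, k)\<in>(SIGMA i:UNIV. {..<a i}). rmul (vsingle i k (ee i)) (u i k)) j l =
    (\<Sum>p\<in>(SIGMA i:UNIV. {..<a i}). if p = (j, l) then u j l else 0)"
    unfolding jvec_sum_apply
    by (intro sum.cong refl) (auto simp: vsingle_def rmul_def jfree_ee[OF assms] split: if_splits)
  also have "\<dots> = u j l"
    using jfree_out[OF assms] by (auto simp: sum.delta)
  finally show "u j l = (\<Sum>(i, k)\<in>(SIGMA i:UNIV. {..<a i}). rmul (vsingle i k (ee i)) (u i k)) j l"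
    by simp
qed

lemma vrad_pow:
  assumes "u \<in> jfree a" "vrad u"
  shows "u i k \<in> jac_pow 1"
proof -
  have "lp0 (u i k) v = 0" for v
    using assms jfree_ee[OF assms(1), of i k] by (cases "v = i") (auto simp: vrad_def neq_iff_oth ee_mult_iff)
  then show ?thesis by (auto simp: jac_pow_def)
qed

text \<open>Each generator is an element of X plus a radical vector. Expanding u in the generators
  therefore leaves, modulo X, a vector whose entries are one step deeper in the radical filtration,
  and the fourth step is zero. The induction counts the steps that remain.\<close>

lemma nakayama_jfree:
  assumes X: "0 \<in> X" "\<And>u v. u \<in> X \<Longrightarrow> v \<in> X \<Longrightarrow> u + v \<in> X" "\<And>u b. u \<in> X \<Longrightarrow> rmul u b \<in> X"
    and gen: "\<And>i k. k < a i \<Longrightarrow> \<exists>n\<in>jfree a. vrad n \<and> vsingle i k (ee i) - n \<in> X"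
    and u: "u \<in> jfree a"
  shows "u \<in> X"
proof -
  define n where "n i k = (SOME n. n \<in> jfree a \<and> vrad n \<and> vsingle i k (ee i) - n \<in> X)" for i k
  have n: "n i k \<in> jfree a" "vrad (n i k)" "vsingle i k (ee i) - n i k \<in> X" if "k < a i" for i k
  proof -
    have "\<exists>n. n \<in> jfree a \<and> vrad n \<and> vsingle i k (ee i) - n \<in> X"
      using gen[OF that] by blast
    from someI_ex[OF this] show "n i k \<in> jfree a" "vrad (n i k)" "vsingle i k (ee i) - n i k \<in> X"
      unfolding n_def by blast+
  qed
  have sumX: "sum f T \<in> X" if "\<And>t. t \<in> T \<Longrightarrow> f t \<in> X" for f and T :: "(vert \<times> nat) set"
    using that
  proof (induction T rule: infinite_finite_induct)
    case (insert t T)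
    then show ?case using X(2) by (simp only: sum.insert not_False_eq_True) blast
  qed (simp_all only: sum.infinite sum.empty X(1) not_False_eq_True)
  have "u \<in> X" if "u \<in> jfree a" "\<And>i k. u i k \<in> jac_pow (4 - d)" "d \<le> 4" for u d
    using that
  proof (induction d arbitrary: u)
    case 0
    then have "u = 0" by (auto simp: jac_pow_4 fun_eq_iff)
    then show ?case using X(1) by (simp only:)
  next
    case (Suc d)
    let ?I = "SIGMA i:UNIV. {..<a i}"
    let ?x = "\<Sum>(i, k)\<in>?I. rmul (vsingle i k (ee i) - n i k) (u i k)"
    let ?y = "\<Sum>(i, k)\<in>?I. rmul (n i k) (u i k)"
    have "?x \<in> X" by (rule sumX) (auto intro: X(3) n(3))
    moreover have "?y \<in> X"
    proof (rule Suc.IH)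
      show "?y \<in> jfree a" by (rule jfree_sum) (auto intro: jfree_rmul n(1))
      fix j l
      have "n i k j l * u i k \<in> jac_pow (4 - d)" if "k < a i" for i k
      proof -
        have "Suc (4 - Suc d) = 4 - d" using Suc.prems(3) by simp
        then show ?thesis
          using jac_pow_mult[OF vrad_pow[OF n(1,2)[OF that], of j l] Suc.prems(2)[of i k]] by (simp only:)
      qed
      then show "?y j l \<in> jac_pow (4 - d)"
        unfolding jvec_sum_apply by (intro jac_pow_sum) (auto simp: rmul_def)
      show "d \<le> 4" using Suc.prems(3) by simp
    qed
    ultimately have xy: "?x + ?y \<in> X" by (rule X(2))
    have eq: "u = ?x + ?y"
      unfolding sum.distrib [symmetric]
      by (subst jfree_expand[OF Suc.prems(1)]) (intro sum.cong refl, auto simp: rmul_simps)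
    show ?case by (rule back_subst[of "\<lambda>v. v \<in> X", OF xy eq [symmetric]])
  qed
  from this[OF u, of 4] show ?thesis by (simp only: diff_self_eq_0 jac_pow_0 order_refl)
qed

section \<open>Modules over an algebra isomorphic to \<open>jac\<close>\<close>

text \<open>The elements of \<open>Lambda12\<close> are cosets of functions on paths. From here on
  only the isomorphism \<psi> matters, and all computations take place in
  \<open>jac\<close>.\<close>

locale jac_algebra =
  fixes A :: "('r, 'k::field, vert) vertex_algebra" and \<psi> :: "'k jac \<Rightarrow> 'r"
  assumes inj_psi: "inj \<psi>"
    and carrier_A: "carrier A = range \<psi>"
    and zero_A: "\<zero>\<^bsub>A\<^esub> = \<psi> 0"
    and one_A: "\<one>\<^bsub>A\<^esub> = \<psi> 1"
    and add_A: "\<And>x y. \<psi> x \<oplus>\<^bsub>A\<^esub> \<psi> y = \<psi> (x + y)"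
    and mult_A: "\<And>x y. \<psi> x \<otimes>\<^bsub>A\<^esub> \<psi> y = \<psi> (x * y)"
    and scal_A: "\<And>c. scal A c = \<psi> (sc c)"
    and idem_A: "\<And>i. idem A i = \<psi> (ee i)"
    and two_nonzero: "(2::'k) \<noteq> 0"
begin

definition \<phi> :: "'r \<Rightarrow> 'k jac" where
  "\<phi> = inv_into UNIV \<psi>"

lemma phi_psi [simp]: "\<phi> (\<psi> b) = b"
  by (simp add: \<phi>_def inj_psi)

lemma psi_eq [simp]: "\<psi> b = \<psi> c \<longleftrightarrow> b = c"
  using inj_psi by (simp add: inj_eq)

lemma psi_phi: "r \<in> carrier A \<Longrightarrow> \<psi> (\<phi> r) = r"
  by (auto simp: carrier_A)

lemma psi_closed [simp]: "\<psi> b \<in> carrier A"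
  by (simp add: carrier_A)

definition act :: "('r, 'm) module \<Rightarrow> 'm \<Rightarrow> 'k jac \<Rightarrow> 'm" where
  "act M x b = \<psi> b \<odot>\<^bsub>M\<^esub> x"

definition vmap :: "'k jvec \<Rightarrow> vert \<Rightarrow> nat \<Rightarrow> 'r" where
  "vmap u = (\<lambda>i k. \<psi> (u i k))"

definition vinv :: "(vert \<Rightarrow> nat \<Rightarrow> 'r) \<Rightarrow> 'k jvec" where
  "vinv w = (\<lambda>i k. \<phi> (w i k))"

lemma vinv_vmap [simp]: "vinv (vmap u) = u"
  by (simp add: vinv_def vmap_def)

lemma vmap_eq [simp]: "vmap u = vmap v \<longleftrightarrow> u = v"
  by (metis vinv_vmap)

lemma idem_range: "{idem A i \<otimes>\<^bsub>A\<^esub> r | r. r \<in> carrier A} = \<psi> ` {b. ee i * b = b}"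
proof -
  have "{idem A i \<otimes>\<^bsub>A\<^esub> r | r. r \<in> carrier A} = range (\<lambda>b. \<psi> (ee i * b))"
  proof (intro Set.set_eqI iffI)
    fix x assume "x \<in> range (\<lambda>b. \<psi> (ee i * b))"
    then obtain b where "x = idem A i \<otimes>\<^bsub>A\<^esub> \<psi> b" by (auto simp: idem_A mult_A)
    then show "x \<in> {idem A i \<otimes>\<^bsub>A\<^esub> r | r. r \<in> carrier A}" by (auto simp: carrier_A)
  qed (auto simp: carrier_A idem_A mult_A)
  also have "\<dots> = \<psi> ` {b. ee i * b = b}"
    by (auto simp: image_iff) (metis ee_idem_left)
  finally show ?thesis .
qed

lemma proj_sum_carrier: "carrier (proj_sum A a) = vmap ` jfree a"
proof
  show "carrier (proj_sum A a) \<subseteq> vmap ` jfree a"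
  proof
    fix w assume "w \<in> carrier (proj_sum A a)"
    then have w0: "\<forall>i k. if k < a i then w i k \<in> {idem A i \<otimes>\<^bsub>A\<^esub> r | r. r \<in> carrier A}
        else w i k = \<zero>\<^bsub>A\<^esub>"
      by (simp add: proj_sum_def)
    have w: "if k < a i then w i k \<in> \<psi> ` {b. ee i * b = b} else w i k = \<psi> 0" for i k
      using w0[THEN spec, of i, THEN spec, of k] unfolding idem_range zero_A .
    have "w i k = \<psi> (\<phi> (w i k))" for i k
      using w[of k i] by (auto split: if_splits)
    then have "w = vmap (vinv w)" by (auto simp: vmap_def vinv_def)
    moreover have "vinv w \<in> jfree a"
    proof (rule jfreeI)
      fix i k assume "k < a i" then show "ee i * vinv w i k = vinv w i k"
        using w[of k i] by (auto simp: vinv_def)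
    next
      fix i k assume "a i \<le> k" then show "vinv w i k = 0"
        using w[of k i] by (auto simp: vinv_def split: if_splits)
    qed
    ultimately show "w \<in> vmap ` jfree a" by blast
  qed
  show "vmap ` jfree a \<subseteq> carrier (proj_sum A a)"
    by (auto simp: proj_sum_def idem_range zero_A vmap_def jfree_def)
qed

lemma proj_sum_simps:
  "\<zero>\<^bsub>proj_sum A a\<^esub> = vmap 0"
  "vmap u \<oplus>\<^bsub>proj_sum A a\<^esub> vmap v = vmap (u + v)"
  "\<psi> b \<odot>\<^bsub>proj_sum A a\<^esub> vmap u = vmap (rmul u b)"
  by (auto simp: proj_sum_def vmap_def rmul_def zero_A add_A mult_A)

lemma proj_sum_abelian: "abelian_group (proj_sum A a)"
proof (rule abelian_groupI)
  fix x assume "x \<in> carrier (proj_sum A a)"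
  then obtain u where u: "u \<in> jfree a" "x = vmap u" by (auto simp: proj_sum_carrier)
  have "vmap (- u) \<in> carrier (proj_sum A a)"
    unfolding proj_sum_carrier using u by (intro imageI jfree_uminus) auto
  moreover have "vmap (- u) \<oplus>\<^bsub>proj_sum A a\<^esub> x = \<zero>\<^bsub>proj_sum A a\<^esub>"
    by (simp add: u proj_sum_simps)
  ultimately show "\<exists>y\<in>carrier (proj_sum A a). y \<oplus>\<^bsub>proj_sum A a\<^esub> x = \<zero>\<^bsub>proj_sum A a\<^esub>" by blast
qed (auto simp: proj_sum_carrier proj_sum_simps add.assoc add.commute intro!: imageI jfree_add)

lemma proj_sum_module: "right_module A (proj_sum A a)"
  unfolding right_module_def
  by (auto simp: proj_sum_abelian proj_sum_carrier carrier_A proj_sum_simps rmul_simps add_A mult_A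
      one_A jfree_rmul)

end

locale jac_module = jac_algebra A \<psi>
  for A :: "('r, 'k::field, vert) vertex_algebra" and \<psi> :: "'k jac \<Rightarrow> 'r" +
  fixes M :: "('r, 'm) module"
  assumes right_module: "right_module A M"
begin

sublocale M: abelian_group M
  using right_module by (simp add: right_module_def)

lemma act_closed [simp, intro]: "x \<in> carrier M \<Longrightarrow> act M x b \<in> carrier M"
  using right_module by (simp add: right_module_def act_def)

lemma act_add: "x \<in> carrier M \<Longrightarrow> y \<in> carrier M \<Longrightarrow> act M (x \<oplus>\<^bsub>M\<^esub> y) b = act M x b \<oplus>\<^bsub>M\<^esub> act M y b"
  using right_module by (simp add: right_module_def act_def)

lemma act_plus: "x \<in> carrier M \<Longrightarrow> act M x (b + c) = act M x b \<oplus>\<^bsub>M\<^esub> act M x c"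
  using right_module by (simp add: right_module_def act_def add_A [symmetric])

lemma act_mult: "x \<in> carrier M \<Longrightarrow> act M x (b * c) = act M (act M x b) c"
  using right_module by (simp add: right_module_def act_def mult_A [symmetric])

lemma act_one [simp]: "x \<in> carrier M \<Longrightarrow> act M x 1 = x"
  using right_module by (simp add: right_module_def act_def one_A [symmetric])

lemma act_0 [simp]: "x \<in> carrier M \<Longrightarrow> act M x 0 = \<zero>\<^bsub>M\<^esub>"
  using act_plus[of x 0 0] by (simp add: M.add.l_cancel_one')

lemma act_zero [simp]: "act M \<zero>\<^bsub>M\<^esub> b = \<zero>\<^bsub>M\<^esub>"
  using act_add[of "\<zero>\<^bsub>M\<^esub>" "\<zero>\<^bsub>M\<^esub>" b] by (simp add: M.add.l_cancel_one')

lemma act_uminus: "x \<in> carrier M \<Longrightarrow> act M x (- b) = \<ominus>\<^bsub>M\<^esub> act M x b"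
  using act_plus[of x "- b" b] by (simp add: M.minus_equality)

lemma act_diff: "x \<in> carrier M \<Longrightarrow> act M x (b - c) = act M x b \<ominus>\<^bsub>M\<^esub> act M x c"
  using act_plus[of x b "- c"] by (simp add: act_uminus a_minus_def)

lemma minus_eq_zero_iff:
  assumes "x \<in> carrier M" "y \<in> carrier M"
  shows "x \<ominus>\<^bsub>M\<^esub> y = \<zero>\<^bsub>M\<^esub> \<longleftrightarrow> x = y"
proof
  assume "x \<ominus>\<^bsub>M\<^esub> y = \<zero>\<^bsub>M\<^esub>"
  then have "\<ominus>\<^bsub>M\<^esub> (\<ominus>\<^bsub>M\<^esub> y) = x"
    using assms by (intro M.minus_equality) (simp_all add: a_minus_def)
  then show "x = y" using assms by simp
qed (use assms in \<open>simp add: a_minus_def M.r_neg\<close>)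

lemma act_eq_iff: "x \<in> carrier M \<Longrightarrow> act M x b = act M x c \<longleftrightarrow> act M x (b - c) = \<zero>\<^bsub>M\<^esub>"
  by (simp add: act_diff minus_eq_zero_iff)

lemma act_sum:
  assumes "finite T" "x \<in> carrier M"
  shows "act M x (\<Sum>t\<in>T. f t) = (\<Oplus>\<^bsub>M\<^esub>t\<in>T. act M x (f t))"
  using assms by (induction T rule: finite_induct) (simp_all add: act_plus Pi_def)

end

context jac_algebra
begin

text \<open>Homomorphisms out of \<open>proj_sum A a\<close>, read on coordinate vectors. In
  contrast to members of \<open>rhom\<close>, their values outside the domain are unconstrained, so
  they can be written as plain formulas.\<close>

definition jhom :: "(vert \<Rightarrow> nat) \<Rightarrow> ('k jvec \<Rightarrow> 'm) \<Rightarrow> ('r, 'm) module \<Rightarrow> bool" where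
  "jhom a Q M \<longleftrightarrow> (\<forall>u\<in>jfree a. Q u \<in> carrier M) \<and>
     (\<forall>u\<in>jfree a. \<forall>v\<in>jfree a. Q (u + v) = Q u \<oplus>\<^bsub>M\<^esub> Q v) \<and>
     (\<forall>u\<in>jfree a. \<forall>b. Q (rmul u b) = act M (Q u) b)"

lemma jhom_of_rhom:
  assumes "q \<in> rhom A (proj_sum A a) M"
  shows "jhom a (\<lambda>u. q (vmap u)) M"
proof -
  have 1: "q w \<in> carrier M" if "w \<in> carrier (proj_sum A a)" for w
    using assms that by (auto simp: rhom_def)
  have 2: "q (x \<oplus>\<^bsub>proj_sum A a\<^esub> y) = q x \<oplus>\<^bsub>M\<^esub> q y"
    if "x \<in> carrier (proj_sum A a)" "y \<in> carrier (proj_sum A a)" for x y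
    using assms that by (simp add: rhom_def)
  have 3: "q (r \<odot>\<^bsub>proj_sum A a\<^esub> x) = r \<odot>\<^bsub>M\<^esub> q x"
    if "x \<in> carrier (proj_sum A a)" "r \<in> carrier A" for r x
    using assms that by (simp add: rhom_def)
  show ?thesis
    unfolding jhom_def act_def
  proof (intro conjI ballI allI)
    fix u v :: "'k jvec" and b assume u: "u \<in> jfree a"
    then have u': "vmap u \<in> carrier (proj_sum A a)" by (simp add: proj_sum_carrier)
    then show "q (vmap u) \<in> carrier M" by (rule 1)
    show "q (vmap (rmul u b)) = \<psi> b \<odot>\<^bsub>M\<^esub> q (vmap u)"
      using 3[OF u' psi_closed] by (simp only: proj_sum_simps)
    assume "v \<in> jfree a"
    then have "vmap v \<in> carrier (proj_sum A a)" by (simp add: proj_sum_carrier)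
    from 2[OF u' this] show "q (vmap (u + v)) = q (vmap u) \<oplus>\<^bsub>M\<^esub> q (vmap v)"
      by (simp only: proj_sum_simps)
  qed
qed

lemma rhom_of_jhom:
  assumes "jhom a Q M"
  shows "(\<lambda>w\<in>carrier (proj_sum A a). Q (vinv w)) \<in> rhom A (proj_sum A a) M"
proof -
  let ?P = "proj_sum A a"
  have Q: "(\<lambda>w\<in>carrier ?P. Q (vinv w)) (vmap u) = Q u" if "u \<in> jfree a" for u
    using that by (simp add: proj_sum_carrier)
  have "(\<lambda>w\<in>carrier ?P. Q (vinv w)) \<in> carrier ?P \<rightarrow>\<^sub>E carrier M"
    using assms by (auto simp: proj_sum_carrier jhom_def)
  then show ?thesis
    unfolding rhom_def
    using assms by (auto simp: proj_sum_carrier[of a] proj_sum_simps carrier_A jhom_def act_def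
        jfree_add jfree_rmul simp del: restrict_apply' intro: imageI)
qed

lemma jhom_closed: "jhom a Q M \<Longrightarrow> u \<in> jfree a \<Longrightarrow> Q u \<in> carrier M"
  by (simp add: jhom_def)

lemma jhom_add: "jhom a Q M \<Longrightarrow> u \<in> jfree a \<Longrightarrow> v \<in> jfree a \<Longrightarrow> Q (u + v) = Q u \<oplus>\<^bsub>M\<^esub> Q v"
  by (simp add: jhom_def)

lemma jhom_rmul: "jhom a Q M \<Longrightarrow> u \<in> jfree a \<Longrightarrow> Q (rmul u b) = act M (Q u) b"
  by (simp add: jhom_def)

end

section \<open>Existence of projective covers\<close>

context jac_module
begin

lemma jhom_0: "jhom a Q M \<Longrightarrow> Q 0 = \<zero>\<^bsub>M\<^esub>"
  using jhom_rmul[of a Q M 0 0] jhom_closed[of a Q M 0] by (simp add: rmul_simps)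

lemma jhom_diff:
  assumes "jhom a Q M" "u \<in> jfree a" "v \<in> jfree a"
  shows "Q (u - v) = Q u \<ominus>\<^bsub>M\<^esub> Q v"
proof -
  have "Q (u - v) \<oplus>\<^bsub>M\<^esub> Q v = Q u"
    using jhom_add[OF assms(1) jfree_diff[OF assms(2,3)] assms(3)] by simp
  then show ?thesis
    using jhom_closed[OF assms(1)] assms jfree_diff[OF assms(2,3)]
    by (metis M.add.inv_solve_right' a_minus_def)
qed

lemma jhom_eq_iff:
  assumes "jhom a Q M" "u \<in> jfree a" "v \<in> jfree a"
  shows "Q u = Q v \<longleftrightarrow> Q (u - v) = \<zero>\<^bsub>M\<^esub>"
  using jhom_diff[OF assms] jhom_closed[OF assms(1)] assms(2,3) by (simp add: minus_eq_zero_iff)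

text \<open>Embeds the free module with one copy of P_i fewer, i = \<open>i0\<close>, as the vectors
  whose coordinate (\<open>i0\<close>, \<open>k0\<close>) is zero.\<close>

definition vinsert :: "vert \<Rightarrow> nat \<Rightarrow> 'k jvec \<Rightarrow> 'k jvec" where
  "vinsert i0 k0 u = (\<lambda>i k. if i \<noteq> i0 \<or> k < k0 then u i k else if k = k0 then 0 else u i (k - 1))"

lemma vinsert_simps: "vinsert i k (u + v) = vinsert i k u + vinsert i k v"
  "vinsert i k (rmul u b) = rmul (vinsert i k u) b"
  by (auto simp: vinsert_def rmul_def fun_eq_iff)

lemma vinsert_jfree:
  assumes "u \<in> jfree (a(i0 := a i0 - 1))" "k0 < a i0"
  shows "vinsert i0 k0 u \<in> jfree a"
proof (rule jfreeI)
  fix i k assume "k < a i"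
  then show "ee i * vinsert i0 k0 u i k = vinsert i0 k0 u i k"
    using jfree_ee[OF assms(1)] by (simp add: vinsert_def)
next
  fix i k assume "a i \<le> k"
  moreover have "u i l = 0" if "(a(i0 := a i0 - 1)) i \<le> l" for l
    using jfree_out[OF assms(1), of l i] that by simp
  ultimately show "vinsert i0 k0 u i k = 0"
    using assms(2) by (cases "i = i0") (auto simp: vinsert_def)
qed

lemma vinsert_surj:
  assumes "u \<in> jfree a" "u i0 k0 = 0" "k0 < a i0"
  obtains u' where "u' \<in> jfree (a(i0 := a i0 - 1))" "vinsert i0 k0 u' = u"
proof
  let ?u = "\<lambda>i k. if i \<noteq> i0 \<or> k < k0 then u i k else u i (Suc k)"
  show "vinsert i0 k0 ?u = u"
    using assms(2) by (auto simp: vinsert_def fun_eq_iff)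
  show "?u \<in> jfree (a(i0 := a i0 - 1))"
    using assms by (intro jfreeI) (auto simp: jfree_ee intro!: jfree_out[OF assms(1)] split: if_splits)
qed

text \<open>A kernel vector with a unit in coordinate (\<open>i0\<close>, \<open>k0\<close>)
  expresses this generator through the others.\<close>

lemma drop_generator:
  assumes Q: "jhom a Q M" "Q ` jfree a = carrier M"
    and n: "n \<in> jfree a" "Q n = \<zero>\<^bsub>M\<^esub>" "lp0 (n i0 k0) i0 \<noteq> 0"
  shows "\<exists>Q'. jhom (a(i0 := a i0 - 1)) Q' M \<and> Q' ` jfree (a(i0 := a i0 - 1)) = carrier M"
proof -
  have k0: "k0 < a i0" using n(3) jfree_out[OF n(1), of k0 i0] by force
  obtain y where y: "ee i0 * n i0 k0 * y = ee i0" using jac_unit[OF n(3)] .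
  let ?a = "a(i0 := a i0 - 1)"
  let ?Q = "\<lambda>u. Q (vinsert i0 k0 u)"
  have hom: "jhom ?a ?Q M"
    using Q(1) vinsert_jfree[where a=a, OF _ k0] by (auto simp: jhom_def vinsert_simps)
  have "x \<in> ?Q ` jfree ?a" if x: "x \<in> carrier M" for x
  proof -
    obtain u where u: "u \<in> jfree a" "x = Q u" using x unfolding Q(2) [symmetric] by blast
    \<comment> \<open>With this factor \<open>n i0 k0 * ?b = u i0 k0\<close>, so subtracting the
      kernel vector \<open>rmul n ?b\<close> clears the coordinate without changing the
      image.\<close>
    let ?b = "y * u i0 k0"
    let ?v = "u - rmul n ?b"
    have v: "?v \<in> jfree a" by (intro jfree_diff jfree_rmul u n)
    have "n i0 k0 * ?b = (ee i0 * n i0 k0 * y) * u i0 k0"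
      by (simp add: jfree_ee[OF n(1)] mult.assoc)
    then have "?v i0 k0 = 0"
      by (simp add: rmul_def y jfree_ee[OF u(1)] del: mult.assoc)
    then obtain u' where u': "u' \<in> jfree ?a" "vinsert i0 k0 u' = ?v"
      using vinsert_surj[OF v _ k0] by blast
    have "Q ?v = Q u \<ominus>\<^bsub>M\<^esub> act M (Q n) ?b"
      using jhom_diff[OF Q(1) u(1) jfree_rmul[OF n(1)]] jhom_rmul[OF Q(1) n(1)] by simp
    then have "Q ?v = x"
      using n(2) u jhom_closed[OF Q(1) u(1)] by (simp add: M.minus_eq)
    then show ?thesis using u' by (intro image_eqI[of _ _ u']) simp_all
  qed
  then have "?Q ` jfree ?a = carrier M"
    using jhom_closed[OF hom] by blast
  then show ?thesis using hom by blast
qed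

text \<open>A free module with the least number of summands is chosen. A kernel vector outside the
  radical would allow a smaller one by \<open>drop_generator\<close>.\<close>

lemma projective_cover_exists:
  assumes "jhom a Q M" "Q ` jfree a = carrier M"
  obtains a' Q' where "jhom a' Q' M" "Q' ` jfree a' = carrier M"
    "\<And>u. u \<in> jfree a' \<Longrightarrow> Q' u = \<zero>\<^bsub>M\<^esub> \<Longrightarrow> vrad u"
proof -
  let ?P = "\<lambda>a. \<exists>Q. jhom a Q M \<and> Q ` jfree a = carrier M"
  obtain a' where a': "?P a'" "\<And>c. ?P c \<Longrightarrow> a' V1 + a' V2 \<le> c V1 + c V2"
    using ex_has_least_nat[of ?P a "\<lambda>a. a V1 + a V2"] assms by blast
  then obtain Q' where Q': "jhom a' Q' M" "Q' ` jfree a' = carrier M" by blast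
  have "vrad n" if n: "n \<in> jfree a'" "Q' n = \<zero>\<^bsub>M\<^esub>" for n
  proof (rule ccontr)
    assume "\<not> vrad n"
    then obtain i k where ik: "lp0 (n i k) i \<noteq> 0" by (auto simp: vrad_def)
    then have "k < a' i" using jfree_out[OF n(1), of k i] by force
    moreover have "?P (a'(i := a' i - 1))"
      by (rule drop_generator[OF Q' n ik])
    ultimately show False using a'(2)[of "a'(i := a' i - 1)"] by (cases i) auto
  qed
  then show thesis using that Q' by blast
qed

lemma jhom_of_generators:
  fixes n :: nat
  assumes g: "\<And>k. k < n \<Longrightarrow> g k \<in> carrier M"
    and gen: "\<And>x. x \<in> carrier M \<Longrightarrow> \<exists>\<beta>. x = (\<Oplus>\<^bsub>M\<^esub>k\<in>{..<n}. act M (g k) (\<beta> k))"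
  obtains a Q where "jhom a Q M" "Q ` jfree a = carrier M"
proof
  \<comment> \<open>Each generator g splits as g e_1 + g e_2, so it receives one copy of P_1 and one
    of P_2.\<close>
  let ?a = "\<lambda>i::vert. n"
  let ?Q = "\<lambda>u::'k jvec. (\<Oplus>\<^bsub>M\<^esub>k\<in>{..<n}. act M (g k) (u V1 k + u V2 k))"
  have act_finsum: "act M (\<Oplus>\<^bsub>M\<^esub>k\<in>T. h k) b = (\<Oplus>\<^bsub>M\<^esub>k\<in>T. act M (h k) b)"
    if "finite T" "\<And>k. k \<in> T \<Longrightarrow> h k \<in> carrier M" for T :: "nat set" and h b
    using that
    by (induction T rule: finite_induct) (simp_all add: act_add Pi_def)
  show hom: "jhom ?a ?Q M"
    unfolding jhom_def
  proof (intro conjI ballI allI)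
    fix u v b
    show "?Q u \<in> carrier M" by (rule M.finsum_closed) (auto simp: g)
    have "(\<Oplus>\<^bsub>M\<^esub>k\<in>{..<n}. act M (g k) ((u + v) V1 k + (u + v) V2 k)) =
        (\<Oplus>\<^bsub>M\<^esub>k\<in>{..<n}. act M (g k) (u V1 k + u V2 k) \<oplus>\<^bsub>M\<^esub> act M (g k) (v V1 k + v V2 k))"
    proof (rule M.finsum_cong')
      fix k assume "k \<in> {..<n}"
      then have "act M (g k) ((u V1 k + u V2 k) + (v V1 k + v V2 k)) =
          act M (g k) (u V1 k + u V2 k) \<oplus>\<^bsub>M\<^esub> act M (g k) (v V1 k + v V2 k)"
        using g act_plus by blast
      then show "act M (g k) ((u + v) V1 k + (u + v) V2 k) =
          act M (g k) (u V1 k + u V2 k) \<oplus>\<^bsub>M\<^esub> act M (g k) (v V1 k + v V2 k)"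
        by (simp add: algebra_simps)
    qed (auto simp: g)
    also have "\<dots> = ?Q u \<oplus>\<^bsub>M\<^esub> ?Q v"
      by (rule M.finsum_addf) (auto simp: g)
    finally show "?Q (u + v) = ?Q u \<oplus>\<^bsub>M\<^esub> ?Q v" .
    have "?Q (rmul u b) = (\<Oplus>\<^bsub>M\<^esub>k\<in>{..<n}. act M (act M (g k) (u V1 k + u V2 k)) b)"
      by (rule M.finsum_cong') (auto simp: g rmul_def act_mult [symmetric] distrib_right)
    then show "?Q (rmul u b) = act M (?Q u) b"
      by (subst act_finsum) (auto simp: g)
  qed
  have "x \<in> ?Q ` jfree ?a" if x: "x \<in> carrier M" for x
  proof -
    obtain \<beta> where \<beta>: "x = (\<Oplus>\<^bsub>M\<^esub>k\<in>{..<n}. act M (g k) (\<beta> k))" using gen[OF x] by blast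
    let ?u = "\<lambda>i k. if k < n then ee i * \<beta> k else 0"
    have u: "?u \<in> jfree ?a" by (rule jfreeI) auto
    have "?Q ?u = x"
      unfolding \<beta>
    proof (rule M.finsum_cong')
      fix k assume k: "k \<in> {..<n}"
      have "ee V1 * \<beta> k + ee V2 * \<beta> k = \<beta> k"
        by (simp only: distrib_right [symmetric] ee_sum[of V1, simplified] mult_1_left)
      then show "act M (g k) (?u V1 k + ?u V2 k) = act M (g k) (\<beta> k)" using k by simp
    qed (auto simp: g)
    from image_eqI[where f = ?Q, OF this [symmetric] u] show ?thesis .
  qed
  then show "?Q ` jfree ?a = carrier M"
    using jhom_closed[OF hom] by blast
qed

lemma finite_dimensional_generators:
  assumes "finite_dimensional A M"
  obtains n :: nat and g where "\<And>k. k < n \<Longrightarrow> g k \<in> carrier M"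
    "\<And>x. x \<in> carrier M \<Longrightarrow> \<exists>\<beta>. x = (\<Oplus>\<^bsub>M\<^esub>k\<in>{..<n}. act M (g k) (\<beta> k))"
proof -
  obtain B where B: "finite B" "B \<subseteq> carrier M"
    "\<And>x. x \<in> carrier M \<Longrightarrow> \<exists>c. x = (\<Oplus>\<^bsub>M\<^esub>b\<in>B. scal A (c b) \<odot>\<^bsub>M\<^esub> b)"
    using assms unfolding finite_dimensional_def by blast
  obtain g where g: "bij_betw g {..<card B} B"
    using ex_bij_betw_nat_finite[OF B(1)] by (auto simp: atLeast0LessThan)
  show thesis
  proof
    show "g k \<in> carrier M" if "k < card B" for k
      using g B(2) that by (auto simp: bij_betw_def)
    fix x assume "x \<in> carrier M"
    then obtain c where c: "x = (\<Oplus>\<^bsub>M\<^esub>b\<in>B. scal A (c b) \<odot>\<^bsub>M\<^esub> b)" using B(3) by blast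
    have "x = (\<Oplus>\<^bsub>M\<^esub>b\<in>g ` {..<card B}. act M b (sc (c b)))"
      using g c by (simp add: bij_betw_def act_def scal_A)
    also have "\<dots> = (\<Oplus>\<^bsub>M\<^esub>k\<in>{..<card B}. act M (g k) (sc (c (g k))))"
      by (rule M.finsum_reindex) (use g B(2) in \<open>auto simp: bij_betw_def\<close>)
    finally show "\<exists>\<beta>. x = (\<Oplus>\<^bsub>M\<^esub>k\<in>{..<card B}. act M (g k) (\<beta> k))" 
      by (rule exI[of _ "\<lambda>k. sc (c (g k))"])
  qed
qed

end

text \<open>Submodules of a free module \<open>jfree a\<close> are finitely generated, being subspaces of a
  finite-dimensional vector space.\<close>

definition vscale :: "'k::field \<Rightarrow> 'k jvec \<Rightarrow> 'k jvec" where
  "vscale c u = rmul u (sc c)"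

interpretation jvec: vector_space "vscale :: 'k::field \<Rightarrow> 'k jvec \<Rightarrow> 'k jvec"
proof
  fix a b :: 'k and x y :: "'k jvec"
  show "vscale a (x + y) = vscale a x + vscale a y" by (simp only: vscale_def rmul_simps)
  show "vscale (a + b) x = vscale a x + vscale b x" by (simp only: vscale_def rmul_simps sc_simps)
  show "vscale a (vscale b x) = vscale (a * b) x"
    by (simp only: vscale_def rmul_simps(3) [symmetric] sc_simps(4) [symmetric] mult.commute)
  show "vscale 1 x = x" by (simp only: vscale_def rmul_simps sc_simps)
qed

definition jac_basis :: "'k::field jac set" where
  "jac_basis = (\<Union>v. {ee v, zz * ee v, zz * zz * ee v, zz * zz * zz * ee v, av v, zz * av v})"

lemma finite_jac_basis: "finite jac_basis"
  by (simp add: jac_basis_def)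

lemma jac_expand:
  "b = (\<Sum>v\<in>UNIV. ee v * sc (lp0 b v) + zz * ee v * sc (lp1 b v) + zz * zz * ee v * sc (lp2 b v) +
      zz * zz * zz * ee v * sc (lp3 b v) + av v * sc (ar0 b v) + zz * av v * sc (ar1 b v))"
  by (simp add: UNIV_vert[of V1] jac_eq_iff) (metis vert.exhaust oth.simps oth_eq)

lemma vsingle_add: "vsingle i k (x + y) = vsingle i k x + vsingle i k y"
  by (auto simp: vsingle_def fun_eq_iff)

lemma jfree_span:
  assumes "u \<in> jfree a"
  shows "u \<in> jvec.span ((\<lambda>((i, k), b). vsingle i k b) ` ((SIGMA i:UNIV. {..<a i}) \<times> jac_basis))"
    (is "u \<in> jvec.span ?B")
proof -
  have base: "vsingle i k (b * sc c) \<in> jvec.span ?B" if "k < a i" "b \<in> jac_basis" for i k b c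
  proof -
    have "vsingle i k b \<in> jvec.span ?B"
      by (intro jvec.span_base image_eqI[of _ _ "((i, k), b)"]) (use that in auto)
    then have "vscale c (vsingle i k b) \<in> jvec.span ?B" by (rule jvec.span_scale)
    then show ?thesis by (simp only: vscale_def rmul_vsingle)
  qed
  have plus: "vsingle i k (x + y) \<in> jvec.span ?B"
    if "vsingle i k x \<in> jvec.span ?B" "vsingle i k y \<in> jvec.span ?B" for i k x y
    unfolding vsingle_add using that by (rule jvec.span_add)
  have single: "vsingle i k b \<in> jvec.span ?B" if k: "k < a i" for i k b
  proof -
    let ?t = "\<lambda>v. ee v * sc (lp0 b v) + zz * ee v * sc (lp1 b v) + zz * zz * ee v * sc (lp2 b v) +
      zz * zz * zz * ee v * sc (lp3 b v) + av v * sc (ar0 b v) + zz * av v * sc (ar1 b v)"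
    have t: "vsingle i k (?t v) \<in> jvec.span ?B" for v
      by (intro plus base k) (auto simp: jac_basis_def)
    have "b = ?t V1 + ?t V2"
      using jac_expand[of b] by (simp only: UNIV_vert[of V1] oth.simps) simp
    then show ?thesis using plus[OF t t] by metis
  qed
  have "(\<Sum>(i, k)\<in>(SIGMA i:UNIV. {..<a i}). rmul (vsingle i k (ee i)) (u i k)) \<in> jvec.span ?B"
    by (rule jvec.span_sum) (auto simp: rmul_vsingle intro: single)
  then show ?thesis by (simp only: jfree_expand[OF assms, symmetric])
qed

lemma jfree_subspace_finite_basis:
  assumes "N \<subseteq> jfree a"
  obtains B where "finite B" "B \<subseteq> N" "N \<subseteq> jvec.span B"
proof -
  obtain B where B: "B \<subseteq> N" "jvec.independent B" "N \<subseteq> jvec.span B" "card B = jvec.dim N"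
    using jvec.basis_exists by blast
  have "finite B"
  proof -
    have "finite ((\<lambda>((i, k), b::'a jac). vsingle i k b) ` ((SIGMA i:UNIV. {..<a i}) \<times> jac_basis))"
      by (intro finite_imageI finite_cartesian_product finite_SigmaI finite_jac_basis) auto
    moreover have "B \<subseteq> jvec.span ((\<lambda>((i, k), b). vsingle i k b) ` ((SIGMA i:UNIV. {..<a i}) \<times> jac_basis))"
      using B(1) assms jfree_span by blast
    ultimately show ?thesis using jvec.independent_span_bound B(2) by blast
  qed
  then show thesis using that B by blast
qed

context jac_algebra
begin

text \<open>Nakayama's lemma: if N + X is everything, each generator lies in X up to a radical
  vector from N.\<close>

lemma superfluousI:
  assumes N: "N \<subseteq> {vmap u | u. u \<in> jfree a \<and> vrad u}"
  shows "superfluous A N (proj_sum A a)"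
  unfolding superfluous_def
proof (intro allI impI, elim conjE)
  fix X assume X: "rsubmodule A X (proj_sum A a)" and sum: "N <+>\<^bsub>proj_sum A a\<^esub> X = carrier (proj_sum A a)"
  interpret X: additive_subgroup X "proj_sum A a" using X by (simp add: rsubmodule_def)
  have Xsub: "X \<subseteq> carrier (proj_sum A a)" by (rule X.a_subset)
  let ?X = "{u \<in> jfree a. vmap u \<in> X}"
  have "u \<in> ?X" if u: "u \<in> jfree a" for u
  proof (rule nakayama_jfree[where a = a, OF _ _ _ _ u])
    show "0 \<in> ?X" using X.zero_closed by (simp add: proj_sum_simps)
    show "u + v \<in> ?X" if "u \<in> ?X" "v \<in> ?X" for u v
      using that X.a_closed[of "vmap u" "vmap v"] by (simp only: mem_Collect_eq jfree_add proj_sum_simps)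
    show "rmul u b \<in> ?X" if "u \<in> ?X" for u b
    proof -
      have "\<psi> b \<odot>\<^bsub>proj_sum A a\<^esub> vmap u \<in> X" using X that by (simp add: rsubmodule_def)
      then show ?thesis using that by (simp only: mem_Collect_eq jfree_rmul proj_sum_simps)
    qed
    fix i k assume k: "k < a i"
    have "vmap (vsingle i k (ee i)) \<in> N <+>\<^bsub>proj_sum A a\<^esub> X"
      unfolding sum proj_sum_carrier by (intro imageI jfree_vsingle k) simp
    then obtain n x where nx: "n \<in> N" "x \<in> X" "vmap (vsingle i k (ee i)) = n \<oplus>\<^bsub>proj_sum A a\<^esub> x"
      unfolding set_add_def' by blast
    obtain m where m: "m \<in> jfree a" "vrad m" "n = vmap m" using N nx(1) by blast
    obtain y where y: "y \<in> jfree a" "x = vmap y" using nx(2) Xsub by (auto simp: proj_sum_carrier)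
    have "vsingle i k (ee i) = m + y"
      using nx(3) unfolding m(3) y(2) proj_sum_simps vmap_eq .
    then have "vsingle i k (ee i) - m = y" by (simp only: add_diff_cancel_left')
    then show "\<exists>n\<in>jfree a. vrad n \<and> vsingle i k (ee i) - n \<in> ?X"
      using m y nx(2) by blast
  qed
  then show "X = carrier (proj_sum A a)"
    using Xsub unfolding proj_sum_carrier by blast
qed

lemma vrad_submodule:
  "rsubmodule A (vmap ` {u \<in> jfree a. lp0 (u i k) i = 0}) (proj_sum A a)"
proof -
  let ?X = "vmap ` {u \<in> jfree a. lp0 (u i k) i = 0}"
  interpret P: abelian_group "proj_sum A a" by (rule proj_sum_abelian)
  have "subgroup ?X (add_monoid (proj_sum A a))"
  proof (rule P.add.subgroupI)
    show "?X \<subseteq> carrier (proj_sum A a)" by (auto simp: proj_sum_carrier)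
    show "?X \<noteq> {}" using jfree_zero[of a] by (auto intro!: exI[of _ 0])
    fix x y assume "x \<in> ?X" "y \<in> ?X"
    then obtain u v where uv: "u \<in> jfree a" "lp0 (u i k) i = 0" "x = vmap u"
      "v \<in> jfree a" "lp0 (v i k) i = 0" "y = vmap v" by auto
    show "x \<oplus>\<^bsub>proj_sum A a\<^esub> y \<in> ?X"
      unfolding uv(3,6) proj_sum_simps using uv by (intro imageI CollectI conjI jfree_add) simp_all
    have "vmap (- u) \<oplus>\<^bsub>proj_sum A a\<^esub> vmap u = \<zero>\<^bsub>proj_sum A a\<^esub>"
      unfolding proj_sum_simps by simp
    then have "\<ominus>\<^bsub>proj_sum A a\<^esub> x = vmap (- u)"
      using uv jfree_uminus[OF uv(1)] by (intro P.minus_equality) (auto simp: proj_sum_carrier)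
    moreover have "vmap (- u) \<in> ?X" using uv by (intro imageI CollectI conjI jfree_uminus) simp_all
    ultimately show "\<ominus>\<^bsub>proj_sum A a\<^esub> x \<in> ?X" by simp
  qed
  moreover have "r \<odot>\<^bsub>proj_sum A a\<^esub> x \<in> ?X" if r: "r \<in> carrier A" and x: "x \<in> ?X" for r x
  proof -
    obtain b where b: "r = \<psi> b" using r by (auto simp: carrier_A)
    obtain u where u: "u \<in> jfree a" "lp0 (u i k) i = 0" "x = vmap u" using x by auto
    show ?thesis unfolding u b proj_sum_simps
      using u by (intro imageI) (simp add: jfree_rmul, simp add: rmul_def)
  qed
  ultimately show ?thesis
    unfolding rsubmodule_def by (simp add: additive_subgroup.intro)
qed

text \<open>An element of N with a nonzero constant coefficient lies outside one of the maximal
  submodules of \<open>vrad_submodule\<close>; N and this proper submodule would then span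
  everything.\<close>

lemma superfluousD:
  assumes "superfluous A N (proj_sum A a)" "N \<subseteq> carrier (proj_sum A a)"
    and closed: "\<And>n b. vmap n \<in> N \<Longrightarrow> n \<in> jfree a \<Longrightarrow> vmap (rmul n b) \<in> N"
    and n: "n \<in> jfree a" "vmap n \<in> N"
  shows "vrad n"
proof (rule ccontr)
  assume "\<not> vrad n"
  then obtain i k where ik: "lp0 (n i k) i \<noteq> 0" by (auto simp: vrad_def)
  then have k: "k < a i" using jfree_out[OF n(1), of k i] by force
  let ?X = "vmap ` {u \<in> jfree a. lp0 (u i k) i = 0}"
  have "N <+>\<^bsub>proj_sum A a\<^esub> ?X = carrier (proj_sum A a)"
  proof
    show "N <+>\<^bsub>proj_sum A a\<^esub> ?X \<subseteq> carrier (proj_sum A a)"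
    proof
      fix x assume "x \<in> N <+>\<^bsub>proj_sum A a\<^esub> ?X"
      then obtain m y where my: "m \<in> N" "y \<in> ?X" "x = m \<oplus>\<^bsub>proj_sum A a\<^esub> y"
        unfolding set_add_def' by blast
      then obtain u v where uv: "m = vmap u" "u \<in> jfree a" "y = vmap v" "v \<in> jfree a"
        using assms(2) by (auto simp: proj_sum_carrier)
      show "x \<in> carrier (proj_sum A a)"
        unfolding my(3) uv(1,3) proj_sum_simps proj_sum_carrier by (intro imageI jfree_add uv)
    qed
    show "carrier (proj_sum A a) \<subseteq> N <+>\<^bsub>proj_sum A a\<^esub> ?X"
    proof
      fix x assume "x \<in> carrier (proj_sum A a)"
      then obtain u where u: "u \<in> jfree a" "x = vmap u" by (auto simp: proj_sum_carrier)
      \<comment> \<open>The scalar that cancels the constant coefficient of u in coordinate (i,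
        k).\<close>
      let ?b = "sc (lp0 (u i k) i / lp0 (n i k) i)"
      have "u - rmul n ?b \<in> {u \<in> jfree a. lp0 (u i k) i = 0}"
        using ik by (simp add: jfree_diff u n jfree_rmul del: minus_apply) (simp add: rmul_def)
      then have "vmap (u - rmul n ?b) \<in> ?X" by (rule imageI)
      moreover have "vmap (rmul n ?b) \<in> N" by (rule closed[OF n(2,1)])
      moreover have "x = vmap (rmul n ?b) \<oplus>\<^bsub>proj_sum A a\<^esub> vmap (u - rmul n ?b)"
        unfolding u proj_sum_simps by simp
      ultimately show "x \<in> N <+>\<^bsub>proj_sum A a\<^esub> ?X" unfolding set_add_def' by blast
    qed
  qed
  then have "?X = carrier (proj_sum A a)"
    using assms(1) vrad_submodule unfolding superfluous_def by blast
  moreover have "vmap (vsingle i k (ee i)) \<in> carrier (proj_sum A a)"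
    unfolding proj_sum_carrier by (intro imageI jfree_vsingle k) simp
  ultimately have "vmap (vsingle i k (ee i)) \<in> ?X" by simp
  then show False by (auto simp: vsingle_def)
qed

end

section \<open>Minimal presentations and g-vectors\<close>

context jac_algebra
begin

text \<open>A cover of M is followed by a cover of its kernel. The kernel is finitely generated
  because it is a subspace of a finite-dimensional space.\<close>

lemma minimal_presentation_exists:
  assumes "M \<in> mod_fd A"
  shows "\<exists>a b f q. minimal_presentation A a b f q M"
proof -
  interpret M: jac_module A \<psi> M
    by unfold_locales (use assms in \<open>simp add: mod_fd_def\<close>)
  obtain n :: nat and g where "\<And>k. k < n \<Longrightarrow> g k \<in> carrier M"
    "\<And>x. x \<in> carrier M \<Longrightarrow> \<exists>\<beta>. x = (\<Oplus>\<^bsub>M\<^esub>k\<in>{..<n}. act M (g k) (\<beta> k))"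
    using M.finite_dimensional_generators assms by (auto simp: mod_fd_def)
  then obtain a0 Q0 where "jhom a0 Q0 M" "Q0 ` jfree a0 = carrier M"
    using M.jhom_of_generators by blast
  then obtain a Q where Q: "jhom a Q M" "Q ` jfree a = carrier M"
    "\<And>u. u \<in> jfree a \<Longrightarrow> Q u = \<zero>\<^bsub>M\<^esub> \<Longrightarrow> vrad u"
    using M.projective_cover_exists by blast
  let ?P = "proj_sum A a"
  define N where "N = {u \<in> jfree a. Q u = \<zero>\<^bsub>M\<^esub>}"
  have N0: "0 \<in> N" using M.jhom_0[OF Q(1)] by (simp only: N_def mem_Collect_eq jfree_zero)
  have Nadd: "u + v \<in> N" if "u \<in> N" "v \<in> N" for u v
    using that jhom_add[OF Q(1), of u v] by (simp only: N_def mem_Collect_eq jfree_add) simp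
  have Nneg: "- u \<in> N" if "u \<in> N" for u
  proof -
    have "Q (0 - u) = \<zero>\<^bsub>M\<^esub>" using that M.jhom_diff[OF Q(1), of 0 u] M.jhom_0[OF Q(1)]
      by (simp only: N_def mem_Collect_eq jfree_zero M.minus_eq_zero_iff M.M.zero_closed)
    then show ?thesis using that by (simp only: N_def mem_Collect_eq jfree_uminus diff_0)
  qed
  have Nmul: "rmul u c \<in> N" if "u \<in> N" for u c
    using that jhom_rmul[OF Q(1), of u c] by (simp only: N_def mem_Collect_eq jfree_rmul M.act_zero)
  \<comment> \<open>The kernel is made a module in its own right, so that the covering lemmas apply
    to it.\<close>
  define NM where "NM = ?P\<lparr>carrier := vmap ` N\<rparr>"
  have NM: "carrier NM = vmap ` N" "\<zero>\<^bsub>NM\<^esub> = vmap 0" "\<And>u v. vmap u \<oplus>\<^bsub>NM\<^esub> vmap v = vmap (u + v)"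
    "\<And>u b. \<psi> b \<odot>\<^bsub>NM\<^esub> vmap u = vmap (rmul u b)" "add NM = add ?P" "smult NM = smult ?P"
    by (simp_all add: NM_def proj_sum_simps)
  have "abelian_group NM"
  proof (rule abelian_groupI)
    show "x \<oplus>\<^bsub>NM\<^esub> y \<in> carrier NM" if "x \<in> carrier NM" "y \<in> carrier NM" for x y
      using that Nadd unfolding NM(1) by (elim imageE) (simp only: NM(3), rule imageI, blast)
    show "\<zero>\<^bsub>NM\<^esub> \<in> carrier NM" unfolding NM using N0 by (rule imageI)
    show "x \<oplus>\<^bsub>NM\<^esub> y \<oplus>\<^bsub>NM\<^esub> z = x \<oplus>\<^bsub>NM\<^esub> (y \<oplus>\<^bsub>NM\<^esub> z)"
      if "x \<in> carrier NM" "y \<in> carrier NM" "z \<in> carrier NM" for x y z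
      using that unfolding NM(1) by (elim imageE) (simp only: NM(3) add.assoc)
    show "x \<oplus>\<^bsub>NM\<^esub> y = y \<oplus>\<^bsub>NM\<^esub> x" if "x \<in> carrier NM" "y \<in> carrier NM" for x y
      using that unfolding NM(1) by (elim imageE) (simp only: NM(3) add.commute)
    show "\<zero>\<^bsub>NM\<^esub> \<oplus>\<^bsub>NM\<^esub> x = x" if "x \<in> carrier NM" for x
      using that unfolding NM(1) by (elim imageE) (simp only: NM(2,3) add_0)
    show "\<exists>y\<in>carrier NM. y \<oplus>\<^bsub>NM\<^esub> x = \<zero>\<^bsub>NM\<^esub>" if x: "x \<in> carrier NM" for x
    proof -
      obtain u where u: "u \<in> N" "x = vmap u" using x by (auto simp: NM(1))
      have "vmap (- u) \<oplus>\<^bsub>NM\<^esub> x = \<zero>\<^bsub>NM\<^esub>" by (simp only: u(2) NM(2,3) left_minus)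
      then show ?thesis using Nneg[OF u(1)] unfolding NM(1) by blast
    qed
  qed
  then have "right_module A NM"
    unfolding right_module_def carrier_A NM(1)
    by (auto simp: NM(3,4) rmul_simps add_A mult_A one_A Nmul)
  then interpret NM: jac_module A \<psi> NM
    by unfold_locales
  obtain B where B: "finite B" "B \<subseteq> N" "N \<subseteq> jvec.span B"
    using jfree_subspace_finite_basis[of N a] by (auto simp: N_def)
  obtain h where h: "bij_betw h {..<card B} B"
    using ex_bij_betw_nat_finite[OF B(1)] by (auto simp: atLeast0LessThan)
  have hB: "h k \<in> N" if "k < card B" for k using h B(2) that by (auto simp: bij_betw_def)
  have fin: "(\<Oplus>\<^bsub>NM\<^esub>k\<in>T. vmap (u k)) = vmap (\<Sum>k\<in>T. u k)" if "finite T" "\<And>k. k \<in> T \<Longrightarrow> u k \<in> N" for T :: "nat set" and u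
    using that
  proof (induction T rule: finite_induct)
    case (insert k T)
    then have "vmap (u k) \<in> carrier NM" "(\<lambda>k. vmap (u k)) \<in> T \<rightarrow> carrier NM"
      by (auto simp: NM(1))
    then have "(\<Oplus>\<^bsub>NM\<^esub>k\<in>insert k T. vmap (u k)) = vmap (u k) \<oplus>\<^bsub>NM\<^esub> (\<Oplus>\<^bsub>NM\<^esub>k\<in>T. vmap (u k))"
      using insert by (simp add: NM.M.finsum_insert)
    moreover have "(\<Oplus>\<^bsub>NM\<^esub>k\<in>T. vmap (u k)) = vmap (\<Sum>k\<in>T. u k)"
      by (rule insert.IH) (use insert.prems in blast)
    ultimately show ?case by (simp only: sum.insert[OF insert.hyps(1,2)] NM(3))
  qed (simp only: NM.M.finsum_empty sum.empty NM(2))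
  have "\<exists>a0 Q0. jhom a0 Q0 NM \<and> Q0 ` jfree a0 = carrier NM"
  proof (rule NM.jhom_of_generators[of "card B" "\<lambda>k. vmap (h k)"])
    show "vmap (h k) \<in> carrier NM" if "k < card B" for k unfolding NM(1) by (rule imageI[OF hB[OF that]])
    fix x assume "x \<in> carrier NM"
    then obtain u where u: "u \<in> N" "x = vmap u" by (auto simp: NM(1))
    then obtain c where c: "u = (\<Sum>b\<in>B. vscale (c b) b)" using B jvec.span_finite[OF B(1)] by auto
    have "u = (\<Sum>k\<in>{..<card B}. rmul (h k) (sc (c (h k))))"
      unfolding c vscale_def by (rule sum.reindex_bij_betw[OF h, symmetric])
    then have "x = (\<Oplus>\<^bsub>NM\<^esub>k\<in>{..<card B}. vmap (rmul (h k) (sc (c (h k)))))"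
      using fin[of "{..<card B}" "\<lambda>k. rmul (h k) (sc (c (h k)))"] Nmul hB u by simp
    then have "x = (\<Oplus>\<^bsub>NM\<^esub>k\<in>{..<card B}. act NM (vmap (h k)) (sc (c (h k))))"
      by (simp only: act_def NM(4))
    then show "\<exists>\<beta>. x = (\<Oplus>\<^bsub>NM\<^esub>k\<in>{..<card B}. act NM (vmap (h k)) (\<beta> k))"
      by (rule exI[of _ "\<lambda>k. sc (c (h k))"])
  qed blast
  then obtain b R where R: "jhom b R NM" "R ` jfree b = carrier NM"
    "\<And>u. u \<in> jfree b \<Longrightarrow> R u = \<zero>\<^bsub>NM\<^esub> \<Longrightarrow> vrad u"
    using NM.projective_cover_exists by blast
  let ?q = "\<lambda>w\<in>carrier ?P. Q (vinv w)"
  let ?f = "\<lambda>w\<in>carrier (proj_sum A b). R (vinv w)"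
  have q: "?q \<in> rhom A ?P M" by (rule rhom_of_jhom[OF Q(1)])
  have qu: "?q (vmap u) = Q u" if "u \<in> jfree a" for u using that by (simp add: proj_sum_carrier)
  have fu: "?f (vmap u) = R u" if "u \<in> jfree b" for u using that by (simp add: proj_sum_carrier)
  have "?f \<in> rhom A (proj_sum A b) NM" by (rule rhom_of_jhom[OF R(1)])
  moreover have "carrier NM \<subseteq> carrier ?P" unfolding NM(1) proj_sum_carrier N_def by blast
  ultimately have f: "?f \<in> rhom A (proj_sum A b) ?P"
    unfolding rhom_def NM(5,6) by (auto simp only: PiE_iff mem_Collect_eq subset_iff)
  have "minimal_presentation A a b ?f ?q M"
    unfolding minimal_presentation_def
  proof (intro conjI f q)
    show "?q ` carrier ?P = carrier M"
      unfolding proj_sum_carrier image_image using Q(2) qu by (simp add: proj_sum_carrier)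
    have ker: "hom_kernel ?P M ?q = vmap ` N"
      unfolding hom_kernel_def N_def proj_sum_carrier using qu by (auto simp: proj_sum_carrier)
    show "?f ` carrier (proj_sum A b) = hom_kernel ?P M ?q"
      unfolding ker unfolding NM(1) [symmetric] R(2) [symmetric] unfolding proj_sum_carrier image_image
      using fu by (simp add: proj_sum_carrier)
    show "superfluous A (hom_kernel ?P M ?q) ?P"
      unfolding ker by (rule superfluousI) (auto simp: N_def Q(3))
    show "superfluous A (hom_kernel (proj_sum A b) ?P ?f) (proj_sum A b)"
    proof (rule superfluousI)
      show "hom_kernel (proj_sum A b) ?P ?f \<subseteq> {vmap u | u. u \<in> jfree b \<and> vrad u}"
        using R(3) unfolding NM(2) by (auto simp: hom_kernel_def proj_sum_carrier proj_sum_simps)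
    qed
  qed
  then show ?thesis by blast
qed

end

locale min_pres = jac_module A \<psi> M
  for A :: "('r, 'k::field, vert) vertex_algebra" and \<psi> :: "'k jac \<Rightarrow> 'r" and M :: "('r, 'm) module" +
  fixes a b :: "vert \<Rightarrow> nat" and f q
  assumes min_pres: "minimal_presentation A a b f q M"
begin

definition Q :: "'k jvec \<Rightarrow> 'm" where
  "Q u = q (vmap u)"

definition R :: "'k jvec \<Rightarrow> 'k jvec" where
  "R v = vinv (f (vmap v))"

lemma Q_hom: "jhom a Q M"
proof -
  have "q \<in> rhom A (proj_sum A a) M" using min_pres by (simp add: minimal_presentation_def)
  from jhom_of_rhom[OF this] show ?thesis by (simp add: Q_def [abs_def])
qed

lemma f_hom: "jhom b (\<lambda>v. f (vmap v)) (proj_sum A a)"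
  using min_pres by (intro jhom_of_rhom) (simp add: minimal_presentation_def)

lemma
  assumes "v \<in> jfree b"
  shows f_vmap: "f (vmap v) = vmap (R v)" and R_closed: "R v \<in> jfree a"
proof -
  obtain u where "u \<in> jfree a" "f (vmap v) = vmap u"
    using jhom_closed[OF f_hom assms] by (auto simp: proj_sum_carrier)
  then show "f (vmap v) = vmap (R v)" "R v \<in> jfree a" by (simp_all add: R_def)
qed

lemma R_rmul:
  assumes "v \<in> jfree b"
  shows "R (rmul v c) = rmul (R v) c"
proof -
  have "vmap (R (rmul v c)) = act (proj_sum A a) (vmap (R v)) c"
    using jhom_rmul[OF f_hom assms] f_vmap[OF assms] f_vmap[OF jfree_rmul[OF assms]] by metis
  then show ?thesis by (simp only: act_def proj_sum_simps vmap_eq)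
qed

lemma R_add:
  assumes "u \<in> jfree b" "v \<in> jfree b"
  shows "R (u + v) = R u + R v"
proof -
  have "vmap (R (u + v)) = vmap (R u) \<oplus>\<^bsub>proj_sum A a\<^esub> vmap (R v)"
    using jhom_add[OF f_hom assms] f_vmap[OF assms(1)] f_vmap[OF assms(2)]
      f_vmap[OF jfree_add[OF assms]] by metis
  then show ?thesis by (simp only: proj_sum_simps vmap_eq)
qed

lemma Q_surj: "Q ` jfree a = carrier M"
proof -
  have "q ` carrier (proj_sum A a) = carrier M" using min_pres by (simp add: minimal_presentation_def)
  then show ?thesis by (simp add: proj_sum_carrier image_image Q_def)
qed

lemma kernel_Q: "{vmap u | u. u \<in> jfree a \<and> Q u = \<zero>\<^bsub>M\<^esub>} = hom_kernel (proj_sum A a) M q"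
  by (auto simp: hom_kernel_def proj_sum_carrier Q_def)

lemma Q_zero_iff: "u \<in> jfree a \<Longrightarrow> Q u = \<zero>\<^bsub>M\<^esub> \<longleftrightarrow> (\<exists>v\<in>jfree b. u = R v)"
proof -
  assume u: "u \<in> jfree a"
  have "f ` carrier (proj_sum A b) = {vmap u | u. u \<in> jfree a \<and> Q u = \<zero>\<^bsub>M\<^esub>}"
    using min_pres by (simp add: minimal_presentation_def kernel_Q)
  then have "(\<lambda>v. vmap (R v)) ` jfree b = {vmap u | u. u \<in> jfree a \<and> Q u = \<zero>\<^bsub>M\<^esub>}"
    by (simp add: proj_sum_carrier image_image f_vmap cong: image_cong)
  then have "vmap u \<in> (\<lambda>v. vmap (R v)) ` jfree b \<longleftrightarrow> vmap u \<in> {vmap u | u. u \<in> jfree a \<and> Q u = \<zero>\<^bsub>M\<^esub>}"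
    by simp
  then show ?thesis using u by (simp add: image_iff)
qed

lemma Q_rad:
  assumes "u \<in> jfree a" "Q u = \<zero>\<^bsub>M\<^esub>"
  shows "vrad u"
proof (rule superfluousD[where N = "hom_kernel (proj_sum A a) M q"])
  show "superfluous A (hom_kernel (proj_sum A a) M q) (proj_sum A a)"
    using min_pres by (simp add: minimal_presentation_def)
  show "vmap (rmul n c) \<in> hom_kernel (proj_sum A a) M q"
    if "vmap n \<in> hom_kernel (proj_sum A a) M q" "n \<in> jfree a" for n c
    using that jhom_rmul[OF Q_hom, of n c] unfolding kernel_Q [symmetric] by (simp add: jfree_rmul)
qed (use assms in \<open>auto simp: kernel_Q [symmetric] proj_sum_carrier\<close>)

lemma R_rad:
  assumes "v \<in> jfree b" "R v = 0"
  shows "vrad v"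
proof (rule superfluousD[where N = "hom_kernel (proj_sum A b) (proj_sum A a) f"])
  show "superfluous A (hom_kernel (proj_sum A b) (proj_sum A a) f) (proj_sum A b)"
    using min_pres by (simp add: minimal_presentation_def)
  show "vmap (rmul n c) \<in> hom_kernel (proj_sum A b) (proj_sum A a) f"
    if "vmap n \<in> hom_kernel (proj_sum A b) (proj_sum A a) f" "n \<in> jfree b" for n c
    using that by (simp add: hom_kernel_def proj_sum_carrier proj_sum_simps f_vmap jfree_rmul R_rmul rmul_simps)
qed (use assms in \<open>auto simp: hom_kernel_def proj_sum_carrier proj_sum_simps f_vmap\<close>)

end

section \<open>Presentations and g-vectors of cyclic modules\<close>

context jac_module
begin

text \<open>Modulo the radical, every generator of the free module is a multiple of a single
  preimage u of w. Hence there is one generator, and it sits at i. The image of Q need not be all of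
  M, so the lemma applies to the cover of a module and also to the cover of a kernel inside a free
  module.\<close>

lemma cyclic_cover:
  assumes Q: "jhom a Q M" "\<And>u. u \<in> jfree a \<Longrightarrow> Q u = \<zero>\<^bsub>M\<^esub> \<Longrightarrow> vrad u"
    and w: "w \<in> carrier M" "act M w (ee i) = w" "w \<noteq> \<zero>\<^bsub>M\<^esub>"
    and img: "Q ` jfree a = range (act M w)"
  shows "a = (\<lambda>j. if j = i then 1 else 0)"
proof -
  have "act M w 1 \<in> Q ` jfree a" unfolding img by blast
  then obtain u where u: "u \<in> jfree a" "Q u = w" using w(1) by auto
  have *: "\<exists>c. lp0 (u i k) i * c = 1 \<and> j = i \<and> (\<forall>l. l \<noteq> k \<longrightarrow> lp0 (u i l) i * c = 0)"
    if jk: "k < a j" for j k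
  proof -
    let ?E = "vsingle j k (ee j)"
    have E: "?E \<in> jfree a" by (rule jfree_vsingle) (use jk in simp_all)
    then have "Q ?E \<in> range (act M w)" using img by blast
    then obtain c where c: "Q ?E = act M w c" by blast
    \<comment> \<open>Since w e_i = w and the generator at j is fixed by e_j, the factor c may be
      replaced by its component in e_i \<open>jac\<close> e_j.\<close>
    let ?c = "ee i * c * ee j"
    have "Q ?E = Q (rmul ?E (ee j))" by (simp add: rmul_vsingle)
    also have "\<dots> = act M (Q ?E) (ee j)" by (rule jhom_rmul[OF Q(1) E])
    also have "\<dots> = act M (act M (act M w (ee i)) c) (ee j)" by (simp only: c w(2))
    also have "\<dots> = act M w ?c" using w(1) by (simp add: act_mult)
    also have "\<dots> = Q (rmul u ?c)" using jhom_rmul[OF Q(1) u(1)] u(2) by simp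
    finally have "Q (?E - rmul u ?c) = \<zero>\<^bsub>M\<^esub>"
      using jhom_eq_iff[OF Q(1) E jfree_rmul[OF u(1)]] by blast
    then have "vrad (?E - rmul u ?c)"
      using Q(2) jfree_diff[OF E jfree_rmul[OF u(1)]] by blast
    then have r: "lp0 (?E j' k' - u j' k' * ?c) j' = 0" for j' k'
      by (simp add: vrad_def rmul_def)
    have "lp0 (u j k) j * lp0 ?c j = 1" using r[of j k] by (simp add: vsingle_def)
    \<comment> \<open>The element e_i c e_j has a constant coefficient at j only if j = i.\<close>
    then have "j = i" by (auto split: if_splits)
    moreover have "lp0 (u i l) i * lp0 ?c i = (if l = k then 1 else 0)" for l
      using r[of i l] \<open>j = i\<close> by (auto simp: vsingle_def)
    ultimately show ?thesis by (intro exI[of _ "lp0 ?c i"]) auto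
  qed
  have "a j = 0" if "j \<noteq> i" for j
    using *[of 0 j] that by auto
  moreover have "a i \<le> 1"
  proof (rule ccontr)
    assume "\<not> a i \<le> 1"
    then have lt: "0 < a i" "1 < a i" by auto
    from *[OF lt(1)] obtain c where c: "\<forall>l. l \<noteq> 0 \<longrightarrow> lp0 (u i l) i * c = 0" "lp0 (u i 0) i * c = 1" by auto
    from *[OF lt(2)] obtain d where d: "lp0 (u i 1) i * d = 1" by auto
    have "c \<noteq> 0" "lp0 (u i 1) i \<noteq> 0" using c d by auto
    then show False using c(1) by simp
  qed
  moreover have "a i \<noteq> 0"
  proof
    assume "a i = 0"
    then have "a j = 0" for j using \<open>\<And>j. j \<noteq> i \<Longrightarrow> a j = 0\<close> by (cases "j = i") auto
    then have "u = 0" using jfree_out[OF u(1)] by (auto simp: fun_eq_iff)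
    then show False using u(2) jhom_0[OF Q(1)] w(3) by simp
  qed
  ultimately show ?thesis by (auto simp: fun_eq_iff)
qed

end

text \<open>The value 0 beyond the top exponent allows indices to be shifted without case
  distinctions, as in \<open>lpc_divides\<close>.\<close>

definition lpc :: "'k::field jac \<Rightarrow> vert \<Rightarrow> nat \<Rightarrow> 'k" where
  "lpc b i k = (if k = 0 then lp0 b i else if k = 1 then lp1 b i else if k = 2 then lp2 b i
     else if k = 3 then lp3 b i else 0)"

definition arc :: "'k::field jac \<Rightarrow> vert \<Rightarrow> nat \<Rightarrow> 'k" where
  "arc b i k = (if k = 0 then ar0 b i else if k = 1 then ar1 b i else 0)"

text \<open>The right ideals containing all \<open>b\<close> with \<open>e\<^sub>i b = 0\<close> are the \<open>ann i j t\<close> with suitable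
  \<open>j \<le> 4\<close> and \<open>t \<le> 2\<close>.\<close>

definition ann :: "vert \<Rightarrow> nat \<Rightarrow> nat \<Rightarrow> 'k::field jac set" where
  "ann i J T = {b. (\<forall>k<J. lpc b i k = 0) \<and> (\<forall>k<T. arc b i k = 0)}"

text \<open>In the second case J is 2 because a_i followed by the returning arrow is a nonzero
  multiple of z^2 e_i: dividing out a_i removes z^2 and z^3 at i and all arrows out of i.\<close>

definition proj_or_loop :: "nat \<Rightarrow> nat \<Rightarrow> bool" where
  "proj_or_loop J T \<longleftrightarrow> J = 4 \<and> T = 2 \<or> J = 2 \<and> T = 0"

lemma all_less_numerals: "(\<forall>k<2. P k) \<longleftrightarrow> P 0 \<and> P (1::nat)"
  "(\<forall>k<4. P k) \<longleftrightarrow> P 0 \<and> P 1 \<and> P 2 \<and> P (3::nat)"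
  by (auto simp: numeral_eq_Suc All_less_Suc)

lemma ann_4_2: "b \<in> ann i 4 2 \<longleftrightarrow> lp0 b i = 0 \<and> lp1 b i = 0 \<and> lp2 b i = 0 \<and> lp3 b i = 0 \<and>
    ar0 b i = 0 \<and> ar1 b i = 0"
  by (simp add: ann_def all_less_numerals lpc_def arc_def)

lemma ann_4_2_zero:
  assumes "ee i * x = x" "x \<in> ann i 4 2"
  shows "x = 0"
  using assms unfolding ee_mult_iff by (simp add: ann_4_2 jac_eq_iff all_vert[of _ i])

lemma ann_2_0: "b \<in> ann i 2 0 \<longleftrightarrow> lp0 b i = 0 \<and> lp1 b i = 0"
  by (simp add: ann_def all_less_numerals lpc_def arc_def)

lemma lpc_arc_linear: "lpc (x - y) i k = lpc x i k - lpc y i k" "arc (x - y) i k = arc x i k - arc y i k"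
  "lpc (x + y) i k = lpc x i k + lpc y i k" "arc (x + y) i k = arc x i k + arc y i k"
  "lpc (sc c * x) i k = c * lpc x i k" "arc (sc c * x) i k = c * arc x i k"
  by (simp_all add: lpc_def arc_def)

text \<open>On e_i \<open>jac\<close>, left multiplication by c is triangular with diagonal entry
  \<open>lp0 c i\<close>. The arrow part of c only meets coordinates of x at \<open>oth i\<close>,
  which are zero.\<close>

lemma ann_mult_left:
  assumes "proj_or_loop J T" "lp0 c i \<noteq> 0" "ee i * x = x"
  shows "c * x \<in> ann i J T \<longleftrightarrow> x \<in> ann i J T"
  using assms unfolding proj_or_loop_def ee_mult_iff by (auto simp: ann_4_2 ann_2_0)

lemma ann_mult_right:
  assumes "proj_or_loop J T" "x \<in> ann i J T"
  shows "x * c \<in> ann i J T"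
  using assms unfolding proj_or_loop_def by (auto simp: ann_4_2 ann_2_0)

lemma ann_lp0: "proj_or_loop J T \<Longrightarrow> x \<in> ann i J T \<Longrightarrow> lp0 x i = 0"
  unfolding proj_or_loop_def by (auto simp: ann_4_2 ann_2_0)

lemma ann_ee: "proj_or_loop J T \<Longrightarrow> 1 - ee i \<in> ann i J T"
  unfolding proj_or_loop_def by (auto simp: ann_4_2 ann_2_0)

text \<open>The arrow coordinates of x are reached by a_i followed by powers of z, and z^2 e_i, z^3
  e_i by a_i followed by the returning arrow; hence the division by \<open>kap i\<close>.\<close>

lemma ann_2_0_generated:
  assumes "(2::'k::field) \<noteq> 0" "ee i * x = (x :: 'k jac)" "x \<in> ann i 2 0"
  obtains c where "x = av i * c"
proof
  let ?s = "\<lambda>y v. if v = oth i then y else 0"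
  have k: "(kap i :: 'k) \<noteq> 0" using assms(1) by (cases i) auto
  show "x = av i * Jac (?s (ar0 x i)) (?s (ar1 x i)) (\<lambda>_. 0) (\<lambda>_. 0)
      (?s (lp2 x i / kap i)) (?s (lp3 x i / kap i))"
    using assms(2,3) k unfolding ee_mult_iff ann_2_0 by (simp add: jac_eq_iff all_vert[of _ i])
qed

abbreviation unit_vec :: "vert \<Rightarrow> vert \<Rightarrow> nat" where
  "unit_vec i \<equiv> (\<lambda>j. if j = i then 1 else 0)"

lemma jfree_unit_vec: "u \<in> jfree (unit_vec i) \<longleftrightarrow> u = vsingle i 0 (u i 0) \<and> ee i * u i 0 = u i 0"
proof
  assume u: "u \<in> jfree (unit_vec i)"
  have "u j k = 0" if "j \<noteq> i \<or> k \<noteq> 0" for j k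
    using that by (intro jfree_out[OF u]) auto
  then show "u = vsingle i 0 (u i 0) \<and> ee i * u i 0 = u i 0"
    using jfree_ee[OF u, of i 0] by (auto simp: vsingle_def fun_eq_iff)
next
  assume u: "u = vsingle i 0 (u i 0) \<and> ee i * u i 0 = u i 0"
  then have "vsingle i 0 (u i 0) \<in> jfree (unit_vec i)" by (intro jfree_vsingle) auto
  then show "u \<in> jfree (unit_vec i)" using u by metis
qed

context jac_algebra
begin

text \<open>\<open>M\<close> is isomorphic to \<open>e\<^sub>i jac / ann i J T\<close>: this is \<open>P\<^sub>i\<close> for \<open>(J, T) = (4, 2)\<close> and
  \<open>P\<^sub>i / a\<^sub>i jac\<close> for \<open>(J, T) = (2, 0)\<close>.\<close>

definition cyclic_at :: "('r, 'm) module \<Rightarrow> 'm \<Rightarrow> vert \<Rightarrow> nat \<Rightarrow> nat \<Rightarrow> bool" where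
  "cyclic_at M w i J T \<longleftrightarrow> w \<in> carrier M \<and> carrier M = range (act M w) \<and>
     (\<forall>b. act M w b = \<zero>\<^bsub>M\<^esub> \<longleftrightarrow> b \<in> ann i J T)"

end

context jac_module
begin

lemma cyclic_at_ee:
  assumes "cyclic_at M w i J T" "proj_or_loop J T"
  shows "act M w (ee i) = w" and "w \<noteq> \<zero>\<^bsub>M\<^esub>"
proof -
  have w: "w \<in> carrier M" "\<And>b. act M w b = \<zero>\<^bsub>M\<^esub> \<longleftrightarrow> b \<in> ann i J T"
    using assms(1) by (auto simp: cyclic_at_def)
  have "act M w 1 = act M w (ee i)"
    using act_eq_iff[OF w(1), of 1 "ee i"] w(2) ann_ee[OF assms(2)] by simp
  then show "act M w (ee i) = w" using w(1) by simp
  have "act M w 1 \<noteq> \<zero>\<^bsub>M\<^esub>" using w(2)[of 1] ann_lp0[OF assms(2), of 1 i] by auto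
  then show "w \<noteq> \<zero>\<^bsub>M\<^esub>" using w(1) by simp
qed

lemma cyclic_at_eq_iff:
  "cyclic_at M w i J T \<Longrightarrow> act M w b = act M w c \<longleftrightarrow> b - c \<in> ann i J T"
  using act_eq_iff[of w b c] by (auto simp: cyclic_at_def)

end

context min_pres
begin

text \<open>The generator of P_i is sent to w c. Surjectivity forces c to have a nonzero constant
  coefficient at i, so by \<open>ann_mult_left\<close> the factor c does not change the
  kernel.\<close>

lemma cyclic_presentation:
  assumes cyc: "cyclic_at M w i J T" and JT: "proj_or_loop J T"
  shows "a = unit_vec i" and "\<And>u. u \<in> jfree a \<Longrightarrow> Q u = \<zero>\<^bsub>M\<^esub> \<longleftrightarrow> u i 0 \<in> ann i J T"
proof -
  have w: "w \<in> carrier M" "carrier M = range (act M w)" "\<And>b. act M w b = \<zero>\<^bsub>M\<^esub> \<longleftrightarrow> b \<in> ann i J T"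
    using cyc by (auto simp: cyclic_at_def)
  show a: "a = unit_vec i"
    by (rule cyclic_cover[OF Q_hom Q_rad w(1) cyclic_at_ee[OF cyc JT]]) (use Q_surj w in auto)
  let ?E = "vsingle i 0 (ee i) :: 'k jvec"
  have E: "?E \<in> jfree a" unfolding a by (rule jfree_vsingle) simp_all
  have u: "u = rmul ?E (u i 0)" "ee i * u i 0 = u i 0" if "u \<in> jfree a" for u
    using that unfolding a jfree_unit_vec by (simp_all add: rmul_vsingle)
  have "Q ?E \<in> carrier M" by (rule jhom_closed[OF Q_hom E])
  then obtain c where c: "Q ?E = act M w c" using w(2) by blast
  have Qu: "Q u = act M w (c * u i 0)" if "u \<in> jfree a" for u
    using jhom_rmul[OF Q_hom E, of "u i 0"] u(1)[OF that] c w(1) by (simp add: act_mult)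
  have "w \<in> Q ` jfree a" unfolding Q_surj by (rule w(1))
  then obtain u0 where u0: "u0 \<in> jfree a" "Q u0 = w" by (elim imageE) simp
  have "act M w (c * u0 i 0) = act M w 1" using Qu[OF u0(1)] u0(2) w(1) by simp
  then have "c * u0 i 0 - 1 \<in> ann i J T" using cyclic_at_eq_iff[OF cyc] by blast
  then have "lp0 c i \<noteq> 0" using ann_lp0[OF JT] by fastforce
  then show "Q u = \<zero>\<^bsub>M\<^esub> \<longleftrightarrow> u i 0 \<in> ann i J T" if "u \<in> jfree a" for u
    using Qu[OF that] w(3) ann_mult_left[OF JT _ u(2)[OF that]] by simp
qed

text \<open>The kernel of \<open>Q\<close> is zero, so a generator of the next term would be killed
  by \<open>R\<close> although it is not radical.\<close>

lemma proj_presentation: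
  assumes cyc: "cyclic_at M w i 4 2"
  shows "b = (\<lambda>_. 0)"
proof -
  have JT: "proj_or_loop 4 2" by (simp add: proj_or_loop_def)
  note a = cyclic_presentation[OF cyc JT]
  have "b j = 0" for j
  proof (rule ccontr)
    assume "b j \<noteq> 0"
    let ?E = "vsingle j 0 (ee j) :: 'k jvec"
    have E: "?E \<in> jfree b" by (rule jfree_vsingle) (use \<open>b j \<noteq> 0\<close> in simp_all)
    have "Q (R ?E) = \<zero>\<^bsub>M\<^esub>" using Q_zero_iff[OF R_closed[OF E]] E by blast
    then have "R ?E i 0 \<in> ann i 4 2" using a(2)[OF R_closed[OF E]] by blast
    moreover have RE: "R ?E = vsingle i 0 (R ?E i 0)" "ee i * R ?E i 0 = R ?E i 0"
      using R_closed[OF E] unfolding a(1) jfree_unit_vec by auto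
    ultimately have "R ?E i 0 = 0"
      using ann_4_2_zero by blast
    then have "R ?E = 0" using RE(1) by (simp add: vsingle_def fun_eq_iff)
    then have "vrad ?E" by (rule R_rad[OF E])
    then have "lp0 (?E j 0) j = 0" unfolding vrad_def by blast
    then show False by (simp add: vsingle_def)
  qed
  then show ?thesis by auto
qed

text \<open>\<open>cyclic_cover\<close> is applied to f. Its image is the kernel of
  \<open>Q\<close>, generated by a_i, and a_i is fixed by the idempotent of its target
  \<open>oth i\<close>.\<close>

lemma loop_presentation:
  assumes cyc: "cyclic_at M w i 2 0"
  shows "b = unit_vec (oth i)"
proof -
  have JT: "proj_or_loop 2 0" by (simp add: proj_or_loop_def)
  note a = cyclic_presentation[OF cyc JT]
  interpret P: jac_module A \<psi> "proj_sum A a"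
    by unfold_locales (rule proj_sum_module)
  let ?w = "vsingle i 0 (av i) :: 'k jvec"
  have w: "?w \<in> jfree a" unfolding a by (rule jfree_vsingle) (simp_all add: ee_mult_iff)
  have awb: "act (proj_sum A a) (vmap ?w) c = vmap (vsingle i 0 (av i * c))" for c
    by (simp only: act_def proj_sum_simps rmul_vsingle)
  show ?thesis
  proof (rule P.cyclic_cover[OF f_hom])
    show "vrad v" if "v \<in> jfree b" "f (vmap v) = \<zero>\<^bsub>proj_sum A a\<^esub>" for v
      using that R_rad[of v] f_vmap[of v] by (simp add: proj_sum_simps)
    show "vmap ?w \<in> carrier (proj_sum A a)" using w by (simp add: proj_sum_carrier)
    have "av i * ee (oth i) = (av i :: 'k jac)" by (auto simp: jac_eq_iff)
    then show "act (proj_sum A a) (vmap ?w) (ee (oth i)) = vmap ?w"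
      unfolding awb by simp
    show "vmap ?w \<noteq> \<zero>\<^bsub>proj_sum A a\<^esub>"
    proof
      assume "vmap ?w = \<zero>\<^bsub>proj_sum A a\<^esub>"
      then have "?w = 0" by (simp only: proj_sum_simps vmap_eq)
      then have "ar0 (?w i 0) i = 0" by simp
      then show False by (simp add: vsingle_def)
    qed
    show "(\<lambda>v. f (vmap v)) ` jfree b = range (act (proj_sum A a) (vmap ?w))"
    proof (intro equalityI subsetI)
      fix x assume "x \<in> (\<lambda>v. f (vmap v)) ` jfree b"
      then obtain v where v: "v \<in> jfree b" "x = f (vmap v)" by blast
      have Rv: "R v \<in> jfree a" by (rule R_closed[OF v(1)])
      have "Q (R v) = \<zero>\<^bsub>M\<^esub>" using Q_zero_iff[OF Rv] v(1) by blast
      then have "R v i 0 \<in> ann i 2 0" using a(2)[OF Rv] by blast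
      moreover have RE: "R v = vsingle i 0 (R v i 0)" "ee i * R v i 0 = R v i 0"
        using Rv unfolding a(1) jfree_unit_vec by auto
      ultimately obtain c where c: "R v i 0 = av i * c"
        using ann_2_0_generated[OF two_nonzero] by blast
      have "x = vmap (vsingle i 0 (av i * c))"
        unfolding v(2) f_vmap[OF v(1)] c [symmetric] using RE(1) by metis
      then show "x \<in> range (act (proj_sum A a) (vmap ?w))" using awb by (metis rangeI)
    next
      fix x assume "x \<in> range (act (proj_sum A a) (vmap ?w))"
      then obtain c where c: "x = vmap (rmul ?w c)" by (auto simp: awb rmul_vsingle)
      have wc: "rmul ?w c \<in> jfree a" by (rule jfree_rmul[OF w])
      have "rmul ?w c i 0 \<in> ann i 2 0" by (simp add: rmul_def vsingle_def ann_2_0)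
      then have "Q (rmul ?w c) = \<zero>\<^bsub>M\<^esub>" using a(2)[OF wc] by blast
      then obtain v where "v \<in> jfree b" "rmul ?w c = R v" using Q_zero_iff[OF wc] by blast
      then show "x \<in> (\<lambda>v. f (vmap v)) ` jfree b" unfolding c using f_vmap by (metis image_eqI)
    qed
  qed
qed

end

context jac_algebra
begin

lemma g_vector_cyclic:
  assumes M: "M \<in> mod_fd A"
  shows "cyclic_at M w i 4 2 \<Longrightarrow> g_vector A M = (\<lambda>j. if j = i then 1 else 0)"
    and "cyclic_at M w i 2 0 \<Longrightarrow> g_vector A M = (\<lambda>j. if j = i then 1 else - 1)"
proof -
  have JT: "proj_or_loop 4 2" "proj_or_loop 2 0" by (simp_all add: proj_or_loop_def)
  have rm: "right_module A M" using M by (simp add: mod_fd_def)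
  note ex = minimal_presentation_exists[OF M]
  show "g_vector A M = (\<lambda>j. if j = i then 1 else 0)" if cyc: "cyclic_at M w i 4 2"
  proof -
    have ab: "a = unit_vec i \<and> b = (\<lambda>_. 0)" if "minimal_presentation A a b f q M" for a b f q
    proof -
      interpret min_pres A \<psi> M a b f q by unfold_locales (rule rm, rule that)
      show ?thesis using cyclic_presentation(1)[OF cyc JT(1)] proj_presentation[OF cyc] by blast
    qed
    show ?thesis
      unfolding g_vector_def
    proof (rule the_equality)
      show "\<exists>a b f q. minimal_presentation A a b f q M \<and> (\<lambda>j. if j = i then 1 else 0) = (\<lambda>i. int (a i) - int (b i))"
        using ex ab by (fastforce simp: fun_eq_iff)
    qed (use ab in \<open>fastforce simp: fun_eq_iff\<close>)
  qed
  show "g_vector A M = (\<lambda>j. if j = i then 1 else - 1)" if cyc: "cyclic_at M w i 2 0"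
  proof -
    have ab: "a = unit_vec i \<and> b = unit_vec (oth i)" if "minimal_presentation A a b f q M" for a b f q
    proof -
      interpret min_pres A \<psi> M a b f q by unfold_locales (rule rm, rule that)
      show ?thesis using cyclic_presentation(1)[OF cyc JT(2)] loop_presentation[OF cyc] by blast
    qed
    have eq: "(\<lambda>j. if j = i then 1 else - 1) = (\<lambda>j. int (unit_vec i j) - int (unit_vec (oth i) j))"
      by (auto simp: fun_eq_iff neq_iff_oth)
    show ?thesis
      unfolding g_vector_def eq
    proof (rule the_equality)
      show "\<exists>a b f q. minimal_presentation A a b f q M \<and>
          (\<lambda>j. int (unit_vec i j) - int (unit_vec (oth i) j)) = (\<lambda>i. int (a i) - int (b i))"
        using ex ab by blast
    qed (use ab in blast)
  qed
qed

end

section \<open>Tau-rigid modules\<close>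

lemma jvec_hom_sum:
  fixes G :: "'k::field jvec \<Rightarrow> 'b::comm_monoid_add"
  assumes "G 0 = 0" "\<And>u v. u \<in> jfree a \<Longrightarrow> v \<in> jfree a \<Longrightarrow> G (u + v) = G u + G v"
    and "finite T" "\<And>t. t \<in> T \<Longrightarrow> h t \<in> jfree a"
  shows "G (\<Sum>t\<in>T. h t) = (\<Sum>t\<in>T. G (h t))"
  using assms(3,4)
proof (induction T rule: finite_induct)
  case (insert t T)
  have "G (h t + sum h T) = G (h t) + G (sum h T)"
    using insert.prems by (intro assms(2) jfree_sum) auto
  moreover have "G (sum h T) = (\<Sum>t\<in>T. G (h t))"
    by (rule insert.IH) (use insert.prems in blast)
  ultimately show ?case by (simp only: sum.insert[OF insert.hyps(1,2)])
qed (simp only: sum.empty assms(1))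

lemma jvec_hom_expand:
  fixes G :: "'k::field jvec \<Rightarrow> 'b::comm_monoid_add"
  assumes "G 0 = 0" "\<And>u v. u \<in> jfree a \<Longrightarrow> v \<in> jfree a \<Longrightarrow> G (u + v) = G u + G v" and u: "u \<in> jfree a"
  shows "G u = (\<Sum>(i, k)\<in>(SIGMA i:UNIV. {..<a i}). G (rmul (vsingle i k (ee i)) (u i k)))"
proof -
  let ?h = "\<lambda>(i, k). rmul (vsingle i k (ee i)) (u i k)"
  have "G (\<Sum>t\<in>(SIGMA i:UNIV. {..<a i}). ?h t) = (\<Sum>t\<in>(SIGMA i:UNIV. {..<a i}). G (?h t))"
    by (rule jvec_hom_sum[where a = a, OF assms(1,2)]) (auto intro!: jfree_rmul jfree_vsingle)
  then show ?thesis
    unfolding jfree_expand[OF u, symmetric] by (simp add: case_prod_unfold)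
qed

section \<open>Duals of free modules and homomorphisms into the translate\<close>

context jac_algebra
begin

lemma AR_translate_presentation:
  assumes "M \<in> mod_fd A"
  obtains a b f q where "minimal_presentation A a b f q M"
    "AR_translate A M = (nakayama A b)
        \<lparr> carrier := hom_kernel (nakayama A b) (nakayama A a) (nakayama_map A b a f) \<rparr>"
proof -
  let ?t = "SOME (a, b, f). \<exists>q. minimal_presentation A a b f q M"
  have "\<exists>t. (case t of (a, b, f) \<Rightarrow> \<exists>q. minimal_presentation A a b f q M)"
    using minimal_presentation_exists[OF assms] by auto
  from someI_ex[OF this] have t: "case ?t of (a, b, f) \<Rightarrow> \<exists>q. minimal_presentation A a b f q M" .
  obtain a b f where abf: "?t = (a, b, f)" using prod_cases3 by blast
  then obtain q where "minimal_presentation A a b f q M" using t by auto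
  then show thesis using that abf by (simp add: AR_translate_def)
qed

lemma regular_module_simps: "carrier (regular_module A) = carrier A"
  "act (regular_module A) x c = x \<otimes>\<^bsub>A\<^esub> \<psi> c" "add (regular_module A) = add A"
  by (simp_all add: regular_module_def act_def)

lemma proj_dual_hom:
  assumes "g \<in> proj_dual A b"
  shows "u \<in> jfree b \<Longrightarrow> g (vmap u) = \<psi> (\<phi> (g (vmap u)))"
    and "u \<in> jfree b \<Longrightarrow> v \<in> jfree b \<Longrightarrow> \<phi> (g (vmap (u + v))) = \<phi> (g (vmap u)) + \<phi> (g (vmap v))"
    and "u \<in> jfree b \<Longrightarrow> \<phi> (g (vmap (rmul u c))) = \<phi> (g (vmap u)) * c"
    and "\<phi> (g (vmap 0)) = 0"
proof -
  have h: "jhom b (\<lambda>u. g (vmap u)) (regular_module A)"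
    by (rule jhom_of_rhom) (use assms in \<open>simp add: proj_dual_def\<close>)
  show psi: "g (vmap u) = \<psi> (\<phi> (g (vmap u)))" if "u \<in> jfree b" for u
    using jhom_closed[OF h that] by (simp add: regular_module_simps psi_phi)
  show "\<phi> (g (vmap (u + v))) = \<phi> (g (vmap u)) + \<phi> (g (vmap v))" if "u \<in> jfree b" "v \<in> jfree b" for u v
  proof -
    have "g (vmap (u + v)) = \<psi> (\<phi> (g (vmap u))) \<oplus>\<^bsub>A\<^esub> \<psi> (\<phi> (g (vmap v)))"
      using jhom_add[OF h that] psi[OF that(1)] psi[OF that(2)] by (simp only: regular_module_simps)
    then show ?thesis by (simp only: add_A phi_psi)
  qed
  show r: "\<phi> (g (vmap (rmul u c))) = \<phi> (g (vmap u)) * c" if "u \<in> jfree b" for u c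
  proof -
    have "g (vmap (rmul u c)) = \<psi> (\<phi> (g (vmap u))) \<otimes>\<^bsub>A\<^esub> \<psi> c"
      using jhom_rmul[OF h that] psi[OF that] by (simp only: regular_module_simps)
    then show ?thesis by (simp only: mult_A phi_psi)
  qed
  show "\<phi> (g (vmap 0)) = 0"
    using r[OF jfree_zero, of 0] by (simp only: rmul_simps mult_zero_right)
qed

lemma proj_dual_ext:
  assumes "g \<in> proj_dual A b" "h \<in> proj_dual A b"
    and "\<And>j k. k < b j \<Longrightarrow> \<phi> (g (vmap (vsingle j k (ee j)))) = \<phi> (h (vmap (vsingle j k (ee j))))"
  shows "g = h"
proof
  fix w
  show "g w = h w"
  proof (cases "w \<in> carrier (proj_sum A b)")
    case True
    then obtain u where u: "u \<in> jfree b" "w = vmap u" by (auto simp: proj_sum_carrier)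
    have E: "vsingle j k (ee j) \<in> jfree b" if "k < b j" for j k
      by (rule jfree_vsingle) (use that in simp_all)
    have "\<phi> (g (vmap u)) = \<phi> (h (vmap u))"
    proof (rule trans[OF jvec_hom_expand[where G = "\<lambda>u. \<phi> (g (vmap u))", OF proj_dual_hom(4,2)[OF assms(1)] u(1)]
          trans[OF _ jvec_hom_expand[where G = "\<lambda>u. \<phi> (h (vmap u))", OF proj_dual_hom(4,2)[OF assms(2)] u(1), symmetric]]])
      show "(\<Sum>(j, k)\<in>(SIGMA j:UNIV. {..<b j}). \<phi> (g (vmap (rmul (vsingle j k (ee j)) (u j k))))) =
          (\<Sum>(j, k)\<in>(SIGMA j:UNIV. {..<b j}). \<phi> (h (vmap (rmul (vsingle j k (ee j)) (u j k)))))"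
        by (intro sum.cong refl) (auto simp: proj_dual_hom(3)[OF assms(1) E] proj_dual_hom(3)[OF assms(2) E] assms(3))
    qed
    then show ?thesis
      using proj_dual_hom(1)[OF assms(1) u(1)] proj_dual_hom(1)[OF assms(2) u(1)] u(2) by metis
  next
    case False
    then show ?thesis
      using assms(1,2) by (auto simp: proj_dual_def rhom_def PiE_def extensional_def)
  qed
qed

lemma proj_dual_row:
  assumes "\<And>u v. u \<in> jfree b \<Longrightarrow> v \<in> jfree b \<Longrightarrow> G (u + v) = G u + G v"
    and "\<And>u c. u \<in> jfree b \<Longrightarrow> G (rmul u c) = G u * c"
  shows "(\<lambda>w\<in>carrier (proj_sum A b). \<psi> (G (vinv w))) \<in> proj_dual A b"
proof -
  have "jhom b (\<lambda>u. \<psi> (G u)) (regular_module A)"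
    unfolding jhom_def by (auto simp: regular_module_simps add_A mult_A assms)
  from rhom_of_jhom[OF this] show ?thesis by (simp add: proj_dual_def)
qed

lemma dual_add_closed:
  assumes "g \<in> proj_dual A b" "h \<in> proj_dual A b"
  shows "dual_add A b g h \<in> proj_dual A b"
    and "u \<in> jfree b \<Longrightarrow> \<phi> (dual_add A b g h (vmap u)) = \<phi> (g (vmap u)) + \<phi> (h (vmap u))"
proof -
  have eq: "dual_add A b g h = (\<lambda>w\<in>carrier (proj_sum A b). \<psi> (\<phi> (g (vmap (vinv w))) + \<phi> (h (vmap (vinv w)))))"
    unfolding dual_add_def
  proof (rule restrict_ext)
    fix w assume "w \<in> carrier (proj_sum A b)"
    then obtain u where u: "u \<in> jfree b" "w = vmap u" by (auto simp: proj_sum_carrier)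
    show "g w \<oplus>\<^bsub>A\<^esub> h w = \<psi> (\<phi> (g (vmap (vinv w))) + \<phi> (h (vmap (vinv w))))"
      using proj_dual_hom(1)[OF assms(1) u(1)] proj_dual_hom(1)[OF assms(2) u(1)]
      unfolding u(2) vinv_vmap by (metis add_A)
  qed
  show "dual_add A b g h \<in> proj_dual A b"
    unfolding eq
    by (rule proj_dual_row)
      (simp_all only: proj_dual_hom(2,3)[OF assms(1)] proj_dual_hom(2,3)[OF assms(2)] distrib_right add_ac)
  show "u \<in> jfree b \<Longrightarrow> \<phi> (dual_add A b g h (vmap u)) = \<phi> (g (vmap u)) + \<phi> (h (vmap u))"
    unfolding eq by (simp add: proj_sum_carrier)
qed

lemma dual_smult_closed:
  assumes "g \<in> proj_dual A b"
  shows "dual_smult A b (\<psi> c) g \<in> proj_dual A b"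
    and "u \<in> jfree b \<Longrightarrow> \<phi> (dual_smult A b (\<psi> c) g (vmap u)) = c * \<phi> (g (vmap u))"
proof -
  have eq: "dual_smult A b (\<psi> c) g = (\<lambda>w\<in>carrier (proj_sum A b). \<psi> (c * \<phi> (g (vmap (vinv w)))))"
    unfolding dual_smult_def
  proof (rule restrict_ext)
    fix w assume "w \<in> carrier (proj_sum A b)"
    then obtain u where u: "u \<in> jfree b" "w = vmap u" by (auto simp: proj_sum_carrier)
    show "\<psi> c \<otimes>\<^bsub>A\<^esub> g w = \<psi> (c * \<phi> (g (vmap (vinv w))))"
      using proj_dual_hom(1)[OF assms(1) u(1)] unfolding u(2) vinv_vmap by (metis mult_A)
  qed
  show "dual_smult A b (\<psi> c) g \<in> proj_dual A b"
    unfolding eq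
    by (rule proj_dual_row)
      (simp_all only: proj_dual_hom(2,3)[OF assms(1)] distrib_left mult.assoc)
  show "u \<in> jfree b \<Longrightarrow> \<phi> (dual_smult A b (\<psi> c) g (vmap u)) = c * \<phi> (g (vmap u))"
    unfolding eq by (simp add: proj_sum_carrier)
qed

text \<open>The dual basis of Hom(P, A). Evaluating functionals in \<nu>P at it recovers their
  coordinates.\<close>

definition coord :: "(vert \<Rightarrow> nat) \<Rightarrow> vert \<Rightarrow> nat \<Rightarrow> (vert \<Rightarrow> nat \<Rightarrow> 'r) \<Rightarrow> 'r" where
  "coord b j k = (\<lambda>w\<in>carrier (proj_sum A b). \<psi> (vinv w j k))"

lemma coord_dual: "coord b j k \<in> proj_dual A b"
  unfolding coord_def by (rule proj_dual_row) (simp_all add: rmul_def)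

lemma coord_apply: "u \<in> jfree b \<Longrightarrow> \<phi> (coord b j k (vmap u)) = u j k"
  by (simp add: coord_def proj_sum_carrier)

end

locale min_pres_AR = min_pres A \<psi> M a b f q
  for A :: "('r, 'k::field, vert) vertex_algebra" and \<psi> :: "'k jac \<Rightarrow> 'r" and M :: "('r, 'm) module"
    and a b f q +
  assumes AR: "AR_translate A M = (nakayama A b)
        \<lparr> carrier := hom_kernel (nakayama A b) (nakayama A a) (nakayama_map A b a f) \<rparr>"
begin

lemma compose_f_dual:
  assumes "g \<in> proj_dual A a"
  shows "compose (carrier (proj_sum A b)) g f \<in> proj_dual A b"
    and "u \<in> jfree b \<Longrightarrow> \<phi> (compose (carrier (proj_sum A b)) g f (vmap u)) = \<phi> (g (vmap (R u)))"
proof -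
  have eq: "compose (carrier (proj_sum A b)) g f = (\<lambda>w\<in>carrier (proj_sum A b). \<psi> (\<phi> (g (vmap (R (vinv w))))))"
    unfolding compose_def
  proof (rule restrict_ext)
    fix w assume "w \<in> carrier (proj_sum A b)"
    then obtain u where u: "u \<in> jfree b" "w = vmap u" by (auto simp: proj_sum_carrier)
    show "g (f w) = \<psi> (\<phi> (g (vmap (R (vinv w)))))"
      unfolding u(2) vinv_vmap f_vmap[OF u(1)] by (rule proj_dual_hom(1)[OF assms R_closed[OF u(1)]])
  qed
  show "compose (carrier (proj_sum A b)) g f \<in> proj_dual A b"
    unfolding eq
    by (rule proj_dual_row) (simp_all only: R_add R_rmul proj_dual_hom(2,3)[OF assms] R_closed)
  show "u \<in> jfree b \<Longrightarrow> \<phi> (compose (carrier (proj_sum A b)) g f (vmap u)) = \<phi> (g (vmap (R u)))"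
    unfolding eq by (simp add: proj_sum_carrier)
qed

text \<open>The functional \<open>l\<close> and the summand \<open>(j, k)\<close> of \<open>P\<^sub>1\<close> define the homomorphism
  \<open>M \<rightarrow> \<tau>M \<subseteq> \<nu>P\<^sub>1\<close> that sends \<open>x\<close> to \<open>g \<mapsto> l (x g(e\<^sub>j\<^sub>k))\<close>.\<close>

lemma functional_vanishes:
  assumes rigid: "tau_rigid A M"
    and l_add: "\<And>x y. x \<in> carrier M \<Longrightarrow> y \<in> carrier M \<Longrightarrow> l (x \<oplus>\<^bsub>M\<^esub> y) = l x + l y"
    and l_scal: "\<And>x c. x \<in> carrier M \<Longrightarrow> l (act M x (sc c)) = c * l x"
    and k: "k < b j"
    and van: "\<And>x i s. x \<in> carrier M \<Longrightarrow> l (act M x (R (vsingle j k (ee j)) i s)) = 0"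
    and x: "x \<in> carrier M"
  shows "l (act M x (ee j)) = 0"
proof -
  let ?E = "vsingle j k (ee j) :: 'k jvec"
  have E: "?E \<in> jfree b" by (rule jfree_vsingle) (use k in simp_all)
  let ?v = "\<lambda>g. \<phi> (g (vmap ?E))"
  let ?h = "\<lambda>x\<in>carrier M. \<lambda>g\<in>proj_dual A b. l (act M x (?v g))"
  have nak: "(\<lambda>g\<in>proj_dual A b. l (act M x (?v g))) \<in> carrier (nakayama A b)" if x: "x \<in> carrier M" for x
  proof -
    have "l (act M x (?v (dual_add A b g h))) = l (act M x (?v g)) + l (act M x (?v h))"
      if "g \<in> proj_dual A b" "h \<in> proj_dual A b" for g h
      by (simp add: dual_add_closed(2)[OF that E] act_plus x l_add)
    moreover have "l (act M x (?v (dual_smult A b (scal A c) g))) = c * l (act M x (?v g))"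
      if "g \<in> proj_dual A b" for g c
    proof -
      have "act M x (?v (dual_smult A b (scal A c) g)) = act M (act M x (?v g)) (sc c)"
        unfolding scal_A dual_smult_closed(2)[OF that E] sc_commute by (rule act_mult[OF x])
      then show ?thesis using l_scal[OF act_closed[OF x]] by simp
    qed
    ultimately show ?thesis
      by (auto simp: nakayama_def dual_add_closed(1) scal_A dual_smult_closed(1))
  qed
  have ker: "(\<lambda>g\<in>proj_dual A b. l (act M x (?v g))) \<in> carrier (AR_translate A M)"
    if x: "x \<in> carrier M" for x
  proof -
    \<comment> \<open>By linearity g(R E) is the sum over (i, s) of g(e_is) times the entry (i, s)
      of R E, so \<open>van\<close> applies to each term, with x g(e_is) in place of x.\<close>
    have "l (act M x (\<phi> (g (vmap (R ?E))))) = 0" if g: "g \<in> proj_dual A a" for g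
    proof -
      have lsum: "l (act M x (\<Sum>t\<in>T. c t)) = 0" if "finite T" "\<And>t. t \<in> T \<Longrightarrow> l (act M x (c t)) = 0" for T c
        using that
      proof (induction T rule: finite_induct)
        case empty
        have "l (\<zero>\<^bsub>M\<^esub> \<oplus>\<^bsub>M\<^esub> \<zero>\<^bsub>M\<^esub>) = l \<zero>\<^bsub>M\<^esub> + l \<zero>\<^bsub>M\<^esub>" by (rule l_add) simp_all
        then have "l \<zero>\<^bsub>M\<^esub> = 0" by (metis M.l_zero M.zero_closed add_cancel_right_right)
        then show ?case using x by simp
      qed (simp add: act_plus x l_add)
      have "l (act M x (\<Sum>(i, s)\<in>(SIGMA i:UNIV. {..<a i}).
          \<phi> (g (vmap (rmul (vsingle i s (ee i)) (R ?E i s)))))) = 0"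
      proof (rule lsum, goal_cases)
        case (2 t)
        then obtain i s where t: "t = (i, s)" "s < a i" by auto
        have "vsingle i s (ee i) \<in> jfree a" by (rule jfree_vsingle) (use t in simp_all)
        from proj_dual_hom(3)[OF g this] show ?case
          unfolding t(1) prod.case by (simp only: act_mult[OF x] van act_closed[OF x])
      qed auto
      then show ?thesis
        by (simp only: jvec_hom_expand[where G = "\<lambda>u. \<phi> (g (vmap u))", OF proj_dual_hom(4,2)[OF g] R_closed[OF E], symmetric])
    qed
    then have "nakayama_map A b a f (\<lambda>g\<in>proj_dual A b. l (act M x (?v g))) = \<zero>\<^bsub>nakayama A a\<^esub>"
      unfolding nakayama_map_def nakayama_def
      by (auto simp: compose_f_dual(1) compose_f_dual(2)[OF _ E] intro!: restrict_ext)
    then show ?thesis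
      unfolding AR using nak[OF x] by (simp add: hom_kernel_def)
  qed
  have "?h \<in> rhom A M (AR_translate A M)"
    unfolding rhom_def
  proof (intro CollectI conjI ballI)
    show "?h \<in> carrier M \<rightarrow>\<^sub>E carrier (AR_translate A M)" using ker by auto
    fix x assume x: "x \<in> carrier M"
    show "?h (x \<oplus>\<^bsub>M\<^esub> y) = ?h x \<oplus>\<^bsub>AR_translate A M\<^esub> ?h y" if y: "y \<in> carrier M" for y
      unfolding AR using x y by (auto simp: nakayama_def act_add l_add intro!: restrict_ext)
    show "?h (r \<odot>\<^bsub>M\<^esub> x) = r \<odot>\<^bsub>AR_translate A M\<^esub> ?h x" if r: "r \<in> carrier A" for r
    proof -
      obtain c where c: "r = \<psi> c" using r by (auto simp: carrier_A)
      have "?h (r \<odot>\<^bsub>M\<^esub> x) = (\<lambda>g\<in>proj_dual A b. l (act M (act M x c) (?v g)))"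
        using x act_closed[OF x, of c] unfolding c act_def by simp
      also have "\<dots> = (\<lambda>g\<in>proj_dual A b. l (act M x (?v (dual_smult A b r g))))"
        unfolding c by (rule restrict_ext) (simp only: dual_smult_closed(2)[OF _ E] act_mult[OF x])
      also have "\<dots> = r \<odot>\<^bsub>AR_translate A M\<^esub> ?h x"
        unfolding AR using x by (auto simp: nakayama_def c dual_smult_closed(1) intro!: restrict_ext)
      finally show ?thesis .
    qed
  qed
  then have "?h x = \<zero>\<^bsub>AR_translate A M\<^esub>" using rigid x unfolding tau_rigid_def by blast
  \<comment> \<open>The coordinate functional (j, k) takes the value e_j at the generator
    \<open>?E\<close>, so evaluating there returns l(x e_j).\<close>
  then have "(\<lambda>g\<in>proj_dual A b. l (act M x (?v g))) (coord b j k) = (\<lambda>g\<in>proj_dual A b. 0) (coord b j k)"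
    unfolding AR using x by (simp add: nakayama_def)
  then show ?thesis
    using coord_dual[of b j k] by (simp add: coord_apply[OF E]) (simp add: vsingle_def)
qed

text \<open>Already every homomorphism h : M -> \<nu>P_1 vanishes. Any g is the sum of c coord_jk
  with c = g(e_jk) and c e_j = c, and h(x)(c coord_jk) = h(x c)(coord_jk), where x c = x c e_j is
  zero.\<close>

lemma tau_rigidI:
  assumes "\<And>j x. 0 < b j \<Longrightarrow> x \<in> carrier M \<Longrightarrow> act M x (ee j) = \<zero>\<^bsub>M\<^esub>"
  shows "tau_rigid A M"
  unfolding tau_rigid_def
proof (intro ballI)
  fix h x assume h: "h \<in> rhom A M (AR_translate A M)" and x: "x \<in> carrier M"
  have hc: "h y \<in> carrier (nakayama A b)" if "y \<in> carrier M" for y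
    using h that unfolding rhom_def AR by (auto simp: hom_kernel_def)
  then have h_add: "h y (dual_add A b g g') = h y g + h y g'"
    if "y \<in> carrier M" "g \<in> proj_dual A b" "g' \<in> proj_dual A b" for y g g'
    using that by (auto simp: nakayama_def)
  have h_mul: "h (act M y c) g = h y (dual_smult A b (\<psi> c) g)" if "y \<in> carrier M" "g \<in> proj_dual A b" for y c g
  proof -
    have "h (\<psi> c \<odot>\<^bsub>M\<^esub> y) = \<psi> c \<odot>\<^bsub>AR_translate A M\<^esub> h y"
      using h that(1) psi_closed unfolding rhom_def by blast
    then show ?thesis using that(2) unfolding AR act_def by (simp add: nakayama_def)
  qed
  have h_zero: "h \<zero>\<^bsub>M\<^esub> g = 0" if g: "g \<in> proj_dual A b" for g
  proof -
    have "h (\<zero>\<^bsub>M\<^esub> \<oplus>\<^bsub>M\<^esub> \<zero>\<^bsub>M\<^esub>) = h \<zero>\<^bsub>M\<^esub> \<oplus>\<^bsub>AR_translate A M\<^esub> h \<zero>\<^bsub>M\<^esub>"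
      using h M.zero_closed unfolding rhom_def by blast
    then have "h \<zero>\<^bsub>M\<^esub> = h \<zero>\<^bsub>M\<^esub> \<oplus>\<^bsub>AR_translate A M\<^esub> h \<zero>\<^bsub>M\<^esub>" by simp
    then have "h \<zero>\<^bsub>M\<^esub> g = (h \<zero>\<^bsub>M\<^esub> \<oplus>\<^bsub>AR_translate A M\<^esub> h \<zero>\<^bsub>M\<^esub>) g" by (rule arg_cong)
    then have "h \<zero>\<^bsub>M\<^esub> g = h \<zero>\<^bsub>M\<^esub> g + h \<zero>\<^bsub>M\<^esub> g"
      unfolding AR nakayama_def ring.simps partial_object.simps module.simps restrict_apply' [OF g] .
    then show ?thesis by (metis add_cancel_right_right)
  qed
  have single: "h x (dual_smult A b (\<psi> c) (coord b j k)) = 0" if "k < b j" "c * ee j = c" for c j k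
  proof -
    have "act M x c = act M (act M x c) (ee j)" using act_mult[OF x, of c "ee j"] that(2) by simp
    also have "\<dots> = \<zero>\<^bsub>M\<^esub>" by (rule assms) (use that x in auto)
    finally show ?thesis using h_mul[OF x coord_dual] h_zero[OF coord_dual] by metis
  qed
  have E: "vsingle j k (ee j) \<in> jfree b" if "k < b j" for j k
    by (rule jfree_vsingle) (use that in simp_all)
  have "h x g = 0" if "finite T" "g \<in> proj_dual A b" "T \<subseteq> (SIGMA j:UNIV. {..<b j})"
      "\<And>j k. k < b j \<Longrightarrow> (j, k) \<notin> T \<Longrightarrow> \<phi> (g (vmap (vsingle j k (ee j)))) = 0" for T g
    using that
  proof (induction T arbitrary: g rule: finite_induct)
    case empty
    \<comment> \<open>A g that vanishes on all generators equals its own double, so its value under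
      the additive \<open>h x\<close> is zero.\<close>
    have "g = dual_add A b g g"
      by (rule proj_dual_ext[OF empty.prems(1) dual_add_closed(1)[OF empty.prems(1,1)]])
        (simp add: dual_add_closed(2)[OF empty.prems(1,1) E] empty.prems(3))
    then show ?case using h_add[OF x empty.prems(1,1)] by (metis add_cancel_right_right)
  next
    case (insert t T)
    obtain j k where t: "t = (j, k)" by (cases t)
    have k: "k < b j" using insert.prems(2) t by auto
    let ?c = "\<phi> (g (vmap (vsingle j k (ee j))))"
    have c: "?c * ee j = ?c"
      using proj_dual_hom(3)[OF insert.prems(1) E[OF k], of "ee j"] by (simp add: rmul_vsingle)
    let ?s = "\<lambda>c. dual_smult A b (\<psi> c) (coord b j k)"
    have s: "?s d \<in> proj_dual A b" for d by (rule dual_smult_closed(1)[OF coord_dual])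
    \<comment> \<open>Removes the component of g along the coordinate (j, k), so the induction
      hypothesis for the smaller support applies.\<close>
    let ?g = "dual_add A b g (?s (- ?c))"
    have g: "?g \<in> proj_dual A b" by (rule dual_add_closed(1)[OF insert.prems(1) s])
    have gE: "\<phi> (?g (vmap (vsingle j' k' (ee j')))) =
        \<phi> (g (vmap (vsingle j' k' (ee j')))) - ?c * vsingle j' k' (ee j') j k" if "k' < b j'" for j' k'
      by (simp add: dual_add_closed(2)[OF insert.prems(1) s E[OF that]]
          dual_smult_closed(2)[OF coord_dual E[OF that]] coord_apply[OF E[OF that]])
    have "h x ?g = 0"
    proof (rule insert.IH[OF g])
      show "T \<subseteq> (SIGMA j:UNIV. {..<b j})" using insert.prems(2) by blast
      fix j' k' assume jk: "k' < b j'" "(j', k') \<notin> T"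
      show "\<phi> (?g (vmap (vsingle j' k' (ee j')))) = 0"
      proof (cases "(j', k') = t")
        case True
        then have jk': "j' = j" "k' = k" using t by auto
        show ?thesis using gE[OF jk(1)] c unfolding jk' by (simp add: vsingle_def)
      next
        case False
        then have "vsingle j' k' (ee j') j k = (0 :: 'k jac)" using t by (auto simp: vsingle_def)
        then show ?thesis using gE[OF jk(1)] insert.prems(3)[of k' j'] jk False by simp
      qed
    qed
    moreover have "h x (?s (- ?c)) = 0" by (rule single[OF k]) (simp add: c)
    ultimately show ?case using h_add[OF x insert.prems(1) s] by simp
  qed
  from this[of "SIGMA j:UNIV. {..<b j}"] have "h x g = 0" if "g \<in> proj_dual A b" for g
    using that by auto
  moreover have "h x \<in> extensional (proj_dual A b)"
    using hc[OF x] by (auto simp: nakayama_def PiE_def)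
  ultimately have "h x = (\<lambda>g\<in>proj_dual A b. 0)"
    by (auto simp: fun_eq_iff extensional_def)
  then show "h x = \<zero>\<^bsub>AR_translate A M\<^esub>" unfolding AR by (simp add: nakayama_def)
qed

end

section \<open>From rigidity to the list of modules\<close>

context min_pres
begin

lemma R_zero: "R 0 = 0"
  using R_rmul[of 0 0] by (simp only: rmul_simps jfree_zero)

lemma R_expand:
  assumes "v \<in> jfree b"
  shows "R v = (\<Sum>(j, k)\<in>(SIGMA j:UNIV. {..<b j}). rmul (R (vsingle j k (ee j))) (v j k))"
proof -
  have "R v = (\<Sum>(j, k)\<in>(SIGMA j:UNIV. {..<b j}). R (rmul (vsingle j k (ee j)) (v j k)))"
    by (rule jvec_hom_expand[OF R_zero R_add assms])
  also have "\<dots> = (\<Sum>(j, k)\<in>(SIGMA j:UNIV. {..<b j}). rmul (R (vsingle j k (ee j))) (v j k))"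
    by (intro sum.cong refl) (auto intro!: R_rmul jfree_vsingle)
  finally show ?thesis .
qed

text \<open>Two preimages of the same element of M differ by a value of \<open>R\<close>, so the
  choice of preimage does not matter.\<close>

lemma induced_functional:
  fixes c :: "'k jvec \<Rightarrow> 'k"
  assumes c_add: "\<And>u v. u \<in> jfree a \<Longrightarrow> v \<in> jfree a \<Longrightarrow> c (u + v) = c u + c v"
    and c_scal: "\<And>u r. u \<in> jfree a \<Longrightarrow> c (rmul u (sc r)) = r * c u"
    and c_ker: "\<And>v. v \<in> jfree b \<Longrightarrow> c (R v) = 0"
  obtains l where "\<And>u. u \<in> jfree a \<Longrightarrow> l (Q u) = c u"
    "\<And>x y. x \<in> carrier M \<Longrightarrow> y \<in> carrier M \<Longrightarrow> l (x \<oplus>\<^bsub>M\<^esub> y) = l x + l y"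
    "\<And>x r. x \<in> carrier M \<Longrightarrow> l (act M x (sc r)) = r * l x"
proof -
  define l where "l x = c (SOME u. u \<in> jfree a \<and> Q u = x)" for x
  have l: "l (Q u) = c u" if u: "u \<in> jfree a" for u
  proof -
    let ?v = "SOME v. v \<in> jfree a \<and> Q v = Q u"
    have v: "?v \<in> jfree a \<and> Q ?v = Q u" by (rule someI[of _ u]) (use u in simp)
    have d: "?v - u \<in> jfree a" using v u jfree_diff by blast
    have "Q (?v - u) = \<zero>\<^bsub>M\<^esub>" using jhom_eq_iff[OF Q_hom _ u] v by blast
    then obtain y where "y \<in> jfree b" "?v - u = R y" using Q_zero_iff[OF d] by blast
    then have "c (?v - u) = 0" using c_ker by simp
    moreover have "c ((?v - u) + u) = c (?v - u) + c u" by (rule c_add[OF d u])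
    ultimately show ?thesis unfolding l_def by simp
  qed
  have "l (x \<oplus>\<^bsub>M\<^esub> y) = l x + l y" if xy: "x \<in> carrier M" "y \<in> carrier M" for x y
  proof -
    obtain u v where uv: "u \<in> jfree a" "x = Q u" "v \<in> jfree a" "y = Q v"
      using xy unfolding Q_surj [symmetric] by blast
    have "l (Q (u + v)) = c u + c v" using l[OF jfree_add[OF uv(1,3)]] c_add[OF uv(1,3)] by simp
    then show ?thesis using jhom_add[OF Q_hom uv(1,3)] uv l by simp
  qed
  moreover have "l (act M x (sc r)) = r * l x" if x: "x \<in> carrier M" for x r
  proof -
    obtain u where u: "u \<in> jfree a" "x = Q u" using x unfolding Q_surj [symmetric] by blast
    show ?thesis
      using l[OF jfree_rmul[OF u(1), of "sc r"]] jhom_rmul[OF Q_hom u(1), of "sc r"] u l[OF u(1)] c_scal[OF u(1)]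
      by simp
  qed
  ultimately show thesis using that l by blast
qed

lemma rsubmodule_image:
  assumes X: "X \<subseteq> jfree a" "0 \<in> X" "\<And>u v. u \<in> X \<Longrightarrow> v \<in> X \<Longrightarrow> u + v \<in> X"
    "\<And>u c. u \<in> X \<Longrightarrow> rmul u c \<in> X"
  shows "rsubmodule A (Q ` X) M"
proof -
  have Xj: "u \<in> jfree a" if "u \<in> X" for u using that X(1) by blast
  have "subgroup (Q ` X) (add_monoid M)"
  proof (rule M.add.subgroupI)
    show "Q ` X \<subseteq> carrier M" using Xj jhom_closed[OF Q_hom] by blast
    show "Q ` X \<noteq> {}" using X(2) by blast
    fix x y assume "x \<in> Q ` X" "y \<in> Q ` X"
    then obtain u v where uv: "u \<in> X" "x = Q u" "v \<in> X" "y = Q v" by blast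
    have "x \<oplus>\<^bsub>M\<^esub> y = Q (u + v)" using jhom_add[OF Q_hom] Xj uv by simp
    then show "x \<oplus>\<^bsub>M\<^esub> y \<in> Q ` X" using X(3)[OF uv(1,3)] by blast
    have "Q (rmul u (- 1)) = \<ominus>\<^bsub>M\<^esub> Q u"
      using jhom_rmul[OF Q_hom Xj[OF uv(1)]] act_uminus[of "Q u" 1] jhom_closed[OF Q_hom Xj[OF uv(1)]] by simp
    then show "\<ominus>\<^bsub>M\<^esub> x \<in> Q ` X" using X(4)[OF uv(1)] uv(2) by (metis imageI)
  qed
  moreover have "r \<odot>\<^bsub>M\<^esub> x \<in> Q ` X" if r: "r \<in> carrier A" and x: "x \<in> Q ` X" for r x
  proof -
    obtain c where c: "r = \<psi> c" using r by (auto simp: carrier_A)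
    obtain u where u: "u \<in> X" "x = Q u" using x by blast
    have "r \<odot>\<^bsub>M\<^esub> x = Q (rmul u c)"
      using jhom_rmul[OF Q_hom Xj[OF u(1)], of c] unfolding c u(2) act_def by simp
    then show ?thesis using X(4)[OF u(1)] by blast
  qed
  ultimately show ?thesis unfolding rsubmodule_def by (simp add: additive_subgroup.intro)
qed

text \<open>\<open>P\<^sub>0\<close> is the direct sum of \<open>u1 \<cdot> jac\<close> and the vectors whose coordinate \<open>(i, s)\<close> is zero.\<close>

lemma indecomposable_cyclic:
  assumes ind: "indecomposable A M" and u1: "u1 \<in> jfree a" "lp0 (u1 i s) i \<noteq> 0"
    and split: "\<And>x p. p \<in> jfree a \<Longrightarrow> p i s = 0 \<Longrightarrow> Q (rmul u1 x) = Q p \<Longrightarrow> Q (rmul u1 x) = \<zero>\<^bsub>M\<^esub>"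
  shows "carrier M = range (act M (Q u1))"
proof -
  let ?X = "range (rmul u1)"
  let ?Y = "{p \<in> jfree a. p i s = 0}"
  have r1: "rsubmodule A (Q ` ?X) M"
  proof (rule rsubmodule_image)
    show "?X \<subseteq> jfree a" using jfree_rmul[OF u1(1)] by blast
    show "0 \<in> ?X" by (rule range_eqI[of _ _ 0]) (simp only: rmul_simps)
    show "u + v \<in> ?X" if "u \<in> ?X" "v \<in> ?X" for u v
      using that by (auto simp only: rmul_simps(2) [symmetric] image_iff intro: bexI)
    show "rmul u c \<in> ?X" if "u \<in> ?X" for u c
      using that by (auto simp only: rmul_simps(3) [symmetric])
  qed
  have r2: "rsubmodule A (Q ` ?Y) M"
  proof (rule rsubmodule_image)
    show "u + v \<in> ?Y" if "u \<in> ?Y" "v \<in> ?Y" for u v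
      using that by (intro CollectI conjI jfree_add) auto
    show "rmul u c \<in> ?Y" if "u \<in> ?Y" for u c
      using that by (intro CollectI conjI jfree_rmul) (auto simp: rmul_def)
  qed auto
  obtain y where y: "ee i * u1 i s * y = ee i" using jac_unit[OF u1(2)] .
  have "Q ` ?X <+>\<^bsub>M\<^esub> Q ` ?Y = carrier M"
  proof
    show "Q ` ?X <+>\<^bsub>M\<^esub> Q ` ?Y \<subseteq> carrier M"
      using jhom_closed[OF Q_hom] jfree_rmul[OF u1(1)] by (auto simp: set_add_def')
    show "carrier M \<subseteq> Q ` ?X <+>\<^bsub>M\<^esub> Q ` ?Y"
    proof
      fix x assume "x \<in> carrier M"
      then obtain u where u: "u \<in> jfree a" "x = Q u" unfolding Q_surj [symmetric] by blast
      let ?x = "rmul u1 (y * u i s)"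
      have x: "?x \<in> jfree a" by (rule jfree_rmul[OF u1(1)])
      have "u1 i s * (y * u i s) = (ee i * u1 i s * y) * u i s"
        by (simp add: jfree_ee[OF u1(1)] mult.assoc)
      then have "(u - ?x) i s = 0" by (simp add: rmul_def y jfree_ee[OF u(1)])
      then have "u - ?x \<in> ?Y" using jfree_diff[OF u(1) x] by blast
      moreover have "x = Q ?x \<oplus>\<^bsub>M\<^esub> Q (u - ?x)"
        using jhom_add[OF Q_hom x jfree_diff[OF u(1) x]] u(2) by simp
      ultimately show "x \<in> Q ` ?X <+>\<^bsub>M\<^esub> Q ` ?Y" unfolding set_add_def' by blast
    qed
  qed
  moreover have "Q ` ?X \<inter> Q ` ?Y = {\<zero>\<^bsub>M\<^esub>}"
  proof
    show "Q ` ?X \<inter> Q ` ?Y \<subseteq> {\<zero>\<^bsub>M\<^esub>}"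
      using split by auto
    have "\<zero>\<^bsub>M\<^esub> \<in> Q ` ?X" using additive_subgroup.zero_closed r1 unfolding rsubmodule_def by blast
    moreover have "\<zero>\<^bsub>M\<^esub> \<in> Q ` ?Y" using additive_subgroup.zero_closed r2 unfolding rsubmodule_def by blast
    ultimately show "{\<zero>\<^bsub>M\<^esub>} \<subseteq> Q ` ?X \<inter> Q ` ?Y" by blast
  qed
  ultimately have "Q ` ?X = {\<zero>\<^bsub>M\<^esub>} \<or> Q ` ?Y = {\<zero>\<^bsub>M\<^esub>}"
    using ind r1 r2 unfolding indecomposable_def by blast
  moreover have "Q ` ?X \<noteq> {\<zero>\<^bsub>M\<^esub>}"
  proof
    assume "Q ` ?X = {\<zero>\<^bsub>M\<^esub>}"
    then have "Q (rmul u1 1) = \<zero>\<^bsub>M\<^esub>" by blast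
    then have "vrad u1" using Q_rad[OF u1(1)] by (simp add: rmul_simps)
    then show False using u1(2) by (simp add: vrad_def)
  qed
  ultimately have Y: "Q ` ?Y = {\<zero>\<^bsub>M\<^esub>}" by blast
  have "carrier M = Q ` ?X"
  proof
    show "Q ` ?X \<subseteq> carrier M" using jhom_closed[OF Q_hom] jfree_rmul[OF u1(1)] by auto
    show "carrier M \<subseteq> Q ` ?X"
    proof
      fix x assume "x \<in> carrier M"
      then have "x \<in> Q ` ?X <+>\<^bsub>M\<^esub> Q ` ?Y" using \<open>Q ` ?X <+>\<^bsub>M\<^esub> Q ` ?Y = carrier M\<close> by simp
      then obtain z where z: "z \<in> Q ` ?X" "x = z \<oplus>\<^bsub>M\<^esub> \<zero>\<^bsub>M\<^esub>" unfolding Y set_add_def' by blast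
      moreover have "z \<in> carrier M" using z(1) jhom_closed[OF Q_hom] jfree_rmul[OF u1(1)] by auto
      ultimately show "x \<in> Q ` ?X" by simp
    qed
  qed
  also have "\<dots> = range (act M (Q u1))"
    unfolding image_image using jhom_rmul[OF Q_hom u1(1)] by simp
  finally show ?thesis .
qed

end

lemma ee_mult_zero_iff: "ee i * x = 0 \<longleftrightarrow> x \<in> ann i 4 2"
proof
  assume "ee i * x = 0"
  then show "x \<in> ann i 4 2" unfolding ann_4_2 jac_eq_iff by (drule_tac x=i in spec) simp
qed (auto simp: ann_4_2 jac_eq_iff)

lemma ann_ee_mult: "proj_or_loop J T \<Longrightarrow> ee i * x \<in> ann i J T \<longleftrightarrow> x \<in> ann i J T"
  unfolding proj_or_loop_def by (auto simp: ann_4_2 ann_2_0)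

lemma mult_ee_oth:
  assumes "x * ee (oth i) = x"
  shows "lp0 x i = 0" "lp1 x i = 0" "lp2 x i = 0" "lp3 x i = 0"
  using assms unfolding jac_eq_iff by (drule_tac x=i in spec, simp)+

text \<open>The space e_i \<open>jac\<close> e_j, with j = \<open>oth i\<close>, consists of the
  multiples of a_i by p + q z.\<close>

lemma arrow_factor:
  fixes r :: "'k::field jac"
  assumes "ee i * r = r" "r * ee (oth i) = r"
  shows "r = ee i * (sc (ar0 r i) + sc (ar1 r i) * zz) * av i"
  using assms(1) mult_ee_oth[OF assms(2)] unfolding ee_mult_iff
  by (simp add: jac_eq_iff all_vert[of _ i])

text \<open>Division in K[z]/z^2 by an element with nonzero constant term; the quotient is p + s
  z.\<close>

lemma arrow_divides:
  fixes r r' :: "'k::field jac"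
  assumes r: "ee i * r = r" "r * ee (oth i) = r" "ar0 r i \<noteq> 0"
    and r': "ee i * r' = r'" "r' * ee (oth i) = r'"
  obtains t where "r * t = r'"
proof -
  define p where "p = ar0 r' i / ar0 r i"
  define s where "s = (ar1 r' i - ar1 r i * p) / ar0 r i"
  have p: "ar0 r i * p = ar0 r' i" using r(3) by (simp add: p_def)
  have s: "ar0 r i * s + ar1 r i * p = ar1 r' i" using r(3) by (simp add: s_def)
  have "r * (ee (oth i) * (sc p + sc s * zz)) = r'"
    using r(1) mult_ee_oth[OF r(2)] r'(1) mult_ee_oth[OF r'(2)] p s unfolding ee_mult_iff
    by (simp add: jac_eq_iff all_vert[of _ i])
  then show thesis by (rule that)
qed

context min_pres_AR
begin

text \<open>Restates \<open>functional_vanishes\<close> on the free cover, where test functionals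
  are single coefficients.\<close>

lemma functional_vanishes_jfree:
  fixes c :: "'k jvec \<Rightarrow> 'k"
  assumes rigid: "tau_rigid A M"
    and c_add: "\<And>u v. u \<in> jfree a \<Longrightarrow> v \<in> jfree a \<Longrightarrow> c (u + v) = c u + c v"
    and c_scal: "\<And>u r. u \<in> jfree a \<Longrightarrow> c (rmul u (sc r)) = r * c u"
    and c_ker: "\<And>v. v \<in> jfree b \<Longrightarrow> c (R v) = 0"
    and k: "k < b j"
    and van: "\<And>u i s. u \<in> jfree a \<Longrightarrow> c (rmul u (R (vsingle j k (ee j)) i s)) = 0"
    and u: "u \<in> jfree a"
  shows "c (rmul u (ee j)) = 0"
proof -
  obtain l where l: "\<And>u. u \<in> jfree a \<Longrightarrow> l (Q u) = c u"
    "\<And>x y. x \<in> carrier M \<Longrightarrow> y \<in> carrier M \<Longrightarrow> l (x \<oplus>\<^bsub>M\<^esub> y) = l x + l y"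
    "\<And>x r. x \<in> carrier M \<Longrightarrow> l (act M x (sc r)) = r * l x"
    using induced_functional[OF c_add c_scal c_ker] by blast
  have act: "l (act M (Q u) x) = c (rmul u x)" if "u \<in> jfree a" for u x
    using l(1)[OF jfree_rmul[OF that]] jhom_rmul[OF Q_hom that] by simp
  have "l (act M (Q u) (ee j)) = 0"
  proof (rule functional_vanishes[where j = j and k = k, OF rigid l(2,3) k])
    show "l (act M x (R (vsingle j k (ee j)) i s)) = 0" if x: "x \<in> carrier M" for x i s
    proof -
      obtain u where "u \<in> jfree a" "x = Q u" using x unfolding Q_surj [symmetric] by blast
      then show ?thesis using act van by simp
    qed
    show "Q u \<in> carrier M" by (rule jhom_closed[OF Q_hom u])
  qed
  then show ?thesis using act[OF u] by simp
qed

lemma kernel_component: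
  assumes "v \<in> jfree b"
  shows "lp0 (R v i s) j = 0"
proof -
  have "Q (R v) = \<zero>\<^bsub>M\<^esub>" using Q_zero_iff[OF R_closed[OF assms]] assms by blast
  then have "vrad (R v)" by (rule Q_rad[OF R_closed[OF assms]])
  from vrad_pow[OF R_closed[OF assms] this, of i s] show ?thesis by (simp add: jac_pow_def)
qed

text \<open>The test functional is the constant coefficient of the first generator at i of P_0. All
  values of \<open>R\<close> are radical, so it vanishes on them and on multiples by their entries,
  but not on the generator itself.\<close>

lemma supports_disjoint:
  assumes rigid: "tau_rigid A M" and a: "0 < a i"
  shows "b i = 0"
proof (rule ccontr)
  assume "b i \<noteq> 0"
  then have k: "0 < b i" by simp
  let ?c = "\<lambda>u :: 'k jvec. lp0 (u i 0) i"
  have E: "vsingle i 0 (ee i) \<in> jfree b" by (rule jfree_vsingle) (use k in simp_all)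
  have "?c (rmul (vsingle i 0 (ee i)) (ee i)) = 0"
  proof (rule functional_vanishes_jfree[where c = ?c, OF rigid _ _ _ k])
    show "vsingle i 0 (ee i) \<in> jfree a" by (rule jfree_vsingle) (use a in simp_all)
  qed (simp_all add: rmul_def kernel_component kernel_component[OF E] mult.commute)
  then show False by (simp add: rmul_def vsingle_def)
qed

text \<open>If P_1 is zero, one generator of P_0 splits off. Otherwise P_0 lives at i and P_1 at
  \<open>oth i\<close> only, so all entries of the presentation are multiples of a_i. An entry with
  nonzero a_i-coefficient then provides a cyclic direct summand, which is all of M.\<close>

lemma tau_rigid_cyclic:
  assumes ind: "indecomposable A M" and rigid: "tau_rigid A M"
  obtains w i J T where "proj_or_loop J T" "cyclic_at M w i J T"
proof -
  have "\<exists>i. 0 < a i"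
  proof (rule ccontr)
    assume "\<nexists>i. 0 < a i"
    then have "a i = 0" for i by simp
    then have "u = 0" if "u \<in> jfree a" for u
      using jfree_out[OF that] by (simp add: fun_eq_iff)
    then have "(jfree a :: 'k jvec set) = {0}" using jfree_zero by blast
    then have "carrier M = {\<zero>\<^bsub>M\<^esub>}"
      by (simp only: Q_surj [symmetric] image_insert image_empty jhom_0[OF Q_hom])
    then show False using ind by (simp add: indecomposable_def)
  qed
  then obtain i where ai: "0 < a i" by blast
  let ?j = "oth i"
  have bi: "b i = 0" by (rule supports_disjoint[OF rigid ai])
  show thesis
  proof (cases "b ?j = 0")
    case True
    then have "b j = 0" for j using bi by (cases "j = i") (auto simp: neq_iff_oth)
    then have b0: "v = 0" if "v \<in> jfree b" for v
      using jfree_out[OF that] by (simp add: fun_eq_iff)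
    have inj: "Q u = \<zero>\<^bsub>M\<^esub> \<longleftrightarrow> u = 0" if "u \<in> jfree a" for u
      using Q_zero_iff[OF that] b0 R_zero jfree_zero by metis
    let ?E = "vsingle i 0 (ee i) :: 'k jvec"
    have E: "?E \<in> jfree a" by (rule jfree_vsingle) (use ai in simp_all)
    have QE: "Q (rmul ?E x) = \<zero>\<^bsub>M\<^esub> \<longleftrightarrow> x \<in> ann i 4 2" for x
    proof -
      have "Q (rmul ?E x) = \<zero>\<^bsub>M\<^esub> \<longleftrightarrow> rmul ?E x = 0" by (rule inj[OF jfree_rmul[OF E]])
      also have "\<dots> \<longleftrightarrow> ee i * x = 0" by (auto simp: rmul_def vsingle_def fun_eq_iff)
      finally show ?thesis by (simp only: ee_mult_zero_iff)
    qed
    have "carrier M = range (act M (Q ?E))"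
    proof (rule indecomposable_cyclic[OF ind E])
      show "lp0 (?E i 0) i \<noteq> 0" by (simp add: vsingle_def)
      fix x p assume p: "p \<in> jfree a" "p i 0 = 0" "Q (rmul ?E x) = Q p"
      then have "Q (rmul ?E x - p) = \<zero>\<^bsub>M\<^esub>"
        using jhom_eq_iff[OF Q_hom jfree_rmul[OF E] p(1)] by blast
      then have "rmul ?E x - p = 0" using inj[OF jfree_diff[OF jfree_rmul[OF E] p(1)]] by blast
      then have "(rmul ?E x - p) i 0 = 0" by (simp only: zero_fun_apply)
      then have "ee i * x = 0" using p(2) by (simp add: rmul_def vsingle_def)
      then show "Q (rmul ?E x) = \<zero>\<^bsub>M\<^esub>" by (simp only: QE ee_mult_zero_iff)
    qed
    then have "cyclic_at M (Q ?E) i 4 2"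
      unfolding cyclic_at_def using jhom_closed[OF Q_hom E] QE jhom_rmul[OF Q_hom E] by auto
    then show thesis using that[of 4 2] by (simp add: proj_or_loop_def)
  next
    case False
    then have bj: "0 < b ?j" by simp
    have aj: "a ?j = 0" using supports_disjoint[OF rigid, of ?j] bj by auto
    define r where "r k = R (vsingle ?j k (ee ?j))" for k
    have E: "vsingle ?j k (ee ?j) \<in> jfree b" if "k < b ?j" for k
      by (rule jfree_vsingle) (use that in simp_all)
    have r_in: "r k \<in> jfree a" if "k < b ?j" for k
      unfolding r_def by (rule R_closed[OF E[OF that]])
    have r_ee: "ee i * r k i s = r k i s" if "k < b ?j" for k s
      by (rule jfree_ee[OF r_in[OF that]])
    have r_ee': "r k i s * ee ?j = r k i s" if "k < b ?j" for k s
    proof -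
      have "r k = rmul (r k) (ee ?j)"
        using R_rmul[OF E[OF that], of "ee ?j"] unfolding r_def by (simp add: rmul_vsingle)
      then show ?thesis by (metis rmul_def)
    qed
    have Rv: "R v i s = (\<Sum>k<b ?j. r k i s * v ?j k)" if v: "v \<in> jfree b" for v s
    proof -
      have "R v = (\<Sum>j\<in>UNIV. \<Sum>k<b j. rmul (R (vsingle j k (ee j))) (v j k))"
        using R_expand[OF v] by (simp add: sum.Sigma)
      also have "\<dots> = (\<Sum>k<b ?j. rmul (r k) (v ?j k))"
        by (simp add: UNIV_vert[of i] bi r_def)
      finally show ?thesis by (simp add: jvec_sum_apply rmul_def)
    qed
    have "\<exists>k s. k < b ?j \<and> ar0 (r k i s) i \<noteq> 0"
    proof (rule ccontr)
      assume "\<nexists>k s. k < b ?j \<and> ar0 (r k i s) i \<noteq> 0"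
      then have ar: "ar0 (r k i s) i = 0" if "k < b ?j" for k s using that by blast
      \<comment> \<open>If no entry has a nonzero a_i-coefficient, this functional vanishes on
        everything that rigidity requires, yet it takes the value 1 at a_i in coordinate (i,
        0).\<close>
      let ?c = "\<lambda>u :: 'k jvec. ar0 (u i 0) i"
      have "?c (rmul (vsingle i 0 (av i)) (ee ?j)) = 0"
      proof (rule functional_vanishes_jfree[where c = ?c, OF rigid _ _ _ bj])
        show "vsingle i 0 (av i) \<in> jfree a" by (rule jfree_vsingle) (use ai in \<open>simp_all add: ee_mult_iff\<close>)
        show "?c (R v) = 0" if "v \<in> jfree b" for v
          unfolding Rv[OF that] jac_sel_sum
          by (rule sum.neutral) (simp add: ar mult_ee_oth(1)[OF r_ee'])
        show "?c (rmul u (R (vsingle ?j 0 (ee ?j)) i' s)) = 0" for u i' s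
        proof (cases "i' = i")
          case True
          have "lp0 (r 0 i s) ?j = 0" using r_ee[OF bj, of s] unfolding ee_mult_iff by blast
          then show ?thesis unfolding True r_def [symmetric] by (simp add: rmul_def ar[OF bj])
        next
          case False
          then have "r 0 i' s = 0" by (intro jfree_out[OF r_in[OF bj]]) (auto simp: neq_iff_oth aj)
          then show ?thesis unfolding r_def [symmetric] by (simp add: rmul_def)
        qed
      qed (simp_all add: rmul_def mult.commute)
      then show False by (simp add: rmul_def vsingle_def)
    qed
    then obtain k0 s where k0: "k0 < b ?j" and s: "ar0 (r k0 i s) i \<noteq> 0" by blast
    \<comment> \<open>Column \<open>k0\<close> with the arrow stripped off, so that
      \<open>r k0\<close> is u1 times a_i. Its coordinate (i, s) is a unit, so u1 can replace the
      generator (i, s) of P_0.\<close>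
    define u1 where "u1 = (\<lambda>i' t. if i' = i \<and> t < a i
        then ee i * (sc (ar0 (r k0 i t) i) + sc (ar1 (r k0 i t) i) * zz) else 0)"
    have sa: "s < a i" using s jfree_out[OF r_in[OF k0], of s i] by force
    have u1: "u1 \<in> jfree a" by (rule jfreeI) (auto simp: u1_def)
    have u1_unit: "lp0 (u1 i s) i \<noteq> 0" using s sa by (simp add: u1_def)
    have u1_av: "rmul u1 (av i) = r k0"
    proof (intro ext)
      fix i' t
      show "rmul u1 (av i) i' t = r k0 i' t"
      proof (cases "i' = i \<and> t < a i")
        case True
        then show ?thesis
          using arrow_factor[OF r_ee[OF k0] r_ee'[OF k0], of t] by (simp add: rmul_def u1_def)
      next
        case False
        then have "\<not> t < a i'" by (cases "i' = i") (auto simp: neq_iff_oth aj)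
        then have "r k0 i' t = 0" by (rule jfree_out[OF r_in[OF k0]])
        then show ?thesis using False by (auto simp: rmul_def u1_def)
      qed
    qed
    have u1_ee: "rmul u1 (ee i * x) = rmul u1 x" for x
      by (auto simp: rmul_def u1_def fun_eq_iff jac_eq_iff)
    have ker_r: "Q (rmul (r k0) y) = \<zero>\<^bsub>M\<^esub>" for y
    proof -
      have "rmul (r k0) y = R (rmul (vsingle ?j k0 (ee ?j)) y)"
        unfolding r_def by (rule R_rmul[OF E[OF k0], symmetric])
      then show ?thesis
        using Q_zero_iff[OF jfree_rmul[OF r_in[OF k0]]] jfree_rmul[OF E[OF k0]] by blast
    qed
    have JT: "proj_or_loop 4 2" "proj_or_loop 2 0" by (simp_all add: proj_or_loop_def)
    \<comment> \<open>The entry (i, s) of column \<open>k0\<close> divides the entries (i, s) of all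
      columns by \<open>arrow_divides\<close>.\<close>
    have ker: "\<exists>y. R v i s = r k0 i s * y" if v: "v \<in> jfree b" for v
    proof -
      have "\<exists>t. r k0 i s * t = r k i s" if "k < b ?j" for k
        using arrow_divides[OF r_ee[OF k0] r_ee'[OF k0] s r_ee[OF that] r_ee'[OF that]] by metis
      then obtain t where t: "\<And>k. k < b ?j \<Longrightarrow> r k0 i s * t k = r k i s" by metis
      have "R v i s = (\<Sum>k<b ?j. r k0 i s * t k * v ?j k)"
        unfolding Rv[OF v] by (intro sum.cong refl) (simp add: t)
      also have "\<dots> = r k0 i s * (\<Sum>k<b ?j. t k * v ?j k)"
        by (simp add: sum_distrib_left mult.assoc)
      finally show ?thesis by blast
    qed
    \<comment> \<open>The unit \<open>u1 i s\<close> is cancelled after writing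
      \<open>r k0 i s\<close> as \<open>u1 i s\<close> times a_i.\<close>
    have u1x: "ee i * x = av i * y" if "u1 i s * x = r k0 i s * y" for x y
    proof -
      have "u1 i s * (x - av i * y) = 0"
        using that unfolding u1_av [symmetric] by (simp add: rmul_def right_diff_distrib mult.assoc)
      moreover have "u1 i s * (ee i * (x - av i * y)) = u1 i s * (x - av i * y)"
        using u1_ee[of "x - av i * y"] by (metis rmul_def)
      ultimately have "u1 i s * (ee i * (x - av i * y)) \<in> ann i 4 2" by (simp add: ann_4_2)
      then have "ee i * (x - av i * y) \<in> ann i 4 2"
        using ann_mult_left[OF JT(1) u1_unit] by simp
      then have "ee i * (x - av i * y) = 0" by (rule ann_4_2_zero[OF ee_idem_left])
      moreover have "ee i * (av i * y) = av i * y" by (auto simp: jac_eq_iff)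
      ultimately show ?thesis by (simp add: right_diff_distrib)
    qed
    have "carrier M = range (act M (Q u1))"
    proof (rule indecomposable_cyclic[OF ind u1 u1_unit])
      \<comment> \<open>In coordinate (i, s) the relation u1 x - p no longer sees p. Hence e_i x =
        a_i y for some y, so u1 x is a multiple of the relation \<open>r k0\<close>.\<close>
      fix x p assume p: "p \<in> jfree a" "p i s = 0" "Q (rmul u1 x) = Q p"
      then have "Q (rmul u1 x - p) = \<zero>\<^bsub>M\<^esub>"
        using jhom_eq_iff[OF Q_hom jfree_rmul[OF u1] p(1)] by blast
      then obtain v where v: "v \<in> jfree b" "rmul u1 x - p = R v"
        using Q_zero_iff[OF jfree_diff[OF jfree_rmul[OF u1] p(1)]] by blast
      obtain y where "R v i s = r k0 i s * y" using ker[OF v(1)] by blast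
      moreover have "R v i s = u1 i s * x" using p(2) unfolding v(2) [symmetric] by (simp add: rmul_def)
      ultimately have "ee i * x = av i * y" using u1x by simp
      then have "rmul u1 x = rmul (r k0) y"
        using u1_ee[of x] by (simp add: u1_av [symmetric] rmul_simps)
      then show "Q (rmul u1 x) = \<zero>\<^bsub>M\<^esub>" using ker_r by simp
    qed
    moreover have "Q (rmul u1 x) = \<zero>\<^bsub>M\<^esub> \<longleftrightarrow> x \<in> ann i 2 0" for x
    proof
      assume "Q (rmul u1 x) = \<zero>\<^bsub>M\<^esub>"
      then obtain v where v: "v \<in> jfree b" "rmul u1 x = R v"
        using Q_zero_iff[OF jfree_rmul[OF u1]] by blast
      obtain y where "R v i s = r k0 i s * y" using ker[OF v(1)] by blast
      moreover have "R v i s = u1 i s * x" unfolding v(2) [symmetric] by (simp add: rmul_def)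
      ultimately have "ee i * x = av i * y" using u1x by simp
      moreover have "av i * y \<in> ann i 2 0" by (simp add: ann_2_0)
      ultimately show "x \<in> ann i 2 0" using ann_ee_mult[OF JT(2)] by metis
    next
      assume "x \<in> ann i 2 0"
      then have "ee i * x \<in> ann i 2 0" using ann_ee_mult[OF JT(2)] by blast
      then obtain y where "ee i * x = av i * y"
        using ann_2_0_generated[OF two_nonzero ee_idem_left] by blast
      then have "rmul u1 x = rmul (r k0) y"
        using u1_ee[of x] by (simp add: u1_av [symmetric] rmul_simps)
      then show "Q (rmul u1 x) = \<zero>\<^bsub>M\<^esub>" using ker_r by simp
    qed
    ultimately have "cyclic_at M (Q u1) i 2 0"
      unfolding cyclic_at_def using jhom_closed[OF Q_hom u1] jhom_rmul[OF Q_hom u1] by simp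
    then show thesis using that JT(2) by blast
  qed
qed

end

section \<open>The Euler characteristic of a point\<close>

lemma sum_alternating: "(\<Sum>i<n. (- 1) ^ i) = (if even n then 0 else (1 :: 'f::field))"
  by (induction n) auto

text \<open>The identity of the point in standard etale form, with f = T and g = 1; its fibre is the
  single root 0.\<close>

definition trivial_covering :: "'x \<Rightarrow> ('x, 'k::field) covering" where
  "trivial_covering x = [({x}, \<lambda>_. [:0, 1:], \<lambda>_. 1)]"

lemma trivial_covering_fibre: "etale_fibre (trivial_covering x) x = {(0, 0)}"
  by (auto simp: etale_fibre_def trivial_covering_def pderiv_pCons)

context
  fixes X :: "('x, 'k::field) variety" and x :: 'x
  assumes pts: "points X = {x}" and opn: "{x} \<in> zopen X"
    and reg: "\<And>c. (\<lambda>_. c) \<in> regular X {x}"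
begin

lemma etale_trivial_covering: "etale_covering X (trivial_covering x)"
  using trivial_covering_fibre[of x]
  by (auto simp: etale_covering_def pts trivial_covering_def poly_over_def opn reg)

lemma const_rel_poly: "(\<lambda>_ _. c) \<in> rel_poly X {x}"
  using rel_poly.base[OF reg[of c]] .

lemma cochain_const: "cochain X \<V> p (\<lambda>_ _. c)"
  unfolding cochain_def
  by (auto simp: simplices_def pts intro!: bexI[OF _ opn] bexI[OF _ const_rel_poly[of 1]])

lemma refinement_point:
  assumes "\<And>v. v \<in> etale_fibre \<V>' x \<Longrightarrow> \<phi> x v \<in> etale_fibre \<V> x"
    and h: "h \<in> rel_poly X {x}"
    and "\<And>u v. u \<in> etale_fibre \<V>' x \<Longrightarrow> v \<in> etale_fibre \<V>' x \<Longrightarrow> fst u = fst v \<Longrightarrow>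
      \<phi> x u = (fst (\<phi> x v), h x [snd u])"
  shows "refinement X \<V>' \<V> \<phi>"
  unfolding refinement_def pts
proof (intro ballI conjI)
  fix y v assume y: "y \<in> {x}" and v: "v \<in> etale_fibre \<V>' y"
  then show "\<phi> y v \<in> etale_fibre \<V> y" using assms(1) by simp
  show "\<exists>U\<in>zopen X. y \<in> U \<and> (\<exists>h\<in>rel_poly X U. \<exists>h'\<in>rel_poly X U. h' y [snd v] \<noteq> 0 \<and>
      (\<forall>y'\<in>U. \<forall>u\<in>etale_fibre \<V>' y'. fst u = fst v \<and> h' y' [snd u] \<noteq> 0 \<longrightarrow>
         \<phi> y' u = (fst (\<phi> y v), h y' [snd u] / h' y' [snd u])))"
  proof -
    have key: "\<phi> y' u = (fst (\<phi> y v), h y' [snd u] / 1)"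
      if u: "y' \<in> {x}" "u \<in> etale_fibre \<V>' y'" "fst u = fst v" for y' u
    proof -
      have eq: "y' = x" "y = x" using u(1) y by simp_all
      show ?thesis
        unfolding div_by_1 eq by (rule assms(3)) (use u v in \<open>simp_all add: eq\<close>)
    qed
    have "\<forall>y'\<in>{x}. \<forall>u\<in>etale_fibre \<V>' y'. fst u = fst v \<and> (1::'k) \<noteq> 0 \<longrightarrow>
        \<phi> y' u = (fst (\<phi> y v), h y' [snd u] / 1)"
      by (intro ballI impI, elim conjE, rule key)
    then have "\<exists>h'\<in>rel_poly X {x}. h' y [snd v] \<noteq> 0 \<and>
        (\<forall>y'\<in>{x}. \<forall>u\<in>etale_fibre \<V>' y'. fst u = fst v \<and> h' y' [snd u] \<noteq> 0 \<longrightarrow>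
          \<phi> y' u = (fst (\<phi> y v), h y' [snd u] / h' y' [snd u]))"
      by (intro bexI[OF _ const_rel_poly[of 1]]) (simp only: zero_neq_one not_False_eq_True simp_thms one_neq_zero)
    from bexI[where P = "\<lambda>h. \<exists>h'\<in>rel_poly X {x}. h' y [snd v] \<noteq> 0 \<and>
        (\<forall>y'\<in>{x}. \<forall>u\<in>etale_fibre \<V>' y'. fst u = fst v \<and> h' y' [snd u] \<noteq> 0 \<longrightarrow>
          \<phi> y' u = (fst (\<phi> y v), h y' [snd u] / h' y' [snd u]))", OF this h] y
    show ?thesis by (rule bexI[OF conjI[rotated] opn])
  qed
qed

text \<open>The cocycle condition makes a 0-cocycle constant on the fibre over x, so any two are
  linearly dependent. A nonzero constant never becomes zero on a refinement, since fibres of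
  coverings are non-empty.\<close>

lemma etale_betti_point_0: "etale_betti (F :: 'f::{field,finite} itself) X 0 = 1"
  unfolding etale_betti_def
proof (rule Greatest_equality, goal_cases)
  case 1
  let ?cs = "\<lambda>(i::nat) (y::'x) (w::(nat \<times> 'k) list). (1::'f)"
  show ?case
  proof (intro exI[of _ "trivial_covering x"] exI[of _ ?cs] conjI allI impI)
    show "cocycle X (trivial_covering x) 0 (?cs i)" for i
      unfolding cocycle_def
      by (auto simp: cochain_const simplices_def cech_diff_def sum_alternating numeral_2_eq_2[symmetric])
    fix a :: "nat \<Rightarrow> 'f" and i :: nat
    assume "vanishes_in_limit X (trivial_covering x) 0 (\<lambda>y w. \<Sum>i<1. a i * ?cs i y w)" and i: "i < 1"
    then obtain \<V>' where V': "etale_covering X \<V>'" "\<And>y w. (y, w) \<in> simplices X \<V>' 0 \<Longrightarrow> a 0 = 0"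
      by (auto simp: vanishes_in_limit_def coboundary_def)
    then obtain v where "v \<in> etale_fibre \<V>' x" by (auto simp: etale_covering_def pts)
    then have "(x, [v]) \<in> simplices X \<V>' 0" by (simp add: simplices_def pts)
    then show "a i = 0" using V'(2) i by auto
  qed (rule etale_trivial_covering)
next
  case (2 n)
  then obtain \<V> and cs :: "nat \<Rightarrow> 'x \<Rightarrow> (nat \<times> 'k) list \<Rightarrow> 'f" where
    V: "etale_covering X \<V>" "\<And>i. i < n \<Longrightarrow> cocycle X \<V> 0 (cs i)"
      "\<And>a. vanishes_in_limit X \<V> 0 (\<lambda>x w. \<Sum>i<n. a i * cs i x w) \<Longrightarrow> \<forall>i<n. a i = 0"
    by blast
  show "n \<le> 1"
  proof (rule ccontr)
    assume "\<not> n \<le> 1"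
    then have n: "0 < n" "1 < n" by auto
    obtain v0 where v0: "v0 \<in> etale_fibre \<V> x" using V(1) by (auto simp: etale_covering_def pts)
    have const: "cs i x [v] = cs i x [v0]" if "i < n" "v \<in> etale_fibre \<V> x" for i v
    proof -
      have "(x, [v, v0]) \<in> simplices X \<V> (Suc 0)" using v0 that by (simp add: simplices_def pts)
      then have "cech_diff (cs i) x [v, v0] = 0" using V(2)[OF that(1)] by (auto simp: cocycle_def)
      then show ?thesis by (simp add: cech_diff_def numeral_2_eq_2)
    qed
    let ?g = "\<lambda>i. cs i x [v0]"
    \<comment> \<open>A nontrivial relation between the two values: (g_1, -g_0), or (1, 0) if both
      values are zero.\<close>
    define a where "a i = (if ?g 0 = 0 \<and> ?g 1 = 0 then (if i = 0 then 1 else 0)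
      else if i = 0 then ?g 1 else if i = 1 then - ?g 0 else 0)" for i :: nat
    have sum: "(\<Sum>i<n. a i * h i) = a 0 * h 0 + a 1 * h 1" for h
    proof -
      have "(\<Sum>i<n. a i * h i) = (\<Sum>i\<in>{0, 1}. a i * h i)"
        by (rule sum.mono_neutral_right) (use n in \<open>auto simp: a_def\<close>)
      then show ?thesis by simp
    qed
    have "vanishes_in_limit X \<V> 0 (\<lambda>x w. \<Sum>i<n. a i * cs i x w)"
      unfolding vanishes_in_limit_def
    proof (intro exI[of _ \<V>] exI[of _ "\<lambda>x v. v"] conjI V(1))
      show "refinement X \<V> \<V> (\<lambda>x v. v)"
        by (rule refinement_point[OF _ rel_poly.var[of 0]]) (auto simp: prod_eq_iff)
      show "coboundary X \<V> 0 (\<lambda>x w. \<Sum>i<n. a i * cs i x (map (\<lambda>v. v) w))"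
        unfolding coboundary_def
      proof (clarsimp simp: sum)
        fix y w assume "(y, w) \<in> simplices X \<V> 0"
        then obtain v where v: "y = x" "w = [v]" "v \<in> etale_fibre \<V> x"
          by (auto simp: simplices_def pts length_Suc_conv)
        show "a 0 * cs 0 y w + a (Suc 0) * cs (Suc 0) y w = 0"
          using const[OF n(1) v(3)] const[OF n(2) v(3)] unfolding v(1,2) by (simp add: a_def)
      qed
    qed
    from V(3)[OF this] n have "a 0 = 0" "a 1 = 0" by auto
    then show False by (auto simp: a_def split: if_splits)
  qed
qed

text \<open>Choosing a point \<open>v0\<close> of the fibre refines any covering by the trivial one.
  The pulled-back cocycle has a single value \<open>?c\<close>, and it remains to see that this
  constant is a coboundary.\<close>

lemma etale_betti_point_Suc: "etale_betti (F :: 'f::{field,finite} itself) X (Suc q) = 0"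
  unfolding etale_betti_def
proof (rule Greatest_equality, goal_cases)
  case 1
  show ?case using etale_trivial_covering by auto
next
  case (2 n)
  then obtain \<V> and cs :: "nat \<Rightarrow> 'x \<Rightarrow> (nat \<times> 'k) list \<Rightarrow> 'f" where
    V: "etale_covering X \<V>" "\<And>i. i < n \<Longrightarrow> cocycle X \<V> (Suc q) (cs i)"
      "\<And>a. vanishes_in_limit X \<V> (Suc q) (\<lambda>x w. \<Sum>i<n. a i * cs i x w) \<Longrightarrow> \<forall>i<n. a i = 0"
    by blast
  show "n \<le> 0"
  proof (rule ccontr)
    assume "\<not> n \<le> 0"
    then have n: "0 < n" by auto
    obtain v0 where v0: "v0 \<in> etale_fibre \<V> x" using V(1) by (auto simp: etale_covering_def pts)
    let ?c = "cs 0 x (replicate (Suc (Suc q)) v0)"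
    have del: "take i (replicate (Suc m) v) @ drop (Suc i) (replicate (Suc m) v) = replicate m v"
      if "i < Suc m" for i m and v :: "nat \<times> 'k"
      using that by (simp add: replicate_add [symmetric] min_def less_Suc_eq_le del: replicate_Suc)
    have rep: "cech_diff c y (replicate (Suc m) v) = (if even m then c y (replicate m v) else 0)"
      for c :: "'x \<Rightarrow> (nat \<times> 'k) list \<Rightarrow> 'f" and y m v
    proof -
      have "cech_diff c y (replicate (Suc m) v) = (\<Sum>i<Suc m. (- 1) ^ i * c y (replicate m v))"
        unfolding cech_diff_def length_replicate by (intro sum.cong refl) (simp only: del lessThan_iff)
      also have "\<dots> = (\<Sum>i<Suc m. (- 1) ^ i) * c y (replicate m v)"
        by (rule sum_distrib_right [symmetric])
      finally show ?thesis unfolding sum_alternating by simp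
    qed
    have odd: "?c = 0" if "even q"
    proof -
      have "(x, replicate (Suc (Suc (Suc q))) v0) \<in> simplices X \<V> (Suc (Suc q))"
        using v0 by (auto simp: simplices_def pts)
      then have "cech_diff (cs 0) x (replicate (Suc (Suc (Suc q))) v0) = 0"
        using V(2)[OF n] by (auto simp: cocycle_def)
      then show ?thesis using that unfolding rep by simp
    qed
    let ?a = "\<lambda>i::nat. if i = 0 then 1 else (0::'f)"
    have sum: "(\<Sum>i<n. ?a i * h i) = h 0" for h
    proof -
      have "(\<Sum>i<n. ?a i * h i) = (\<Sum>i\<in>{0}. ?a i * h i)"
        by (rule sum.mono_neutral_right) (use n in auto)
      then show ?thesis by simp
    qed
    have "vanishes_in_limit X \<V> (Suc q) (\<lambda>x w. \<Sum>i<n. ?a i * cs i x w)"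
      unfolding vanishes_in_limit_def
    proof (intro exI[of _ "trivial_covering x"] exI[of _ "\<lambda>x v. v0"] conjI etale_trivial_covering)
      show "refinement X (trivial_covering x) \<V> (\<lambda>x v. v0)"
        by (rule refinement_point[OF _ const_rel_poly[of "snd v0"]]) (auto simp: v0)
      show "coboundary X (trivial_covering x) (Suc q) (\<lambda>x w. \<Sum>i<n. ?a i * cs i x (map (\<lambda>v. v0) w))"
        unfolding coboundary_def sum nat.case
      \<comment> \<open>The differential of the constant \<open>?c\<close> is an alternating sum of
        q + 2 equal terms. It equals \<open>?c\<close> for odd q and 0 for even q; in the even case
        the cocycle condition itself gives that \<open>?c\<close> is 0.\<close>
      proof (intro exI[of _ "\<lambda>_ _. ?c"] conjI cochain_const, clarify)
        fix y w assume "(y, w) \<in> simplices X (trivial_covering x) (Suc q)"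
        then have w: "y = x" "length w = Suc (Suc q)" "set w \<subseteq> {(0, 0)}"
          by (auto simp: simplices_def pts trivial_covering_fibre)
        have "w = replicate (Suc (Suc q)) (0, 0)"
          using w(2,3) by (intro replicate_eqI) auto
        then show "cs 0 y (map (\<lambda>v. v0) w) = cech_diff (\<lambda>_ _. ?c) y w"
          using odd unfolding w(1) by (simp only: rep map_replicate even_Suc) simp
      qed
    qed
    from V(3)[OF this] n show False by auto
  qed
qed

lemma euler_characteristic_point: "euler_characteristic (F :: 'f::{field,finite} itself) X = 1"
proof -
  have "etale_betti F X p \<noteq> 0 \<longleftrightarrow> p = 0" for p
    by (cases p) (simp_all add: etale_betti_point_0 etale_betti_point_Suc)
  then show ?thesis by (simp add: euler_characteristic_def etale_betti_point_0)
qed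

end

section \<open>Counting a basis through coordinates\<close>

text \<open>Unique solvability says that the d vectors form a basis of K^n. Comparing with the
  standard basis in both directions gives the two inequalities.\<close>

lemma coordinate_count:
  fixes v :: "nat \<Rightarrow> nat \<Rightarrow> 'k::field"
  assumes "\<And>y. \<exists>!c. c \<in> {..<d} \<rightarrow>\<^sub>E UNIV \<and> (\<forall>l<n. y l = (\<Sum>k<d. c k * v k l))"
  shows "d = n"
proof -
  interpret vs: vector_space "\<lambda>(c::'k) (f :: nat \<Rightarrow> 'k). (\<lambda>l. c * f l)"
    by unfold_locales (auto simp: fun_eq_iff algebra_simps)
  \<comment> \<open>K^n is realised as the sequences that vanish from n on; cutting off v puts the
    vectors into it.\<close>
  define v' where "v' k = (\<lambda>l. if l < n then v k l else 0)" for k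
  define st where "st l = (\<lambda>m. if m = l then 1 else (0::'k))" for l :: nat
  have ev: "(\<Sum>x\<in>T. g x) l = (\<Sum>x\<in>T. g x l)" for T :: "nat set" and g :: "nat \<Rightarrow> nat \<Rightarrow> 'k" and l
    by (induction T rule: infinite_finite_induct) auto
  have st_inj: "inj st" by (rule injI) (metis st_def zero_neq_one)
  have in_st: "f \<in> vs.span (st ` {..<n})" if "\<And>l. n \<le> l \<Longrightarrow> f l = 0" for f
  proof -
    have "f = (\<Sum>l<n. (\<lambda>m. f l * st l m))"
    proof
      fix m
      have "(\<Sum>l<n. (\<lambda>m. f l * st l m)) m = (\<Sum>l<n. if l = m then f m else 0)"
        unfolding ev by (intro sum.cong refl) (auto simp: st_def)
      then show "f m = (\<Sum>l<n. (\<lambda>m. f l * st l m)) m" using that[of m] by (auto simp: not_less)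
    qed
    moreover have "(\<Sum>l<n. (\<lambda>m. f l * st l m)) \<in> vs.span (st ` {..<n})"
      by (intro vs.span_sum vs.span_scale vs.span_base) auto
    ultimately show ?thesis by metis
  qed
  have zero: "c k = 0" if "k < d" "(\<Sum>k<d. (\<lambda>l. c k * v' k l)) = 0" for c k
  proof -
    have "(\<Sum>k<d. c k * v k l) = 0" if "l < n" for l
    proof -
      have "(\<Sum>k<d. (\<lambda>l. c k * v' k l)) l = 0" using \<open>(\<Sum>k<d. (\<lambda>l. c k * v' k l)) = 0\<close> by simp
      then show ?thesis unfolding ev using that by (simp add: v'_def)
    qed
    then have "restrict c {..<d} \<in> {..<d} \<rightarrow>\<^sub>E UNIV \<and> (\<forall>l<n. 0 = (\<Sum>k<d. restrict c {..<d} k * v k l))"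
      by simp
    moreover have "restrict (\<lambda>_. 0) {..<d} \<in> {..<d} \<rightarrow>\<^sub>E UNIV \<and>
        (\<forall>l<n. 0 = (\<Sum>k<d. restrict (\<lambda>_. 0 :: 'k) {..<d} k * v k l))"
      by simp
    ultimately have "restrict c {..<d} = restrict (\<lambda>_. 0) {..<d}"
      using assms[of "\<lambda>_. 0"] by blast
    then show ?thesis using that(1) by (metis lessThan_iff restrict_apply')
  qed
  have v_inj: "inj_on v' {..<d}"
  proof (rule inj_onI, rule ccontr)
    fix k m assume km: "k \<in> {..<d}" "m \<in> {..<d}" "v' k = v' m" "k \<noteq> m"
    let ?c = "\<lambda>i. if i = k then 1 else if i = m then - 1 else (0 :: 'k)"
    have "(\<Sum>i<d. (\<lambda>l. ?c i * v' i l)) = 0"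
    proof
      fix l
      have "(\<Sum>i<d. (\<lambda>l. ?c i * v' i l)) l = (\<Sum>i\<in>{k, m}. ?c i * v' i l)"
        unfolding ev by (rule sum.mono_neutral_right) (use km in auto)
      also have "\<dots> = 0" using km by simp
      finally show "(\<Sum>i<d. (\<lambda>l. ?c i * v' i l)) l = 0 l" by simp
    qed
    from zero[OF _ this, of k] km show False by simp
  qed
  have "vs.independent (v' ` {..<d})"
  proof (rule vs.independent_if_scalars_zero)
    fix f x assume f: "(\<Sum>x\<in>v' ` {..<d}. (\<lambda>l. f x * x l)) = 0" and x: "x \<in> v' ` {..<d}"
    have "(\<Sum>k<d. (\<lambda>l. f (v' k) * v' k l)) = 0"
      using f unfolding sum.reindex[OF v_inj] comp_def .
    then show "f x = 0" using zero[of _ "\<lambda>k. f (v' k)"] x by auto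
  qed simp
  moreover have "v' ` {..<d} \<subseteq> vs.span (st ` {..<n})"
    using in_st by (auto simp: v'_def)
  ultimately have "card (v' ` {..<d}) \<le> card (st ` {..<n})"
    using vs.independent_span_bound[of "st ` {..<n}"] by simp
  then have 1: "d \<le> n" using card_image[OF v_inj] card_image[OF inj_on_subset[OF st_inj, of "{..<n}"]] by simp
  have "vs.independent (st ` {..<n})"
  proof (rule vs.independent_if_scalars_zero)
    fix f x assume f: "(\<Sum>x\<in>st ` {..<n}. (\<lambda>l. f x * x l)) = 0" and x: "x \<in> st ` {..<n}"
    obtain m where m: "m < n" "x = st m" using x by auto
    have "(\<Sum>l<n. (\<lambda>j. f (st l) * st l j)) = 0"
      using f unfolding sum.reindex[OF inj_on_subset[OF st_inj subset_UNIV]] comp_def .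
    then have "(\<Sum>l<n. (\<lambda>j. f (st l) * st l j)) m = 0" by simp
    then have "(\<Sum>l<n. if l = m then f (st m) else 0) = 0"
      unfolding ev by (rule trans[rotated]) (intro sum.cong refl, auto simp: st_def)
    then show "f x = 0" using m by simp
  qed simp
  moreover have "st ` {..<n} \<subseteq> vs.span (v' ` {..<d})"
  proof
    fix x assume "x \<in> st ` {..<n}"
    then obtain m where m: "m < n" "x = st m" by auto
    obtain c where c: "\<And>l. l < n \<Longrightarrow> st m l = (\<Sum>k<d. c k * v k l)" using assms[of "st m"] by blast
    have "x = (\<Sum>k<d. (\<lambda>l. c k * v' k l))"
    proof
      fix l
      show "x l = (\<Sum>k<d. (\<lambda>l. c k * v' k l)) l"
        unfolding ev using c[of l] m by (cases "l < n") (auto simp: v'_def st_def)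
    qed
    moreover have "(\<Sum>k<d. (\<lambda>l. c k * v' k l)) \<in> vs.span (v' ` {..<d})"
      by (intro vs.span_sum vs.span_scale vs.span_base) auto
    ultimately show "x \<in> vs.span (v' ` {..<d})" by metis
  qed
  ultimately have "card (st ` {..<n}) \<le> card (v' ` {..<d})"
    using vs.independent_span_bound[of "v' ` {..<d}"] by simp
  then have "n \<le> d" using card_image[OF v_inj] card_image[OF inj_on_subset[OF st_inj, of "{..<n}"]] by simp
  with 1 show ?thesis by simp
qed

section \<open>Quiver Grassmannians\<close>

text \<open>Pairs \<open>(j, t)\<close> for which \<open>ann i j t\<close> is a right ideal containing \<open>ann i J T\<close>.\<close>

definition ideal_pairs :: "nat \<Rightarrow> (nat \<times> nat) set" where
  "ideal_pairs J = (if J = 4 then {(0,0), (1,0), (1,1), (2,0), (2,1), (2,2), (3,1), (3,2), (4,2)}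
     else {(0,0), (1,0), (2,0)})"

lemma ann_iff: "b \<in> ann i J T \<longleftrightarrow> (0 < J \<longrightarrow> lp0 b i = 0) \<and> (1 < J \<longrightarrow> lp1 b i = 0) \<and>
    (2 < J \<longrightarrow> lp2 b i = 0) \<and> (3 < J \<longrightarrow> lp3 b i = 0) \<and> (0 < T \<longrightarrow> ar0 b i = 0) \<and> (1 < T \<longrightarrow> ar1 b i = 0)"
    (is "_ \<longleftrightarrow> ?r")
proof
  assume "b \<in> ann i J T"
  then have l: "k < J \<Longrightarrow> lpc b i k = 0" and a: "k < T \<Longrightarrow> arc b i k = 0" for k
    by (simp_all add: ann_def)
  show ?r
    using l[of 0] l[of 1] l[of 2] l[of 3] a[of 0] a[of 1] by (simp add: lpc_def arc_def)
next
  assume ?r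
  then show "b \<in> ann i J T" by (auto simp: ann_def lpc_def arc_def)
qed

lemma ann_ideal_pairs:
  assumes "(j, t) \<in> ideal_pairs J" "x \<in> ann i j t"
  shows "x * c \<in> ann i j t"
proof -
  consider "j = 0" "t = 0" | "j = 1" "t = 0" | "j = 1" "t = 1" | "j = 2" "t = 0" | "j = 2" "t = 1"
    | "j = 2" "t = 2" | "j = 3" "t = 1" | "j = 3" "t = 2" | "j = 4" "t = 2"
    using assms(1) by (auto simp: ideal_pairs_def split: if_splits)
  then show ?thesis using assms(2) by cases (simp_all add: ann_iff)
qed

lemma ideal_pairs_le:
  assumes "proj_or_loop J T" "(j, t) \<in> ideal_pairs J"
  shows "j \<le> J" "t \<le> T"
  using assms by (auto simp: ideal_pairs_def proj_or_loop_def)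

lemma lpc_ge_4: "4 \<le> k \<Longrightarrow> lpc b i k = 0"
  by (simp add: lpc_def)

lemma arc_ge_2: "2 \<le> k \<Longrightarrow> arc b i k = 0"
  by (simp add: arc_def)

definition jac_of :: "vert \<Rightarrow> (nat \<Rightarrow> 'k) \<Rightarrow> (nat \<Rightarrow> 'k::field) \<Rightarrow> 'k jac" where
  "jac_of i g h = Jac (\<lambda>v. if v = i then g 0 else 0) (\<lambda>v. if v = i then g 1 else 0)
     (\<lambda>v. if v = i then g 2 else 0) (\<lambda>v. if v = i then g 3 else 0)
     (\<lambda>v. if v = i then h 0 else 0) (\<lambda>v. if v = i then h 1 else 0)"

lemma lpc_jac_of: "lpc (jac_of i g h) i k = (if k < 4 then g k else 0)"
  by (auto simp: lpc_def jac_of_def less_Suc_eq numeral_eq_Suc)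

lemma arc_jac_of: "arc (jac_of i g h) i k = (if k < 2 then h k else 0)"
  by (auto simp: arc_def jac_of_def less_Suc_eq numeral_eq_Suc)

lemma lpc_mult_ee: "lpc (x * ee i) i k = lpc x i k" "arc (x * ee i) i k = 0"
  "lpc (x * ee (oth i)) i k = 0" "arc (x * ee (oth i)) i k = arc x i k"
  by (simp_all add: lpc_def arc_def)

text \<open>In \<open>e\<^sub>i jac e\<^sub>i = K[z] / z\<^sup>4\<close> every element is a unit times a power of \<open>z\<close>.\<close>

lemma lpc_divides:
  assumes b: "\<And>k. k < j \<Longrightarrow> lpc b i k = 0" "lpc b i j \<noteq> 0"
    and c: "\<And>k. k < j \<Longrightarrow> lpc c i k = 0"
  obtains y where "\<And>k. lpc (b * ee i * y) i k = lpc c i k" "\<And>k. arc (b * ee i * y) i k = 0"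
proof -
  have j: "j < 4" using b(2) lpc_ge_4[of j b i] by force
  define y0 where "y0 = lpc c i j / lpc b i j"
  define y1 where "y1 = (lpc c i (j+1) - lpc b i (j+1) * y0) / lpc b i j"
  define y2 where "y2 = (lpc c i (j+2) - lpc b i (j+2) * y0 - lpc b i (j+1) * y1) / lpc b i j"
  define y3 where "y3 = (lpc c i (j+3) - lpc b i (j+3) * y0 - lpc b i (j+2) * y1 - lpc b i (j+1) * y2) / lpc b i j"
  have y: "lpc b i j * y0 = lpc c i j"
    "lpc b i j * y1 + lpc b i (j+1) * y0 = lpc c i (j+1)"
    "lpc b i j * y2 + lpc b i (j+1) * y1 + lpc b i (j+2) * y0 = lpc c i (j+2)"
    "lpc b i j * y3 + lpc b i (j+1) * y2 + lpc b i (j+2) * y1 + lpc b i (j+3) * y0 = lpc c i (j+3)"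
    using b(2) by (simp_all add: y0_def y1_def y2_def y3_def)
  let ?y = "jac_of i ((!) [y0, y1, y2, y3]) (\<lambda>_. 0)"
  consider "j = 0" | "j = 1" | "j = 2" | "j = 3" using j by linarith
  then have "lp0 (b * ee i * ?y) i = lp0 c i \<and> lp1 (b * ee i * ?y) i = lp1 c i \<and>
      lp2 (b * ee i * ?y) i = lp2 c i \<and> lp3 (b * ee i * ?y) i = lp3 c i"
  proof cases
    case 1
    then show ?thesis using y by (simp add: jac_of_def lpc_def algebra_simps)
  next
    case 2
    then show ?thesis using y b(1)[of 0] c[of 0] by (simp add: jac_of_def lpc_def algebra_simps)
  next
    case 3
    then show ?thesis using y b(1)[of 0] b(1)[of 1] c[of 0] c[of 1]
      by (simp add: jac_of_def lpc_def algebra_simps)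
  next
    case 4
    then show ?thesis using y b(1)[of 0] b(1)[of 1] b(1)[of 2] c[of 0] c[of 1] c[of 2]
      by (simp add: jac_of_def lpc_def algebra_simps)
  qed
  then have "lpc (b * ee i * ?y) i k = lpc c i k" for k by (simp add: lpc_def)
  moreover have "arc (b * ee i * ?y) i k = 0" for k by (simp add: arc_def jac_of_def)
  ultimately show thesis using that by blast
qed

text \<open>The same division in e_i \<open>jac\<close> e_j with j = \<open>oth i\<close>, which is
  free of rank one over K[z]/z^2.\<close>

lemma arc_divides:
  assumes b: "\<And>k. k < t \<Longrightarrow> arc b i k = 0" "arc b i t \<noteq> 0"
    and c: "\<And>k. k < t \<Longrightarrow> arc c i k = 0"
  obtains y where "\<And>k. arc (b * ee (oth i) * y) i k = arc c i k" "\<And>k. lpc (b * ee (oth i) * y) i k = 0"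
proof -
  have t: "t < 2" using b(2) arc_ge_2[of t b i] by force
  define y0 where "y0 = arc c i t / arc b i t"
  define y1 where "y1 = (arc c i (t+1) - arc b i (t+1) * y0) / arc b i t"
  have y: "arc b i t * y0 = arc c i t"
    "arc b i t * y1 + arc b i (t+1) * y0 = arc c i (t+1)"
    using b(2) by (simp_all add: y0_def y1_def)
  let ?y = "jac_of (oth i) ((!) [y0, y1, 0, 0]) (\<lambda>_. 0)"
  consider "t = 0" | "t = 1" using t by linarith
  then have "ar0 (b * ee (oth i) * ?y) i = ar0 c i \<and> ar1 (b * ee (oth i) * ?y) i = ar1 c i"
  proof cases
    case 1
    then show ?thesis using y by (simp add: jac_of_def arc_def algebra_simps)
  next
    case 2
    then show ?thesis using y b(1)[of 0] c[of 0] by (simp add: jac_of_def arc_def algebra_simps)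
  qed
  then have "arc (b * ee (oth i) * ?y) i k = arc c i k" for k by (simp add: arc_def)
  moreover have "lpc (b * ee (oth i) * ?y) i k = 0" for k by (simp add: lpc_def jac_of_def)
  ultimately show thesis using that by blast
qed

text \<open>U is the direct sum of its components at i and \<open>oth i\<close>. Up to coordinates
  that \<open>ann i J T\<close> already contains, each lies in a uniserial K[z]-module, so it is
  determined by the least order of z that occurs. Multiplication by the two arrows restricts the
  pair of orders.\<close>

lemma right_ideal_ann:
  assumes U: "0 \<in> U" "\<And>x y. x \<in> U \<Longrightarrow> y \<in> U \<Longrightarrow> x + y \<in> U" "\<And>x c. x \<in> U \<Longrightarrow> x * c \<in> U"
    and ann: "ann i J T \<subseteq> U" and JT: "proj_or_loop J T" and two: "(2::'k::field) \<noteq> 0"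
  obtains j t where "(j, t) \<in> ideal_pairs J" "U = (ann i j t :: 'k jac set)"
proof -
  have kap: "(kap i :: 'k) \<noteq> 0" using two by (cases i) auto
  have ann_lpc: "x \<in> U" if "\<And>k. lpc x i k = 0" "\<And>k. arc x i k = 0" for x
    using ann that by (auto simp: ann_def)
  have cong: "y \<in> U" if "x \<in> U" "\<And>k. lpc x i k = lpc y i k" "\<And>k. arc x i k = arc y i k" for x y
  proof -
    have "x + (y - x) \<in> U" by (intro U(2) that(1) ann_lpc) (simp_all add: lpc_arc_linear that(2,3))
    then show ?thesis by simp
  qed
  \<comment> \<open>The least exponent of z at i in U; the alternative 4 stands for a zero
    component.\<close>
  define j where "j = (LEAST k. 4 \<le> k \<or> (\<exists>b\<in>U. lpc b i k \<noteq> 0))"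
  have j1: "4 \<le> j \<or> (\<exists>b\<in>U. lpc b i j \<noteq> 0)"
    unfolding j_def by (rule LeastI[of _ 4]) simp
  have j2: "lpc b i k = 0" if "k < j" "b \<in> U" for k b
    using not_less_Least[OF that(1)[unfolded j_def]] that(2) by blast
  have j3: "j \<le> 4"
    unfolding j_def by (rule Least_le) simp
  define t where "t = (LEAST k. 2 \<le> k \<or> (\<exists>b\<in>U. arc b i k \<noteq> 0))"
  have t1: "2 \<le> t \<or> (\<exists>b\<in>U. arc b i t \<noteq> 0)"
    unfolding t_def by (rule LeastI[of _ 2]) simp
  have t2: "arc b i k = 0" if "k < t" "b \<in> U" for k b
    using not_less_Least[OF that(1)[unfolded t_def]] that(2) by blast
  have t3: "t \<le> 2"
    unfolding t_def by (rule Least_le) simp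
  have lp_in: "c * ee i \<in> U" if c: "\<And>k. k < j \<Longrightarrow> lpc c i k = 0" for c
  proof (cases "\<exists>b\<in>U. lpc b i j \<noteq> 0")
    case True
    then obtain b where b: "b \<in> U" "lpc b i j \<noteq> 0" by blast
    obtain y where y: "\<And>k. lpc (b * ee i * y) i k = lpc c i k" "\<And>k. arc (b * ee i * y) i k = 0"
      using lpc_divides[of j b i c] b j2 c by blast
    show ?thesis by (rule cong[of "b * ee i * y"]) (simp_all add: U(3) b(1) y lpc_mult_ee)
  next
    case False
    then have "4 \<le> j" using j1 by blast
    then have "lpc c i k = 0" for k using c[of k] lpc_ge_4[of k c i] by force
    then show ?thesis by (intro ann_lpc) (simp_all add: lpc_mult_ee)
  qed
  have ar_in: "c * ee (oth i) \<in> U" if c: "\<And>k. k < t \<Longrightarrow> arc c i k = 0" for c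
  proof (cases "\<exists>b\<in>U. arc b i t \<noteq> 0")
    case True
    then obtain b where b: "b \<in> U" "arc b i t \<noteq> 0" by blast
    obtain y where y: "\<And>k. arc (b * ee (oth i) * y) i k = arc c i k" "\<And>k. lpc (b * ee (oth i) * y) i k = 0"
      using arc_divides[of t b i c] b t2 c by blast
    show ?thesis by (rule cong[of "b * ee (oth i) * y"]) (simp_all add: U(3) b(1) y lpc_mult_ee)
  next
    case False
    then have "2 \<le> t" using t1 by blast
    then have "arc c i k = 0" for k using c[of k] arc_ge_2[of k c i] by force
    then show ?thesis by (intro ann_lpc) (simp_all add: lpc_mult_ee)
  qed
  have Ueq: "U = ann i j t"
  proof
    show "U \<subseteq> ann i j t" using j2 t2 by (auto simp: ann_def)
    show "ann i j t \<subseteq> U"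
    proof
      fix x :: "'k jac" assume "x \<in> ann i j t"
      then have "x * ee i + x * ee (oth i) \<in> U" by (intro U(2) lp_in ar_in) (auto simp: ann_def)
      then show "x \<in> U" by (simp add: distrib_left [symmetric] ee_sum)
    qed
  qed
  have mem: "x \<in> U \<longleftrightarrow> (\<forall>k<j. lpc x i k = 0) \<and> (\<forall>k<t. arc x i k = 0)" for x
    unfolding Ueq by (simp add: ann_def)
  \<comment> \<open>Right multiplication by a_i sends z^j e_i to z^j a_i, which bounds t by j. The
    returning arrow sends z^t a_i to a multiple of z^(t+2) e_i, which bounds j by t + 2. The nine
    pairs are the solutions of t \<le> j \<le> t + 2 with t \<le> 2.\<close>
  have c1: "t = 0" if "j = 0"
  proof (rule ccontr)
    assume t0: "t \<noteq> 0"
    have "ee i \<in> U" unfolding mem that by (simp add: arc_def)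
    then have "ee i * av i \<in> U" by (rule U(3))
    from t2[OF _ this, of 0] t0 show False by (simp add: arc_def)
  qed
  have c2: "t \<le> 1" if "j \<le> 1"
  proof (rule ccontr)
    assume t0: "\<not> t \<le> 1"
    have "zz * ee i \<in> U" unfolding mem using that by (auto simp: arc_def lpc_def)
    then have "zz * ee i * av i \<in> U" by (rule U(3))
    from t2[OF _ this, of 1] t0 show False by (simp add: arc_def)
  qed
  have c3: "j \<le> 2" if "t = 0"
  proof (rule ccontr)
    assume j0: "\<not> j \<le> 2"
    have "av i \<in> U" unfolding mem that by (simp add: lpc_def)
    then have "av i * av (oth i) \<in> U" by (rule U(3))
    from j2[OF _ this, of 2] j0 show False using kap by (simp add: lpc_def)
  qed
  have c4: "j \<le> 3" if "t \<le> 1"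
  proof (rule ccontr)
    assume j0: "\<not> j \<le> 3"
    have "zz * av i \<in> U" unfolding mem using that by (auto simp: lpc_def arc_def)
    then have "zz * av i * av (oth i) \<in> U" by (rule U(3))
    from j2[OF _ this, of 3] j0 show False using kap by (simp add: lpc_def)
  qed
  have "(j, t) \<in> ideal_pairs J"
  proof (cases "J = 4")
    case True
    have "j = 0 \<or> j = 1 \<or> j = 2 \<or> j = 3 \<or> j = 4" "t = 0 \<or> t = 1 \<or> t = 2" using j3 t3 by linarith+
    then show ?thesis using True c1 c2 c3 c4 by (auto simp: ideal_pairs_def)
  next
    case False
    then have JT2: "J = 2" "T = 0" using JT by (auto simp: proj_or_loop_def)
    have "zz * zz * ee i \<in> U" using ann unfolding JT2 by (auto simp: ann_2_0)
    from j2[OF _ this, of 2] have "j \<le> 2" by (intro leI notI) (simp add: lpc_def)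
    moreover have "av i \<in> U" using ann unfolding JT2 by (auto simp: ann_2_0)
    from t2[OF _ this, of 0] have "t = 0" by (intro iffD1[OF not_gr_zero] notI) (simp add: arc_def)
    moreover have "j = 0 \<or> j = 1 \<or> j = 2" using \<open>j \<le> 2\<close> by linarith
    ultimately show ?thesis using False by (auto simp: ideal_pairs_def)
  qed
  then show thesis using Ueq by (rule that)
qed

context jac_module
begin

text \<open>The first n coordinates identify V with K^n, which transports the question to
  \<open>coordinate_count\<close>.\<close>

lemma lin_basis_coordinates:
  fixes crd :: "'k jac \<Rightarrow> nat \<Rightarrow> 'k"
  assumes w: "w \<in> carrier M" and V: "V = act M w ` X"
    and X: "0 \<in> X" "\<And>x y. x \<in> X \<Longrightarrow> y \<in> X \<Longrightarrow> x + y \<in> X" "\<And>x c. x \<in> X \<Longrightarrow> x * sc c \<in> X"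
    and crd: "\<And>x y l. crd (x + y) l = crd x l + crd y l" "\<And>x c l. crd (x * sc c) l = c * crd x l"
    and inj: "\<And>x y. x \<in> X \<Longrightarrow> y \<in> X \<Longrightarrow> act M w x = act M w y \<longleftrightarrow> (\<forall>l<n. crd x l = crd y l)"
    and surj: "\<And>y. \<exists>x\<in>X. \<forall>l<n. crd x l = y l"
  shows "(\<exists>s. lin_basis A M V d s) \<longleftrightarrow> d = n"
proof -
  have X_sum: "(\<Sum>k\<in>K. b k * sc (c k)) \<in> X" if "\<And>k. k \<in> K \<Longrightarrow> b k \<in> X" for K b c
    using that by (induction K rule: infinite_finite_induct) (auto simp: X)
  have crd_0: "crd 0 l = 0" for l using crd(2)[of 0 0 l] by (simp add: sc_simps)
  have crd_sum: "crd (\<Sum>k\<in>K. b k * sc (c k)) l = (\<Sum>k\<in>K. c k * crd (b k) l)" for K b c l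
    by (induction K rule: infinite_finite_induct) (auto simp: crd crd_0)
  have comb: "(\<Oplus>\<^bsub>M\<^esub>k\<in>{..<d}. scal A (c k) \<odot>\<^bsub>M\<^esub> s k) = act M w (\<Sum>k<d. b k * sc (c k))"
    if "\<And>k. k < d \<Longrightarrow> s k = act M w (b k)" for s b c and d :: nat
  proof -
    have "act M w (\<Sum>k<d. b k * sc (c k)) = (\<Oplus>\<^bsub>M\<^esub>k\<in>{..<d}. act M w (b k * sc (c k)))"
      by (rule act_sum) (simp_all add: w)
    also have "\<dots> = (\<Oplus>\<^bsub>M\<^esub>k\<in>{..<d}. scal A (c k) \<odot>\<^bsub>M\<^esub> s k)"
    proof (rule M.finsum_cong')
      fix k assume "k \<in> {..<d}"
      then have "s k = act M w (b k)" using that by simp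
      then show "act M w (b k * sc (c k)) = scal A (c k) \<odot>\<^bsub>M\<^esub> s k"
        using act_mult[OF w, of "b k" "sc (c k)"] by (simp add: scal_A act_def)
    next
      show "(\<lambda>k. scal A (c k) \<odot>\<^bsub>M\<^esub> s k) \<in> {..<d} \<rightarrow> carrier M"
        using that act_closed[OF act_closed[OF w]] by (auto simp: scal_A act_def [symmetric])
    qed simp
    finally show ?thesis by simp
  qed
  have key: "lin_basis A M V d s \<longleftrightarrow> (\<forall>y. \<exists>!c. c \<in> {..<d} \<rightarrow>\<^sub>E UNIV \<and> (\<forall>l<n. y l = (\<Sum>k<d. c k * crd (b k) l)))"
    if b: "\<And>k. k < d \<Longrightarrow> b k \<in> X" "\<And>k. k < d \<Longrightarrow> s k = act M w (b k)" for s b and d :: nat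
  proof -
    have eq: "act M w x = (\<Oplus>\<^bsub>M\<^esub>k\<in>{..<d}. scal A (c k) \<odot>\<^bsub>M\<^esub> s k) \<longleftrightarrow>
        (\<forall>l<n. crd x l = (\<Sum>k<d. c k * crd (b k) l))" if x: "x \<in> X" for x c
    proof -
      have "(\<Sum>k<d. b k * sc (c k)) \<in> X" by (rule X_sum) (simp add: b(1))
      note i = inj[OF x this]
      have "(\<Oplus>\<^bsub>M\<^esub>k\<in>{..<d}. scal A (c k) \<odot>\<^bsub>M\<^esub> s k) = act M w (\<Sum>k<d. b k * sc (c k))"
        by (rule comb) (rule b(2))
      with i show ?thesis by (simp only: crd_sum)
    qed
    have "lin_basis A M V d s \<longleftrightarrow> (\<forall>x\<in>X. \<exists>!c. c \<in> {..<d} \<rightarrow>\<^sub>E UNIV \<and> (\<forall>l<n. crd x l = (\<Sum>k<d. c k * crd (b k) l)))"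
      unfolding lin_basis_def V using b by (auto simp: eq)
    also have "\<dots> \<longleftrightarrow> (\<forall>y. \<exists>!c. c \<in> {..<d} \<rightarrow>\<^sub>E UNIV \<and> (\<forall>l<n. y l = (\<Sum>k<d. c k * crd (b k) l)))"
    proof
      assume l: "\<forall>x\<in>X. \<exists>!c. c \<in> {..<d} \<rightarrow>\<^sub>E UNIV \<and> (\<forall>l<n. crd x l = (\<Sum>k<d. c k * crd (b k) l))"
      show "\<forall>y. \<exists>!c. c \<in> {..<d} \<rightarrow>\<^sub>E UNIV \<and> (\<forall>l<n. y l = (\<Sum>k<d. c k * crd (b k) l))"
      proof
        fix y :: "nat \<Rightarrow> 'k"
        obtain x where x: "x \<in> X" "\<And>l. l < n \<Longrightarrow> crd x l = y l" using surj by blast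
        have eq: "(\<forall>l<n. crd x l = f l) \<longleftrightarrow> (\<forall>l<n. y l = f l)" for f
          using x(2) by simp
        show "\<exists>!c. c \<in> {..<d} \<rightarrow>\<^sub>E UNIV \<and> (\<forall>l<n. y l = (\<Sum>k<d. c k * crd (b k) l))"
          using bspec[OF l x(1)] unfolding eq .
      qed
    qed (intro ballI, erule_tac x = "crd x" in allE)
    finally show ?thesis .
  qed
  show ?thesis
  proof
    assume "\<exists>s. lin_basis A M V d s"
    then obtain s where s: "lin_basis A M V d s" by blast
    then have "\<forall>k<d. \<exists>b\<in>X. s k = act M w b" unfolding lin_basis_def V by blast
    then obtain b where b: "\<And>k. k < d \<Longrightarrow> b k \<in> X" "\<And>k. k < d \<Longrightarrow> s k = act M w (b k)" by metis
    show "d = n"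
      using key[OF b] s by (intro coordinate_count[of d n "\<lambda>k. crd (b k)"]) simp
  next
    assume d: "d = n"
    have "\<forall>k. \<exists>x\<in>X. \<forall>l<n. crd x l = (if l = k then 1 else 0)"
      using surj[of "\<lambda>l. if l = _ then 1 else 0"] by blast
    then obtain b where b: "\<And>k. b k \<in> X" "\<And>k l. l < n \<Longrightarrow> crd (b k) l = (if l = k then 1 else 0)" by metis
    have sum: "(\<Sum>k<d. c k * crd (b k) l) = c l" if "l < n" for c l
    proof -
      have "(\<Sum>k<d. c k * crd (b k) l) = (\<Sum>k<d. if k = l then c l else 0)"
        using b(2)[OF that] by (intro sum.cong refl) auto
      then show ?thesis using that d by simp
    qed
    have "lin_basis A M V d (\<lambda>k. act M w (b k))"
      unfolding key[OF b(1) refl]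
    proof (rule allI, rule ex1I)
      fix y :: "nat \<Rightarrow> 'k"
      show "restrict y {..<d} \<in> {..<d} \<rightarrow>\<^sub>E UNIV \<and>
          (\<forall>l<n. y l = (\<Sum>k<d. restrict y {..<d} k * crd (b k) l))"
      proof (intro conjI allI impI)
        fix l assume l: "l < n"
        show "y l = (\<Sum>k<d. restrict y {..<d} k * crd (b k) l)"
          unfolding sum[OF l] using l d by simp
      qed simp
    next
      fix y c assume c: "c \<in> {..<d} \<rightarrow>\<^sub>E UNIV \<and> (\<forall>l<n. y l = (\<Sum>k<d. c k * crd (b k) l))"
      show "c = restrict y {..<d}"
      proof
        fix k show "c k = restrict y {..<d} k"
          using c sum[of k c] d by (cases "k < d") (auto simp: PiE_def extensional_def)
      qed
    qed
    then show "\<exists>s. lin_basis A M V d s" by blast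
  qed
qed

end

text \<open>The dimension vector of the submodule given by the pair (j, t): the powers z^j, ...,
  z^(J-1) live at i, and the arrow coordinates from t to T - 1 at the other vertex.\<close>

definition dim_vec :: "vert \<Rightarrow> nat \<Rightarrow> nat \<Rightarrow> nat \<times> nat \<Rightarrow> vert \<Rightarrow> nat" where
  "dim_vec i J T = (\<lambda>(j, t) v. if v = i then J - j else T - t)"

lemma dim_vec_inj:
  assumes "proj_or_loop J T"
  shows "inj_on (dim_vec i J T) (ideal_pairs J)"
proof (rule inj_onI, clarify)
  fix j t j' t' assume p: "(j, t) \<in> ideal_pairs J" "(j', t') \<in> ideal_pairs J"
    and e: "dim_vec i J T (j, t) = dim_vec i J T (j', t')"
  have "J - j = J - j'" "T - t = T - t'"
    using fun_cong[OF e, of i] fun_cong[OF e, of "oth i"] by (auto simp: dim_vec_def)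
  then show "j = j' \<and> t = t'"
    using ideal_pairs_le[OF assms p(1)] ideal_pairs_le[OF assms p(2)] by auto
qed

lemma card_ideal_pairs: "card (ideal_pairs 4) = 9" "card (ideal_pairs 2) = 3" "finite (ideal_pairs J)"
  by (simp_all add: ideal_pairs_def)

lemma mult_sc_linear: "lpc (x * sc c) i k = c * lpc x i k" "arc (x * sc c) i k = c * arc x i k"
  by (simp_all only: sc_commute [symmetric] lpc_arc_linear)

lemma shift_zero_iff:
  assumes "\<And>k. k < j \<Longrightarrow> g k = h k"
  shows "(\<forall>k<J. g k = h k) \<longleftrightarrow> (\<forall>l<J - j. g (j + l) = h (j + l :: nat))"
proof
  assume r: "\<forall>l<J - j. g (j + l) = h (j + l)"
  show "\<forall>k<J. g k = h k"
  proof (intro allI impI)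
    fix k assume "k < J"
    then show "g k = h k" using assms[of k] r[THEN spec, of "k - j"] by (cases "k < j") auto
  qed
qed auto

context jac_algebra
begin

lemma cyclic_atD:
  assumes "cyclic_at M w i J T"
  shows "w \<in> carrier M" "carrier M = range (act M w)" "act M w b = \<zero>\<^bsub>M\<^esub> \<longleftrightarrow> b \<in> ann i J T"
  using assms unfolding cyclic_at_def by blast+

end

section \<open>Submodules of the cyclic modules and their dimension vectors\<close>

context jac_module
begin

lemma rsubmodule_ann:
  assumes cyc: "cyclic_at M w i J T" and jt: "(j, t) \<in> ideal_pairs J"
  shows "rsubmodule A (act M w ` ann i j t) M"
proof -
  have w: "w \<in> carrier M" by (rule cyclic_atD(1)[OF cyc])
  have "subgroup (act M w ` ann i j t) (add_monoid M)"
  proof (rule M.add.subgroupI)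
    show "act M w ` ann i j t \<subseteq> carrier M" using w by auto
    have "0 \<in> ann i j t" by (simp add: ann_iff)
    then show "act M w ` ann i j t \<noteq> {}" by blast
    fix x y assume "x \<in> act M w ` ann i j t" "y \<in> act M w ` ann i j t"
    then obtain b c where bc: "b \<in> ann i j t" "x = act M w b" "c \<in> ann i j t" "y = act M w c" by blast
    have "b + c \<in> ann i j t" "- b \<in> ann i j t" using bc by (simp_all add: ann_iff)
    moreover have "x \<oplus>\<^bsub>M\<^esub> y = act M w (b + c)" "\<ominus>\<^bsub>M\<^esub> x = act M w (- b)"
      using bc w by (simp_all add: act_plus act_uminus)
    ultimately show "x \<oplus>\<^bsub>M\<^esub> y \<in> act M w ` ann i j t" "\<ominus>\<^bsub>M\<^esub> x \<in> act M w ` ann i j t" by simp_all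
  qed
  moreover have "r \<odot>\<^bsub>M\<^esub> x \<in> act M w ` ann i j t" if r: "r \<in> carrier A" and x: "x \<in> act M w ` ann i j t" for r x
  proof -
    obtain c where c: "r = \<psi> c" using r by (auto simp: carrier_A)
    obtain b where b: "b \<in> ann i j t" "x = act M w b" using x by blast
    have "r \<odot>\<^bsub>M\<^esub> x = act M w (b * c)" using act_mult[OF w] by (simp add: b c act_def)
    then show ?thesis using ann_ideal_pairs[OF jt b(1)] by simp
  qed
  ultimately show ?thesis by (simp add: rsubmodule_def additive_subgroup.intro)
qed

text \<open>The preimage of N under b \<mapsto> w b is a right ideal containing the annihilator of
  w, so \<open>right_ideal_ann\<close> lists it.\<close>

lemma rsubmodule_cyclic:
  assumes cyc: "cyclic_at M w i J T" and JT: "proj_or_loop J T" and N: "rsubmodule A N M"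
  obtains j t where "(j, t) \<in> ideal_pairs J" "N = act M w ` ann i j t"
proof -
  have w: "w \<in> carrier M" "carrier M = range (act M w)" "\<And>b. act M w b = \<zero>\<^bsub>M\<^esub> \<longleftrightarrow> b \<in> ann i J T"
    by (rule cyclic_atD[OF cyc])+
  interpret N: additive_subgroup N M using N by (simp add: rsubmodule_def)
  let ?U = "{b. act M w b \<in> N}"
  obtain j t where jt: "(j, t) \<in> ideal_pairs J" "?U = (ann i j t :: 'k jac set)"
  proof (rule right_ideal_ann[OF _ _ _ _ JT two_nonzero])
    show "0 \<in> ?U" using w(1) N.zero_closed by simp
    show "x + y \<in> ?U" if "x \<in> ?U" "y \<in> ?U" for x y
      using that w(1) N.a_closed by (simp add: act_plus)
    show "x * c \<in> ?U" if "x \<in> ?U" for x c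
    proof -
      have "\<psi> c \<odot>\<^bsub>M\<^esub> act M w x \<in> N" using N that by (simp add: rsubmodule_def)
      then show ?thesis using act_mult[OF w(1), of x c] by (simp add: act_def)
    qed
    show "ann i J T \<subseteq> ?U"
    proof
      fix x :: "'k jac" assume "x \<in> ann i J T"
      then have "act M w x = \<zero>\<^bsub>M\<^esub>" using w(3) by blast
      then show "x \<in> ?U" using N.zero_closed by simp
    qed
  qed
  have "N = act M w ` ?U"
  proof
    show "N \<subseteq> act M w ` ?U"
    proof
      fix x assume x: "x \<in> N"
      then have "x \<in> range (act M w)" using N.a_subset unfolding w(2) [symmetric] by blast
      then show "x \<in> act M w ` ?U" using x by auto
    qed
  qed auto
  then show thesis using that jt by simp
qed

lemma frame_cyclic:
  assumes cyc: "cyclic_at M w i J T" and JT: "proj_or_loop J T" and jt: "(j, t) \<in> ideal_pairs J"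
  shows "(\<exists>s. frame A M e s (act M w ` ann i j t)) \<longleftrightarrow> e = dim_vec i J T (j, t)"
proof -
  let ?N = "act M w ` ann i j t"
  have w: "w \<in> carrier M" by (rule cyclic_atD(1)[OF cyc])
  note le = ideal_pairs_le[OF JT jt]
  have JT': "J \<le> 4" "T \<le> 2" using JT by (auto simp: proj_or_loop_def)
  have V: "vertex_space A M ?N v = act M w ` ((\<lambda>x. x * ee v) ` ann i j t)" for v
    unfolding vertex_space_def idem_A act_def [symmetric] image_image
    by (intro image_cong refl) (simp add: act_mult[OF w])
  have X: "0 \<in> (\<lambda>x. x * ee v) ` ann i j t"
    "x \<in> (\<lambda>x. x * ee v) ` ann i j t \<Longrightarrow> y \<in> (\<lambda>x. x * ee v) ` ann i j t \<Longrightarrow> x + y \<in> (\<lambda>x. x * ee v) ` ann i j t"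
    "x \<in> (\<lambda>x. x * ee v) ` ann i j t \<Longrightarrow> x * sc c \<in> (\<lambda>x. x * ee v) ` ann i j t"
    for v and x y :: "'k jac" and c
  proof -
    show "0 \<in> (\<lambda>x. x * ee v) ` ann i j t" by (rule image_eqI[of _ _ 0]) (simp_all add: ann_iff)
    show "x + y \<in> (\<lambda>x. x * ee v) ` ann i j t"
      if xy: "x \<in> (\<lambda>x. x * ee v) ` ann i j t" "y \<in> (\<lambda>x. x * ee v) ` ann i j t"
    proof -
      obtain x' y' where "x' \<in> ann i j t" "x = x' * ee v" "y' \<in> ann i j t" "y = y' * ee v" using xy by blast
      then show ?thesis by (intro image_eqI[of _ _ "x' + y'"]) (simp_all add: distrib_right ann_iff)
    qed
    show "x * sc c \<in> (\<lambda>x. x * ee v) ` ann i j t" if x: "x \<in> (\<lambda>x. x * ee v) ` ann i j t"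
    proof -
      obtain x' where "x' \<in> ann i j t" "x = x' * ee v" using x by blast
      then show ?thesis
        by (intro image_eqI[of _ _ "x' * sc c"]) (simp_all add: mult.assoc sc_commute[of c] ann_ideal_pairs[OF jt])
    qed
  qed
  have eq: "act M w x = act M w y \<longleftrightarrow> (\<forall>k<J. lpc x i k = lpc y i k) \<and> (\<forall>k<T. arc x i k = arc y i k)" for x y
    unfolding cyclic_at_eq_iff[OF cyc] by (simp add: ann_def lpc_arc_linear)
  \<comment> \<open>Coefficients below j vanish on the submodule and those from J on vanish in M, so
    the J - j coefficients from j on are coordinates.\<close>
  have dim_i: "(\<exists>s. lin_basis A M (vertex_space A M ?N i) d s) \<longleftrightarrow> d = J - j" for d
  proof (rule lin_basis_coordinates[OF w V X, where crd = "\<lambda>b l. lpc b i (j + l)"])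
    show "lpc (x + y) i (j + l) = lpc x i (j + l) + lpc y i (j + l)"
      "lpc (x * sc c) i (j + l) = c * lpc x i (j + l)" for x y l c
      by (simp_all add: lpc_arc_linear mult_sc_linear)
    show "(act M w x = act M w y) = (\<forall>l<J - j. lpc x i (j + l) = lpc y i (j + l))"
      if xy: "x \<in> (\<lambda>x. x * ee i) ` ann i j t" "y \<in> (\<lambda>x. x * ee i) ` ann i j t" for x y
    proof -
      have "arc x i k = 0" "arc y i k = 0" for k using xy by (auto simp: lpc_mult_ee)
      moreover have "lpc x i k = lpc y i k" if "k < j" for k
        using xy that by (auto simp: lpc_mult_ee ann_def)
      ultimately show ?thesis unfolding eq using shift_zero_iff[of j "lpc x i" "lpc y i" J] by simp
    qed
    show "\<exists>x\<in>(\<lambda>x. x * ee i) ` ann i j t. \<forall>l<J - j. lpc x i (j + l) = y l" for y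
    proof
      let ?x = "jac_of i (\<lambda>k. if j \<le> k then y (k - j) else 0) (\<lambda>_. 0)"
      show "?x * ee i \<in> (\<lambda>x. x * ee i) ` ann i j t"
        by (rule imageI) (auto simp: ann_def lpc_jac_of arc_jac_of)
      show "\<forall>l<J - j. lpc (?x * ee i) i (j + l) = y l"
        using JT'(1) by (auto simp: lpc_mult_ee lpc_jac_of)
    qed
  qed
  have dim_o: "(\<exists>s. lin_basis A M (vertex_space A M ?N (oth i)) d s) \<longleftrightarrow> d = T - t" for d
  proof (rule lin_basis_coordinates[OF w V X, where crd = "\<lambda>b l. arc b i (t + l)"])
    show "arc (x + y) i (t + l) = arc x i (t + l) + arc y i (t + l)"
      "arc (x * sc c) i (t + l) = c * arc x i (t + l)" for x y l c
      by (simp_all add: lpc_arc_linear mult_sc_linear)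
    show "(act M w x = act M w y) = (\<forall>l<T - t. arc x i (t + l) = arc y i (t + l))"
      if xy: "x \<in> (\<lambda>x. x * ee (oth i)) ` ann i j t" "y \<in> (\<lambda>x. x * ee (oth i)) ` ann i j t" for x y
    proof -
      have "lpc x i k = 0" "lpc y i k = 0" for k using xy by (auto simp: lpc_mult_ee)
      moreover have "arc x i k = arc y i k" if "k < t" for k
        using xy that by (auto simp: lpc_mult_ee ann_def)
      ultimately show ?thesis unfolding eq using shift_zero_iff[of t "arc x i" "arc y i" T] by simp
    qed
    show "\<exists>x\<in>(\<lambda>x. x * ee (oth i)) ` ann i j t. \<forall>l<T - t. arc x i (t + l) = y l" for y
    proof
      let ?x = "jac_of i (\<lambda>_. 0) (\<lambda>k. if t \<le> k then y (k - t) else 0)"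
      show "?x * ee (oth i) \<in> (\<lambda>x. x * ee (oth i)) ` ann i j t"
        by (rule imageI) (auto simp: ann_def lpc_jac_of arc_jac_of)
      show "\<forall>l<T - t. arc (?x * ee (oth i)) i (t + l) = y l"
        using JT'(2) by (auto simp: lpc_mult_ee arc_jac_of)
    qed
  qed
  have "(\<exists>s. frame A M e s ?N) \<longleftrightarrow> (\<forall>v. \<exists>s. lin_basis A M (vertex_space A M ?N v) (e v) s)"
    unfolding frame_def using rsubmodule_ann[OF cyc jt] by (simp add: choice_iff)
  also have "\<dots> \<longleftrightarrow> e i = J - j \<and> e (oth i) = T - t"
    unfolding all_vert[of _ i] dim_i dim_o ..
  also have "\<dots> \<longleftrightarrow> e = dim_vec i J T (j, t)"
    unfolding fun_eq_iff all_vert[of _ i] by (simp add: dim_vec_def)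
  finally show ?thesis .
qed

lemma points_cyclic:
  assumes cyc: "cyclic_at M w i J T" and JT: "proj_or_loop J T"
  shows "points (quiver_grassmannian A M e) =
    (\<lambda>(j, t). act M w ` ann i j t) ` {p \<in> ideal_pairs J. dim_vec i J T p = e}"
proof -
  have "(\<exists>s. frame A M e s N) \<longleftrightarrow> (\<exists>j t. (j, t) \<in> ideal_pairs J \<and> dim_vec i J T (j, t) = e \<and> N = act M w ` ann i j t)" for N
  proof
    assume "\<exists>s. frame A M e s N"
    then have "rsubmodule A N M" by (auto simp: frame_def)
    then obtain j t where jt: "(j, t) \<in> ideal_pairs J" "N = act M w ` ann i j t"
      using rsubmodule_cyclic[OF cyc JT] by blast
    then have "e = dim_vec i J T (j, t)"
      using \<open>\<exists>s. frame A M e s N\<close> frame_cyclic[OF cyc JT jt(1)] by simp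
    then show "\<exists>j t. (j, t) \<in> ideal_pairs J \<and> dim_vec i J T (j, t) = e \<and> N = act M w ` ann i j t"
      using jt by blast
  qed (use frame_cyclic[OF cyc JT] in auto)
  then show ?thesis
    by (auto simp: quiver_grassmannian_def Let_def)
qed

lemma CC_cyclic:
  assumes cyc: "cyclic_at M w i J T" and JT: "proj_or_loop J T"
  shows "CC F A M = Poly_Mapping.single (- g_vector A M) (int (card (ideal_pairs J)))"
proof -
  let ?G = "quiver_grassmannian A M" and ?d = "dim_vec i J T"
  have pt: "\<exists>N. points (?G (?d p)) = {N}" if "p \<in> ideal_pairs J" for p
  proof -
    have "{p' \<in> ideal_pairs J. ?d p' = ?d p} = {p}"
      using that dim_vec_inj[OF JT, of i] by (auto simp: inj_on_def)
    then show ?thesis unfolding points_cyclic[OF cyc JT] by simp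
  qed
  have ne: "{e. points (?G e) \<noteq> {}} = ?d ` ideal_pairs J"
    unfolding points_cyclic[OF cyc JT] by auto
  have "euler_characteristic F (?G e) = 1" if "e \<in> ?d ` ideal_pairs J" for e
  proof -
    obtain N where N: "points (?G e) = {N}" using pt \<open>e \<in> ?d ` ideal_pairs J\<close> by blast
    have fr: "{N. \<exists>s. frame A M e s N} = {N}" using N by (simp add: quiver_grassmannian_def Let_def)
    show ?thesis
    proof (rule euler_characteristic_point[OF N])
      show "{N} \<in> zopen (?G e)"
        using fr by (auto simp: quiver_grassmannian_def Let_def intro!: bexI[OF _ frame_poly.const[of 1]])
      show "(\<lambda>_. c) \<in> regular (?G e) {N}" for c
        unfolding quiver_grassmannian_def Let_def variety.simps
      proof (intro CollectI allI impI)
        fix N' s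
        show "\<exists>h\<in>frame_poly A M e. \<exists>h'\<in>frame_poly A M e. h' s \<noteq> 0 \<and>
            (\<forall>N' s'. N' \<in> {N} \<and> frame A M e s' N' \<and> h' s' \<noteq> 0 \<longrightarrow> c = h s' / h' s')"
          by (rule bexI[OF bexI[OF _ frame_poly.const[of 1]] frame_poly.const[of c]]) simp
      qed
    qed
  qed
  then have "(\<Sum>e | points (?G e) \<noteq> {}. euler_characteristic F (?G e)) = int (card (?d ` ideal_pairs J))"
    unfolding ne by simp
  then show ?thesis unfolding CC_def by (simp only: card_image[OF dim_vec_inj[OF JT]])
qed

section \<open>The cyclic modules are indecomposable, finite-dimensional and tau-rigid\<close>

text \<open>M is local. If w = w b + w b', the constant coefficients of b and b' at i add up to 1,
  so one of them is nonzero and the corresponding summand contains w.\<close>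

lemma cyclic_indecomposable:
  assumes cyc: "cyclic_at M w i J T" and JT: "proj_or_loop J T"
  shows "indecomposable A M"
proof -
  have w: "w \<in> carrier M" "carrier M = range (act M w)" "\<And>b. act M w b = \<zero>\<^bsub>M\<^esub> \<longleftrightarrow> b \<in> ann i J T"
    by (rule cyclic_atD[OF cyc])+
  have full: "N = carrier M" if N: "rsubmodule A N M" "act M w b \<in> N" "lp0 b i \<noteq> 0" for N b
  proof -
    have sub: "N \<subseteq> carrier M" using N(1) additive_subgroup.a_subset by (auto simp: rsubmodule_def)
    have N_act: "act M x c \<in> N" if "x \<in> N" for x c
      using N(1) that by (simp add: rsubmodule_def act_def)
    obtain y where y: "ee i * b * y = ee i" using jac_unit[OF N(3)] .
    have "act M (act M w b) y = act M (act M (act M w (ee i)) b) y"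
      by (simp only: cyclic_at_ee(1)[OF cyc JT])
    also have "\<dots> = act M w (ee i * b * y)" using w(1) by (simp add: act_mult)
    also have "\<dots> = w" by (simp only: y cyclic_at_ee(1)[OF cyc JT])
    finally have "w \<in> N" using N_act[OF N(2), of y] by simp
    then show ?thesis using sub w(2) N_act by auto
  qed
  show ?thesis
    unfolding indecomposable_def
  proof (intro conjI allI impI)
    show "carrier M \<noteq> {\<zero>\<^bsub>M\<^esub>}" using w(1) cyclic_at_ee(2)[OF cyc JT] by blast
    fix N N' assume "rsubmodule A N M \<and> rsubmodule A N' M \<and> N <+>\<^bsub>M\<^esub> N' = carrier M \<and> N \<inter> N' = {\<zero>\<^bsub>M\<^esub>}"
    then have N: "rsubmodule A N M" "rsubmodule A N' M" "N <+>\<^bsub>M\<^esub> N' = carrier M" "N \<inter> N' = {\<zero>\<^bsub>M\<^esub>}"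
      by auto
    have sub: "N \<subseteq> carrier M" "N' \<subseteq> carrier M"
      using N(1,2) additive_subgroup.a_subset by (auto simp: rsubmodule_def)
    have "w \<in> N <+>\<^bsub>M\<^esub> N'" unfolding N(3) by (rule w(1))
    then obtain n n' where n: "n \<in> N" "n' \<in> N'" "w = n \<oplus>\<^bsub>M\<^esub> n'" unfolding set_add_def' by blast
    have "n \<in> range (act M w)" "n' \<in> range (act M w)"
      using n sub unfolding w(2) [symmetric] by auto
    then obtain b b' where b: "n = act M w b" "n' = act M w b'" by blast
    have "act M w (b + b') = act M w 1" using n(3) w(1) by (simp add: b act_plus)
    then have "b + b' - 1 \<in> ann i J T" unfolding cyclic_at_eq_iff[OF cyc] .
    then have "lp0 b i + lp0 b' i = 1" using ann_lp0[OF JT] by fastforce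
    then have "lp0 b i \<noteq> 0 \<or> lp0 b' i \<noteq> 0" by auto
    then have "N = carrier M \<or> N' = carrier M"
      using full[OF N(1), of b] full[OF N(2), of b'] n(1,2) unfolding b by blast
    then show "N = {\<zero>\<^bsub>M\<^esub>} \<or> N' = {\<zero>\<^bsub>M\<^esub>}" using N(4) sub by blast
  qed
qed

text \<open>The definition asks for a spanning set, while a family may take the same value several
  times. The coefficients of coinciding members have to be added.\<close>

lemma finite_dimensionalI:
  assumes T: "finite T" "\<And>t. t \<in> T \<Longrightarrow> m t \<in> carrier M"
    and gen: "\<And>x. x \<in> carrier M \<Longrightarrow> \<exists>c. x = (\<Oplus>\<^bsub>M\<^esub>t\<in>T. act M (m t) (sc (c t)))"
  shows "finite_dimensional A M"
proof -
  let ?B = "m ` T"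
  have B: "finite ?B" "?B \<subseteq> carrier M" using T by auto
  have "\<exists>d. (\<Oplus>\<^bsub>M\<^esub>t\<in>T'. act M (m t) (sc (c t))) = (\<Oplus>\<^bsub>M\<^esub>b\<in>?B. act M b (sc (d b)))"
    if "finite T'" "T' \<subseteq> T" for T' and c
    using that
  proof (induction T' rule: finite_induct)
    case empty
    have "(\<Oplus>\<^bsub>M\<^esub>b\<in>?B. act M b (sc 0)) = (\<Oplus>\<^bsub>M\<^esub>b\<in>?B. \<zero>\<^bsub>M\<^esub>)"
      by (rule M.finsum_cong') (use T(2) in \<open>auto simp: sc_simps\<close>)
    then show ?case by (intro exI[of _ "\<lambda>_. 0"]) simp
  next
    case (insert t T')
    then obtain d where d: "(\<Oplus>\<^bsub>M\<^esub>t\<in>T'. act M (m t) (sc (c t))) = (\<Oplus>\<^bsub>M\<^esub>b\<in>?B. act M b (sc (d b)))" by auto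
    let ?b = "m t" and ?C = "m ` T - {m t}"
    \<comment> \<open>The value m t may already have a coefficient from other indices, so c t is
      added to it.\<close>
    let ?d = "d(?b := d ?b + c t)"
    have t: "?b \<in> carrier M" "?b \<in> ?B" using insert.prems T(2) by auto
    have C: "finite ?C" "?b \<notin> ?C" "?B = insert ?b ?C" "?C \<subseteq> carrier M" using T t(2) by auto
    have S: "(\<Oplus>\<^bsub>M\<^esub>b\<in>?B. act M b (sc (e b))) = act M ?b (sc (e ?b)) \<oplus>\<^bsub>M\<^esub> (\<Oplus>\<^bsub>M\<^esub>b\<in>?C. act M b (sc (e b)))" for e
    proof -
      have "(\<Oplus>\<^bsub>M\<^esub>b\<in>insert ?b ?C. act M b (sc (e b))) =
          act M ?b (sc (e ?b)) \<oplus>\<^bsub>M\<^esub> (\<Oplus>\<^bsub>M\<^esub>b\<in>?C. act M b (sc (e b)))"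
        by (rule M.finsum_insert[OF C(1,2)]) (use C(4) t(1) in auto)
      then show ?thesis unfolding C(3) [symmetric] .
    qed
    have "(\<Oplus>\<^bsub>M\<^esub>b\<in>?C. act M b (sc (?d b))) = (\<Oplus>\<^bsub>M\<^esub>b\<in>?C. act M b (sc (d b)))"
      by (rule M.finsum_cong') (use C(4) in auto)
    then have "(\<Oplus>\<^bsub>M\<^esub>b\<in>?B. act M b (sc (?d b))) =
        (act M ?b (sc (c t)) \<oplus>\<^bsub>M\<^esub> act M ?b (sc (d ?b))) \<oplus>\<^bsub>M\<^esub> (\<Oplus>\<^bsub>M\<^esub>b\<in>?C. act M b (sc (d b)))"
      unfolding S using t(1) by (simp add: sc_simps act_plus M.a_comm)
    also have "\<dots> = act M ?b (sc (c t)) \<oplus>\<^bsub>M\<^esub> (\<Oplus>\<^bsub>M\<^esub>b\<in>?B. act M b (sc (d b)))"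
      unfolding S using t(1) C(4) by (subst M.a_assoc) (auto intro!: M.finsum_closed)
    also have "\<dots> = (\<Oplus>\<^bsub>M\<^esub>t\<in>insert t T'. act M (m t) (sc (c t)))"
      unfolding d [symmetric]
      by (rule M.finsum_insert [symmetric]) (use insert T(2) in auto)
    finally show ?case by metis
  qed
  from this[OF T(1) subset_refl] have "\<exists>d. x = (\<Oplus>\<^bsub>M\<^esub>b\<in>?B. act M b (sc (d b)))" if "x \<in> carrier M" for x
    using gen[OF that] by metis
  then show ?thesis
    unfolding finite_dimensional_def using B by (intro exI[of _ ?B]) (simp add: scal_A act_def)
qed

lemma cyclic_finite_dimensional:
  assumes w: "w \<in> carrier M" "carrier M = range (act M w)"
  shows "finite_dimensional A M"
proof -
  let ?\<beta> = "\<lambda>(v, k). [ee v, zz * ee v, zz * zz * ee v, zz * zz * zz * ee v, av v, zz * av v] ! k"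
  let ?T = "(UNIV :: vert set) \<times> {..<6::nat}"
  show ?thesis
  proof (rule finite_dimensionalI[of ?T "\<lambda>t. act M w (?\<beta> t)"])
    fix x assume "x \<in> carrier M"
    then obtain b where b: "x = act M w b" using w(2) by blast
    let ?c = "\<lambda>(v, k). [lp0 b v, lp1 b v, lp2 b v, lp3 b v, ar0 b v, ar1 b v] ! k"
    have "b = (\<Sum>t\<in>?T. ?\<beta> t * sc (?c t))"
      unfolding sum.cartesian_product'
      by (subst jac_expand) (simp add: numeral_eq_Suc lessThan_Suc add_ac)
    then have "x = act M w (\<Sum>t\<in>?T. ?\<beta> t * sc (?c t))" using b by simp
    also have "\<dots> = (\<Oplus>\<^bsub>M\<^esub>t\<in>?T. act M w (?\<beta> t * sc (?c t)))"
      by (rule act_sum) (simp_all add: w(1))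
    also have "\<dots> = (\<Oplus>\<^bsub>M\<^esub>t\<in>?T. act M (act M w (?\<beta> t)) (sc (?c t)))"
      by (simp only: act_mult[OF w(1)])
    finally show "\<exists>c. x = (\<Oplus>\<^bsub>M\<^esub>t\<in>?T. act M (act M w (?\<beta> t)) (sc (c t)))"
      by (rule exI[of _ ?c])
  qed (use w(1) in auto)
qed

end

context jac_algebra
begin

text \<open>For P_i the term P_1 is zero. For P_i / a_i \<Lambda> it is the projective at
  \<open>oth i\<close>, a vertex at which the module is zero. Both cases satisfy the criterion
  \<open>tau_rigidI\<close>.\<close>

lemma cyclic_tau_rigid:
  assumes M: "M \<in> mod_fd A" and cyc: "cyclic_at M w i J T" and JT: "proj_or_loop J T"
  shows "tau_rigid A M"
proof -
  obtain a b f q where pres: "minimal_presentation A a b f q M"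
    and AR: "AR_translate A M = (nakayama A b)
        \<lparr> carrier := hom_kernel (nakayama A b) (nakayama A a) (nakayama_map A b a f) \<rparr>"
    using AR_translate_presentation[OF M] by blast
  interpret min_pres_AR A \<psi> M a b f q
    by unfold_locales (use M in \<open>simp add: mod_fd_def\<close>, rule pres, rule AR)
  show ?thesis
  proof (rule tau_rigidI)
    fix j x assume bj: "0 < b j" and x: "x \<in> carrier M"
    have "J = 2" "T = 0"
      using JT cyc proj_presentation bj by (auto simp: proj_or_loop_def)
    then have cyc': "cyclic_at M w i 2 0" using cyc by simp
    then have j: "j = oth i" using loop_presentation bj by (auto split: if_splits)
    have w: "w \<in> carrier M" "carrier M = range (act M w)" "\<And>b. act M w b = \<zero>\<^bsub>M\<^esub> \<longleftrightarrow> b \<in> ann i 2 0"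
      by (rule cyclic_atD[OF cyc'])+
    obtain c where "x = act M w c" using x w(2) by blast
    then have "act M x (ee j) = act M w (c * ee j)" using act_mult[OF w(1)] by simp
    also have "\<dots> = \<zero>\<^bsub>M\<^esub>" unfolding w(3) j by (simp add: ann_2_0)
    finally show "act M x (ee j) = \<zero>\<^bsub>M\<^esub>" .
  qed
qed

section \<open>Isomorphism classes and existence\<close>

lemma cyclic_iso:
  assumes M: "right_module A M" "cyclic_at M w i J T" and N: "right_module A N" "cyclic_at N w' i J T"
  shows "rmod_iso A M N"
proof -
  interpret M: jac_module A \<psi> M by unfold_locales (rule M)
  interpret N: jac_module A \<psi> N by unfold_locales (rule N)
  have w: "w \<in> carrier M" "carrier M = range (act M w)" by (rule cyclic_atD[OF M(2)])+
  have w': "w' \<in> carrier N" "carrier N = range (act N w')" by (rule cyclic_atD[OF N(2)])+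
  let ?f = "\<lambda>x\<in>carrier M. act N w' (SOME b. act M w b = x)"
  have f: "?f (act M w b) = act N w' b" for b
  proof -
    have "act M w (SOME c. act M w c = act M w b) = act M w b" by (rule someI[of _ b]) simp
    then have "act N w' (SOME c. act M w c = act M w b) = act N w' b"
      unfolding M.cyclic_at_eq_iff[OF M(2)] N.cyclic_at_eq_iff[OF N(2)] .
    then show ?thesis using w(1) by simp
  qed
  have "?f \<in> rhom A M N"
    unfolding rhom_def
  proof (intro CollectI conjI ballI)
    show "?f \<in> carrier M \<rightarrow>\<^sub>E carrier N" using w'(1) by auto
    fix x assume "x \<in> carrier M"
    then obtain b where b: "x = act M w b" using w(2) by blast
    show "?f (x \<oplus>\<^bsub>M\<^esub> y) = ?f x \<oplus>\<^bsub>N\<^esub> ?f y" if y: "y \<in> carrier M" for y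
    proof -
      obtain c where c: "y = act M w c" using y w(2) by blast
      show ?thesis unfolding b c M.act_plus[OF w(1), symmetric] f by (rule N.act_plus[OF w'(1)])
    qed
    show "?f (r \<odot>\<^bsub>M\<^esub> x) = r \<odot>\<^bsub>N\<^esub> ?f x" if r: "r \<in> carrier A" for r
    proof -
      obtain c where c: "r = \<psi> c" using r by (auto simp: carrier_A)
      show ?thesis
        unfolding b c act_def [symmetric] M.act_mult[OF w(1), symmetric] N.act_mult[OF w'(1), symmetric] f
        by (rule refl)
    qed
  qed
  moreover have "bij_betw ?f (carrier M) (carrier N)"
    unfolding bij_betw_def
  proof
    show "inj_on ?f (carrier M)"
    proof (rule inj_onI)
      fix x y assume xy: "x \<in> carrier M" "y \<in> carrier M" "?f x = ?f y"
      then obtain b c where bc: "x = act M w b" "y = act M w c" using w(2) by blast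
      show "x = y"
        using xy(3) unfolding bc f M.cyclic_at_eq_iff[OF M(2)] N.cyclic_at_eq_iff[OF N(2)] .
    qed
    have "?f ` carrier M = range (\<lambda>b. ?f (act M w b))" unfolding w(2) by (simp only: image_image)
    then show "?f ` carrier M = carrier N" unfolding f w'(2) .
  qed
  ultimately show ?thesis unfolding rmod_iso_def by blast
qed

lemma iso_cyclic:
  assumes M: "right_module A M" "cyclic_at M w i J T" and N: "right_module A N" and iso: "rmod_iso A M N"
  obtains w' where "cyclic_at N w' i J T"
proof -
  interpret M: jac_module A \<psi> M by unfold_locales (rule M)
  interpret N: jac_module A \<psi> N by unfold_locales (rule N)
  have w: "w \<in> carrier M" "carrier M = range (act M w)" "\<And>b. act M w b = \<zero>\<^bsub>M\<^esub> \<longleftrightarrow> b \<in> ann i J T"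
    by (rule cyclic_atD[OF M(2)])+
  obtain f where f: "f \<in> rhom A M N" "bij_betw f (carrier M) (carrier N)"
    using iso by (auto simp: rmod_iso_def)
  have fw: "f w \<in> carrier N" using f(2) w(1) by (auto simp: bij_betw_def)
  have fact: "act N (f w) b = f (act M w b)" for b
    using f(1) w(1) psi_closed by (auto simp: rhom_def act_def)
  have f0: "f \<zero>\<^bsub>M\<^esub> = \<zero>\<^bsub>N\<^esub>" using fact[of 0] w(1) fw by simp
  have "act N (f w) b = \<zero>\<^bsub>N\<^esub> \<longleftrightarrow> b \<in> ann i J T" for b
  proof -
    have "f (act M w b) = f \<zero>\<^bsub>M\<^esub> \<longleftrightarrow> act M w b = \<zero>\<^bsub>M\<^esub>"
      using f(2) w(1) M.act_closed[OF w(1)] by (auto simp: bij_betw_def inj_on_def)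
    then show ?thesis by (simp only: fact f0 w(3))
  qed
  moreover have "carrier N = range (act N (f w))"
  proof -
    have "carrier N = f ` carrier M" using f(2) by (simp add: bij_betw_def)
    also have "\<dots> = f ` range (act M w)" using w(2) by (rule arg_cong)
    also have "\<dots> = range (act N (f w))" by (simp only: image_image fact [symmetric])
    finally show ?thesis .
  qed
  ultimately have "cyclic_at N (f w) i J T" using fw by (simp add: cyclic_at_def)
  then show thesis by (rule that)
qed

text \<open>The quotient of \<open>e\<^sub>i jac\<close> by \<open>ann i J T\<close>, in coordinates.\<close>

lemma cyclic_exists:
  assumes JT: "proj_or_loop J T"
  shows "\<exists>(M :: ('r, nat \<Rightarrow> 'k) module) w. M \<in> mod_fd A \<and> cyclic_at M w i J T"
proof -
  define \<pi> :: "'k jac \<Rightarrow> nat \<Rightarrow> 'k" where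
    \<comment> \<open>The J loop coefficients and the T arrow coefficients are placed one after the
      other in a sequence.\<close>
    "\<pi> b = (\<lambda>n. if n < J then lpc b i n else if n < J + T then arc b i (n - J) else 0)" for b
  have \<pi>_add: "\<pi> (x + y) = \<pi> x + \<pi> y" for x y
    by (auto simp: \<pi>_def fun_eq_iff lpc_arc_linear)
  have \<pi>_eq: "\<pi> x = \<pi> y \<longleftrightarrow> x - y \<in> ann i J T" for x y
  proof
    assume e: "\<pi> x = \<pi> y"
    have "lpc x i k = lpc y i k" if "k < J" for k
      using fun_cong[OF e, of k] that by (simp add: \<pi>_def)
    moreover have "arc x i k = arc y i k" if "k < T" for k
      using fun_cong[OF e, of "J + k"] that by (simp add: \<pi>_def)
    ultimately show "x - y \<in> ann i J T" by (simp add: ann_def lpc_arc_linear)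
  next
    assume "x - y \<in> ann i J T"
    then show "\<pi> x = \<pi> y" by (auto simp: \<pi>_def ann_def lpc_arc_linear fun_eq_iff)
  qed
  define M :: "('r, nat \<Rightarrow> 'k) module" where
    "M = \<lparr>carrier = range \<pi>, mult = undefined, one = undefined, zero = \<pi> 0,
       add = (\<lambda>f g. f + g), smult = (\<lambda>r f. \<pi> ((SOME b. \<pi> b = f) * \<phi> r))\<rparr>"
  have M: "carrier M = range \<pi>" "\<zero>\<^bsub>M\<^esub> = \<pi> 0" "\<pi> x \<oplus>\<^bsub>M\<^esub> \<pi> y = \<pi> (x + y)" for x y
    by (simp_all add: M_def \<pi>_add)
  have sm: "\<psi> c \<odot>\<^bsub>M\<^esub> \<pi> b = \<pi> (b * c)" for b c
  proof -
    have "\<pi> (SOME x. \<pi> x = \<pi> b) = \<pi> b" by (rule someI[of _ b]) simp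
    \<comment> \<open>The action is defined through an arbitrary representative; it is independent
      of it because \<open>ann i J T\<close> is a right ideal.\<close>
    then have "((SOME x. \<pi> x = \<pi> b) - b) * c \<in> ann i J T"
      unfolding \<pi>_eq by (rule ann_mult_right[OF JT])
    then have "\<pi> ((SOME x. \<pi> x = \<pi> b) * c) = \<pi> (b * c)"
      unfolding \<pi>_eq left_diff_distrib .
    then show ?thesis by (simp add: M_def)
  qed
  have "abelian_group M"
  proof (rule abelian_groupI)
    fix x assume "x \<in> carrier M"
    then obtain b where b: "x = \<pi> b" by (auto simp: M)
    have "\<pi> (- b) \<oplus>\<^bsub>M\<^esub> x = \<zero>\<^bsub>M\<^esub>" by (simp only: b M left_minus)
    then show "\<exists>y\<in>carrier M. y \<oplus>\<^bsub>M\<^esub> x = \<zero>\<^bsub>M\<^esub>" by (auto simp only: M(1) intro!: bexI)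
    show "\<zero>\<^bsub>M\<^esub> \<oplus>\<^bsub>M\<^esub> x = x" by (simp only: b M add_0)
  next
    show "\<zero>\<^bsub>M\<^esub> \<in> carrier M" by (simp only: M(1,2) rangeI)
    fix x y z assume "x \<in> carrier M" "y \<in> carrier M"
    then obtain b c where bc: "x = \<pi> b" "y = \<pi> c" by (auto simp: M)
    show "x \<oplus>\<^bsub>M\<^esub> y \<in> carrier M" by (simp only: bc M(1,3) rangeI)
    show "x \<oplus>\<^bsub>M\<^esub> y = y \<oplus>\<^bsub>M\<^esub> x" by (simp only: bc M(3) add.commute)
    assume "z \<in> carrier M"
    then obtain d where d: "z = \<pi> d" by (auto simp: M)
    show "x \<oplus>\<^bsub>M\<^esub> y \<oplus>\<^bsub>M\<^esub> z = x \<oplus>\<^bsub>M\<^esub> (y \<oplus>\<^bsub>M\<^esub> z)" by (simp only: bc d M(3) add.assoc)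
  qed
  then have "right_module A M"
    unfolding right_module_def carrier_A M(1)
    by (auto simp: M(3) sm add_A mult_A one_A algebra_simps)
  then interpret M: jac_module A \<psi> M by unfold_locales
  have cyc: "cyclic_at M (\<pi> 1) i J T"
    unfolding cyclic_at_def act_def sm M(1,2) by (intro conjI rangeI allI) (simp_all add: \<pi>_eq)
  then have "M \<in> mod_fd A"
    using M.cyclic_finite_dimensional M.right_module by (auto simp: mod_fd_def cyclic_at_def)
  then show ?thesis using cyc by blast
qed

lemma indec_tau_rigid_iff:
  assumes M: "M \<in> mod_fd A"
  shows "M \<in> indec_tau_rigid A \<longleftrightarrow> (\<exists>w i J T. proj_or_loop J T \<and> cyclic_at M w i J T)"
proof
  assume "M \<in> indec_tau_rigid A"
  then have ind: "indecomposable A M" and rigid: "tau_rigid A M" by (auto simp: indec_tau_rigid_def)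
  obtain a b f q where pres: "minimal_presentation A a b f q M"
    and AR: "AR_translate A M = (nakayama A b)
        \<lparr> carrier := hom_kernel (nakayama A b) (nakayama A a) (nakayama_map A b a f) \<rparr>"
    using AR_translate_presentation[OF M] by blast
  interpret min_pres_AR A \<psi> M a b f q
    by unfold_locales (use M in \<open>simp add: mod_fd_def\<close>, rule pres, rule AR)
  obtain w i J T where "proj_or_loop J T" "cyclic_at M w i J T"
    by (rule tau_rigid_cyclic[OF ind rigid])
  then show "\<exists>w i J T. proj_or_loop J T \<and> cyclic_at M w i J T"
    by (intro exI conjI)
next
  assume "\<exists>w i J T. proj_or_loop J T \<and> cyclic_at M w i J T"
  then obtain w i J T where JT: "proj_or_loop J T" and cyc: "cyclic_at M w i J T" by blast
  interpret jac_module A \<psi> M by unfold_locales (use M in \<open>simp add: mod_fd_def\<close>)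
  show "M \<in> indec_tau_rigid A"
    using M cyclic_tau_rigid[OF M cyc JT] cyclic_indecomposable[OF cyc JT] by (simp add: indec_tau_rigid_def)
qed

end

section \<open>The values of the Caldero-Chapoton map\<close>

definition cc_value :: "vert \<Rightarrow> nat \<Rightarrow> vert laurent" where
  "cc_value i J = (if J = 4 then Poly_Mapping.single (- (\<lambda>j. if j = i then 1 else 0)) 9
     else Poly_Mapping.single (- (\<lambda>j. if j = i then 1 else - 1)) 3)"

lemma cc_value_lmono: "cc_value V1 4 = lmono 9 (-1) 0" "cc_value V2 4 = lmono 9 0 (-1)"
  "cc_value V1 2 = lmono 3 (-1) 1" "cc_value V2 2 = lmono 3 1 (-1)"
proof -
  have "- (\<lambda>j. if j = V1 then 1 else 0) = case_vert (-1) (0::int)"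
    "- (\<lambda>j. if j = V2 then 1 else 0) = case_vert 0 (-1::int)"
    "- (\<lambda>j. if j = V1 then 1 else - 1) = case_vert (-1) (1::int)"
    "- (\<lambda>j. if j = V2 then 1 else - 1) = case_vert 1 (-1::int)"
    by (auto simp: fun_eq_iff split: vert.splits)
  then show "cc_value V1 4 = lmono 9 (-1) 0" "cc_value V2 4 = lmono 9 0 (-1)"
    "cc_value V1 2 = lmono 3 (-1) 1" "cc_value V2 2 = lmono 3 1 (-1)"
    by (simp_all only: cc_value_def lmono_def if_True if_False refl) simp_all
qed

lemma lmono_eq_iff: "c \<noteq> 0 \<Longrightarrow> lmono c p q = lmono c' p' q' \<longleftrightarrow> c = c' \<and> p = p' \<and> q = q'"
proof
  assume c: "c \<noteq> 0" and e: "lmono c p q = lmono c' p' q'"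
  have "Poly_Mapping.lookup (lmono c p q) (case_vert p q) = Poly_Mapping.lookup (lmono c' p' q') (case_vert p q)"
    by (simp only: e)
  then have "c = (if case_vert p' q' = case_vert p q then c' else 0)"
    by (simp add: lmono_def lookup_single when_def)
  then have cv: "c = c'" "case_vert p' q' = case_vert p q" using c by (auto split: if_splits)
  have "p' = p" "q' = q"
    using fun_cong[OF cv(2), of V1] fun_cong[OF cv(2), of V2] by (simp_all only: vert.case)
  then show "c = c' \<and> p = p' \<and> q = q'" using cv(1) by simp
qed auto

text \<open>When the relation is equality of h-values, h is constant on each class and
  \<open>the_elem\<close> extracts the common value.\<close>

lemma bij_betw_quotient:
  assumes "r = {(x, y) \<in> S \<times> S. h x = h y}"
  shows "bij_betw (\<lambda>C. the_elem (h ` C)) (S // r) (h ` S)"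
proof -
  have cls: "h ` (r `` {x}) = {h x}" if "x \<in> S" for x
    using that by (auto simp: assms)
  have eq: "r `` {x} = {y \<in> S. h y = h x}" if "x \<in> S" for x
    using that by (auto simp: assms)
  show ?thesis
    unfolding bij_betw_def
  proof
    show "inj_on (\<lambda>C. the_elem (h ` C)) (S // r)"
    proof (rule inj_onI)
      fix C D assume "C \<in> S // r" "D \<in> S // r" and e: "the_elem (h ` C) = the_elem (h ` D)"
      then obtain x y where xy: "x \<in> S" "C = r `` {x}" "y \<in> S" "D = r `` {y}" by (auto elim!: quotientE)
      then have "h x = h y" using e cls by simp
      then show "C = D" using xy eq by simp
    qed
    have "(\<lambda>C. the_elem (h ` C)) ` (S // r) = (\<lambda>x. the_elem (h ` (r `` {x}))) ` S"
      by (auto simp: quotient_def)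
    also have "\<dots> = h ` S" by (rule image_cong) (simp_all add: cls)
    finally show "(\<lambda>C. the_elem (h ` C)) ` (S // r) = h ` S" .
  qed
qed

context jac_algebra
begin

lemma CC_eq_cc_value:
  assumes M: "M \<in> mod_fd A" and cyc: "cyclic_at M w i J T" and JT: "proj_or_loop J T"
  shows "CC F A M = cc_value i J"
proof -
  interpret jac_module A \<psi> M by unfold_locales (use M in \<open>simp add: mod_fd_def\<close>)
  show ?thesis
    using CC_cyclic[OF cyc JT, of F] g_vector_cyclic[OF M] cyc JT
    by (auto simp: proj_or_loop_def cc_value_def card_ideal_pairs)
qed

lemma cc_value_inj:
  assumes "cc_value i J = cc_value i' J'" "proj_or_loop J T" "proj_or_loop J' T'"
  shows "i = i' \<and> J = J' \<and> T = T'"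
  using assms
  by (cases i; cases i') (auto simp: proj_or_loop_def cc_value_lmono lmono_eq_iff)

text \<open>The Laurent monomial determines the vertex and the pair (J, T), and these determine the
  module up to isomorphism.\<close>

lemma iso_iff_CC:
  assumes "M \<in> indec_tau_rigid A" "N \<in> indec_tau_rigid A"
  shows "rmod_iso A M N \<longleftrightarrow> CC F A M = CC F A N"
proof -
  have M: "M \<in> mod_fd A" and N: "N \<in> mod_fd A" using assms by (auto simp: indec_tau_rigid_def)
  have rm: "right_module A M" "right_module A N" using M N by (auto simp: mod_fd_def)
  obtain w i J T where JT: "proj_or_loop J T" and cM: "cyclic_at M w i J T"
    using indec_tau_rigid_iff[OF M] assms(1) by blast
  obtain w' i' J' T' where JT': "proj_or_loop J' T'" and cN: "cyclic_at N w' i' J' T'"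
    using indec_tau_rigid_iff[OF N] assms(2) by blast
  note CM = CC_eq_cc_value[OF M cM JT, of F] and CN = CC_eq_cc_value[OF N cN JT', of F]
  show ?thesis
  proof
    assume "rmod_iso A M N"
    then obtain v where "cyclic_at N v i J T" using iso_cyclic[OF rm(1) cM rm(2)] by blast
    from CC_eq_cc_value[OF N this JT, of F] show "CC F A M = CC F A N" using CM by simp
  next
    assume "CC F A M = CC F A N"
    then have "cc_value i J = cc_value i' J'" using CM CN by simp
    then have "i = i' \<and> J = J' \<and> T = T'" by (rule cc_value_inj[OF _ JT JT'])
    then show "rmod_iso A M N" using cyclic_iso[OF rm(1) cM rm(2)] cN by simp
  qed
qed

lemma CC_image:
  "CC F A ` (indec_tau_rigid A :: ('r, nat \<Rightarrow> 'k) module set) =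
    {lmono 3 (-1) 1, lmono 3 1 (-1), lmono 9 (-1) 0, lmono 9 0 (-1)}"
proof -
  have "CC F A ` (indec_tau_rigid A :: ('r, nat \<Rightarrow> 'k) module set) =
      {cc_value i J | i J. J = 4 \<or> J = 2}"
  proof
    show "CC F A ` (indec_tau_rigid A :: ('r, nat \<Rightarrow> 'k) module set) \<subseteq> {cc_value i J | i J. J = 4 \<or> J = 2}"
    proof
      fix y assume "y \<in> CC F A ` (indec_tau_rigid A :: ('r, nat \<Rightarrow> 'k) module set)"
      then obtain M :: "('r, nat \<Rightarrow> 'k) module" where M: "M \<in> indec_tau_rigid A" "y = CC F A M" by blast
      then have fd: "M \<in> mod_fd A" by (simp add: indec_tau_rigid_def)
      obtain w i J T where JT: "proj_or_loop J T" and cM: "cyclic_at M w i J T"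
        using indec_tau_rigid_iff[OF fd] M(1) by blast
      have "y = cc_value i J" unfolding M(2) by (rule CC_eq_cc_value[OF fd cM JT])
      then show "y \<in> {cc_value i J | i J. J = 4 \<or> J = 2}" using JT by (auto simp: proj_or_loop_def)
    qed
    show "{cc_value i J | i J. J = 4 \<or> J = 2} \<subseteq> CC F A ` (indec_tau_rigid A :: ('r, nat \<Rightarrow> 'k) module set)"
    proof
      fix y assume "y \<in> {cc_value i J | i J. J = 4 \<or> J = 2}"
      then obtain i J where y: "y = cc_value i J" "J = 4 \<or> J = 2" by blast
      then obtain T where JT: "proj_or_loop J T" by (auto simp: proj_or_loop_def)
      obtain M :: "('r, nat \<Rightarrow> 'k) module" and w where M: "M \<in> mod_fd A" "cyclic_at M w i J T"
        using cyclic_exists[OF JT] by blast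
      then have "M \<in> indec_tau_rigid A" using indec_tau_rigid_iff[OF M(1)] JT by blast
      moreover have "y = CC F A M" unfolding y(1) by (rule CC_eq_cc_value[OF M JT, symmetric])
      ultimately show "y \<in> CC F A ` (indec_tau_rigid A :: ('r, nat \<Rightarrow> 'k) module set)" by blast
    qed
  qed
  also have "\<dots> = {cc_value V1 4, cc_value V2 4, cc_value V1 2, cc_value V2 2}"
    by (auto intro: vert.exhaust) (metis vert.exhaust)+
  finally show ?thesis unfolding cc_value_lmono by blast
qed

end

lemma prime_char_nonzero:
  assumes "CHAR('k::field) \<noteq> p" "prime p"
  shows "(of_nat p :: 'k) \<noteq> 0"
proof
  assume "(of_nat p :: 'k) = 0"
  then have "CHAR('k) dvd p" by (simp add: of_nat_eq_0_iff_char_dvd)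
  then have "CHAR('k) = 1" using assms by (auto simp: prime_nat_iff)
  then show False by simp
qed

theorem theorem4p15:
  fixes \<Lambda> :: "(((vert, arr) path \<Rightarrow> 'k::alg_closed_field) set, 'k, vert) vertex_algebra"
    and S :: "(((vert, arr) path \<Rightarrow> 'k) set, nat \<Rightarrow> 'k) module set"
    and F :: "'f::{field,finite} itself"
  assumes "CHAR('k) \<noteq> 2" and "CHAR('k) \<noteq> 3"
    and "CHAR('f) \<noteq> CHAR('k)"
  defines "\<Lambda> \<equiv> Lambda12"
    and "S \<equiv> indec_tau_rigid \<Lambda>"
  shows "CC F \<Lambda> respects iso_on \<Lambda> S \<and>
    bij_betw (\<lambda>C. the_elem (CC F \<Lambda> ` C)) (S // iso_on \<Lambda> S)
      (cluster_variables gca12 - initial_variables gca12) \<and>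
    cluster_variables gca12 - initial_variables gca12 =
      {lmono 3 (-1) 1, lmono 3 1 (-1), lmono 9 (-1) 0, lmono 9 0 (-1)}"
proof -
  \<comment> \<open>Invertibility of 3 normalises the relations, and that of 2 makes both structure
    constants \<open>kap\<close> nonzero.\<close>
  have two: "(2::'k) \<noteq> 0" and three: "(3::'k) \<noteq> 0"
    using prime_char_nonzero[of 2, where 'k = 'k] prime_char_nonzero[of 3, where 'k = 'k] assms(1,2)
    by simp_all
  interpret jac_algebra \<Lambda> jac_coset
    unfolding \<Lambda>_def
    by unfold_locales (use inj_jac_coset two Lambda12_simps[OF three two] in simp_all)
  \<comment> \<open>Isomorphism classes are the fibres of the Caldero-Chapoton map, so bijectivity
    reduces to the computation of its image.\<close>
  have iso: "iso_on \<Lambda> S = {(M, N) \<in> S \<times> S. CC F \<Lambda> M = CC F \<Lambda> N}"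
    unfolding iso_on_def S_def using iso_iff_CC[of _ _ F] by auto
  have vars: "cluster_variables gca12 - initial_variables gca12 =
      {lmono 3 (-1) 1, lmono 3 1 (-1), lmono 9 (-1) 0, lmono 9 0 (-1)}"
    by (simp add: gca12_def Let_def insert_Diff_if lmono_eq_iff)
  show ?thesis
    using bij_betw_quotient[OF iso] CC_image[of F] unfolding S_def [symmetric] vars
    by (auto simp: iso congruent_def)
qed

end
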